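(* Let $\ell\ge 0$ be an integer and let $Q$ be a quiver of type $\mathbb A_\ell$ with orientation $\tau$. The set of complete central charges for $Q$ is nonempty, and consists precisely of those $\alpha:Q_0\to\mathbb R$ satisfying $$\mu_\alpha(\mathbf I_\tau[a_0,b_0])>\mu_\alpha(\mathbf I_\tau[a_1,b_1])>\cdots>\mu_\alpha(\mathbf I_\tau[a_{\chi(\ell)},b_{\chi(\ell)}]),$$ $$\mu_\alpha(\mathbf I_\tau[a'_0,b'_0])<\mu_\alpha(\mathbf I_\tau[a'_1,b'_1])<\cdots<\mu_\alpha(\mathbf I_\tau[a'_{\eta(\ell)},b'_{\eta(\ell)}]).$$ In particular, if $Q$ is equioriented (every $\tau_i=1$, i.e. representations are ordinary persistence modules), then $\alpha$ is complete for $Q$ if and only if $\alpha(x_i)>\alpha(x_{i+1})$ for all $i\in\{0,1,\ldots,\ell-1\}$.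
   Context: Fix a field $\mathbb F$. For a finite quiver $Q=(s,t:Q_1\to Q_0)$, $\mathrm{Rep}(Q)$ is the abelian category of finite-dimensional representations over $\mathbb F$; $\underline{\dim}_V:Q_0\to\mathbb N$ is the dimension vector $x\mapsto\dim V_x$. A central charge is a function $\alpha:Q_0\to\mathbb R$. The $\alpha$-slope of a nonzero $V$ is $\mu_\alpha(V)=\frac{\sum_{x}\alpha(x)\dim V_x}{\sum_x\dim V_x}$; $V\neq 0$ is $\alpha$-semistable if $\mu_\alpha(U)\le\mu_\alpha(V)$ for every nonzero subrepresentation $U\subset V$. Every nonzero $V$ has a unique Harder-Narasimhan (HN) filtration along $\alpha$: a finite filtration $0=V^0\subsetneq\cdots\subsetneq V^n=V$ whose quotients $S^i=V^i/V^{i-1}$ are $\alpha$-semistable with $\mu_\alpha(S^1)>\cdots>\mu_\alpha(S^n)$. The HN type is $\mathbf T[V;\alpha]=(\underline{\dim}_{S^1},\ldots,\underline{\dim}_{S^n})$ (the zero representation has empty HN type). A central charge $\alpha$ is complete for $Q$ if $\mathbf T[V;\alpha]=\mathbf T[W;\alpha]$ implies $V\simeq W$ for all $V,W\in\mathrm{Rep}(Q)$. A quiver of type $\mathbb A_\ell$ has vertices $x_0,\ldots,x_\ell$ and edges $e_1,\ldots,e_\ell$, where $e_i$ joins $x_{i-1}$ and $x_i$; its orientation is $\tau=(\tau_1,\ldots,\tau_\ell)\in\{0,1\}^\ell$, with $\tau_i=1$ if $e_i$ points $x_{i-1}\to x_i$ and $\tau_i=0$ if $e_i$ points $x_i\to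 x_{i-1}$. For integers $0\le a\le b\le\ell$, $\mathbf I_\tau[a,b]\in\mathrm{Rep}(Q)$ is the interval module with $\mathbb F$ at $x_a,\ldots,x_b$ and $0$ elsewhere, with identity maps between copies of $\mathbb F$ and zero maps otherwise. Define $\chi,\eta:\{0,\ldots,\ell\}\to\mathbb N$ by $\chi(0)=\eta(0)=0$ and, for $1\le i\le\ell$: $\chi(i)=\chi(i-1)+1$, $\eta(i)=\eta(i-1)$ if $\tau_i=1$; and $\chi(i)=\chi(i-1)$, $\eta(i)=\eta(i-1)+1$ if $\tau_i=0$. The level sets $\{i\mid\chi(i)=k\}=[a_k,b_k]$ for $0\le k\le\chi(\ell)$ and $\{i\mid\eta(i)=k\}=[a'_k,b'_k]$ for $0\le k\le\eta(\ell)$ are intervals of integers, which defines $a_k,b_k,a'_k,b'_k$. *)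

theory Defs
  imports Complex_Main "HOL-Library.Function_Algebras" "HOL-Library.FuncSet" "Graph_Theory.Digraph"
begin

section \<open>The ambient vector space\<close>

text \<open>
  Representation spaces are finite-dimensional subspaces of the infinite-dimensional space of
  all sequences over the field.  Every finite-dimensional vector space is isomorphic to such a
  subspace, so up to isomorphism no representation is lost.
\<close>

definition seq_scale :: "'f::field \<Rightarrow> (nat \<Rightarrow> 'f) \<Rightarrow> (nat \<Rightarrow> 'f)" where
  "seq_scale c v = (\<lambda>n. c * v n)"

global_interpretation seqs: vector_space "seq_scale :: 'f::field \<Rightarrow> (nat \<Rightarrow> 'f) \<Rightarrow> (nat \<Rightarrow> 'f)"
  by unfold_locales (auto simp: seq_scale_def fun_eq_iff algebra_simps)

definition fd_subspace :: "(nat \<Rightarrow> 'f::field) set \<Rightarrow> bool" where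
  "fd_subspace S \<longleftrightarrow> seqs.subspace S \<and> (\<exists>B. finite B \<and> seqs.span B = S)"

definition linear_between ::
    "(nat \<Rightarrow> 'f::field) set \<Rightarrow> (nat \<Rightarrow> 'f) set \<Rightarrow> ((nat \<Rightarrow> 'f) \<Rightarrow> (nat \<Rightarrow> 'f)) \<Rightarrow> bool" where
  "linear_between S T f \<longleftrightarrow>
     (\<forall>v\<in>S. f v \<in> T) \<and>
     (\<forall>v\<in>S. \<forall>w\<in>S. f (v + w) = f v + f w) \<and>
     (\<forall>c. \<forall>v\<in>S. f (seq_scale c v) = seq_scale c (f v))"


section \<open>Representations of quivers\<close>

text \<open>
  A finite quiver is a finite directed multigraph (locale \<open>fin_digraph\<close>).  The values of
  \<open>rspace\<close> and \<open>rmap\<close> at non-vertices and non-arcs, and those of a structure map outside the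
  space at its tail, are irrelevant: nothing below depends on them.
\<close>

record ('a, 'e, 'f) qrep =
  rspace :: "'a \<Rightarrow> (nat \<Rightarrow> 'f) set"
  rmap :: "'e \<Rightarrow> (nat \<Rightarrow> 'f) \<Rightarrow> (nat \<Rightarrow> 'f)"

definition is_rep :: "('a, 'e) pre_digraph \<Rightarrow> ('a, 'e, 'f::field) qrep \<Rightarrow> bool" where
  "is_rep Q V \<longleftrightarrow>
     (\<forall>x\<in>verts Q. fd_subspace (rspace V x)) \<and>
     (\<forall>e\<in>arcs Q. linear_between (rspace V (tail Q e)) (rspace V (head Q e)) (rmap V e))"

definition zero_rep :: "('a, 'e) pre_digraph \<Rightarrow> ('a, 'e, 'f::field) qrep \<Rightarrow> bool" where
  "zero_rep Q V \<longleftrightarrow> (\<forall>x\<in>verts Q. rspace V x = {0})"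

definition rep_morphism ::
    "('a, 'e) pre_digraph \<Rightarrow> ('a, 'e, 'f::field) qrep \<Rightarrow> ('a, 'e, 'f) qrep \<Rightarrow>
     ('a \<Rightarrow> (nat \<Rightarrow> 'f) \<Rightarrow> (nat \<Rightarrow> 'f)) \<Rightarrow> bool" where
  "rep_morphism Q V W \<phi> \<longleftrightarrow>
     (\<forall>x\<in>verts Q. linear_between (rspace V x) (rspace W x) (\<phi> x)) \<and>
     (\<forall>e\<in>arcs Q. \<forall>v\<in>rspace V (tail Q e).
        \<phi> (head Q e) (rmap V e v) = rmap W e (\<phi> (tail Q e) v))"

definition rep_iso ::
    "('a, 'e) pre_digraph \<Rightarrow> ('a, 'e, 'f::field) qrep \<Rightarrow> ('a, 'e, 'f) qrep \<Rightarrow> bool" where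
  "rep_iso Q V W \<longleftrightarrow>
     (\<exists>\<phi>. rep_morphism Q V W \<phi> \<and>
          (\<forall>x\<in>verts Q. bij_betw (\<phi> x) (rspace V x) (rspace W x)))"

definition subrep ::
    "('a, 'e) pre_digraph \<Rightarrow> ('a, 'e, 'f::field) qrep \<Rightarrow> ('a, 'e, 'f) qrep \<Rightarrow> bool" where
  "subrep Q U V \<longleftrightarrow>
     is_rep Q U \<and>
     (\<forall>x\<in>verts Q. rspace U x \<subseteq> rspace V x) \<and>
     (\<forall>e\<in>arcs Q. \<forall>v\<in>rspace U (tail Q e). rmap U e v = rmap V e v)"

definition same_spaces ::
    "('a, 'e) pre_digraph \<Rightarrow> ('a, 'e, 'f::field) qrep \<Rightarrow> ('a, 'e, 'f) qrep \<Rightarrow> bool" where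
  "same_spaces Q U V \<longleftrightarrow> (\<forall>x\<in>verts Q. rspace U x = rspace V x)"

text \<open>
  \<open>is_quotient Q V U S\<close>: the representation \<open>S\<close> is (a model of) the quotient \<open>V/U\<close>, i.e. there is
  a short exact sequence \<open>0 \<rightarrow> U \<rightarrow> V \<rightarrow> S \<rightarrow> 0\<close> whose first map is the inclusion.  Such an \<open>S\<close>
  always exists and is unique up to isomorphism.
\<close>

definition is_quotient ::
    "('a, 'e) pre_digraph \<Rightarrow> ('a, 'e, 'f::field) qrep \<Rightarrow> ('a, 'e, 'f) qrep \<Rightarrow> ('a, 'e, 'f) qrep \<Rightarrow> bool"
    where
  "is_quotient Q V U S \<longleftrightarrow>
     subrep Q U V \<and> is_rep Q S \<and>
     (\<exists>\<pi>. rep_morphism Q V S \<pi> \<and>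
          (\<forall>x\<in>verts Q. \<pi> x ` rspace V x = rspace S x \<and>
                       {v \<in> rspace V x. \<pi> x v = 0} = rspace U x))"

definition dim_vector :: "('a, 'e) pre_digraph \<Rightarrow> ('a, 'e, 'f::field) qrep \<Rightarrow> ('a \<Rightarrow> nat)" where
  "dim_vector Q V = (\<lambda>x\<in>verts Q. seqs.dim (rspace V x))"


section \<open>Central charges and Harder--Narasimhan types\<close>

text \<open>
  A central charge is a function \<open>\<alpha> :: 'a \<Rightarrow> real\<close>; only its values on the vertices are used.
\<close>

definition slope ::
    "('a, 'e) pre_digraph \<Rightarrow> ('a \<Rightarrow> real) \<Rightarrow> ('a, 'e, 'f::field) qrep \<Rightarrow> real" where
  "slope Q \<alpha> V =
     (\<Sum>x\<in>verts Q. \<alpha> x * real (dim_vector Q V x)) / (\<Sum>x\<in>verts Q. real (dim_vector Q V x))"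

definition semistable ::
    "('a, 'e) pre_digraph \<Rightarrow> ('a \<Rightarrow> real) \<Rightarrow> ('a, 'e, 'f::field) qrep \<Rightarrow> bool" where
  "semistable Q \<alpha> V \<longleftrightarrow>
     is_rep Q V \<and> \<not> zero_rep Q V \<and>
     (\<forall>U. subrep Q U V \<and> \<not> zero_rep Q U \<longrightarrow> slope Q \<alpha> U \<le> slope Q \<alpha> V)"

text \<open>
  \<open>F 0, \<dots>, F n\<close> is the filtration of \<open>V\<close> and \<open>S 1, \<dots>, S n\<close> are its successive quotients.
\<close>

definition HN_filtration ::
    "('a, 'e) pre_digraph \<Rightarrow> ('a \<Rightarrow> real) \<Rightarrow> ('a, 'e, 'f::field) qrep \<Rightarrow> nat \<Rightarrow>
     (nat \<Rightarrow> ('a, 'e, 'f) qrep) \<Rightarrow> (nat \<Rightarrow> ('a, 'e, 'f) qrep) \<Rightarrow> bool" where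
  "HN_filtration Q \<alpha> V n F S \<longleftrightarrow>
     (\<forall>i\<in>{0..n}. subrep Q (F i) V) \<and>
     zero_rep Q (F 0) \<and> same_spaces Q (F n) V \<and>
     (\<forall>i\<in>{1..n}. subrep Q (F (i - 1)) (F i) \<and> \<not> same_spaces Q (F (i - 1)) (F i)) \<and>
     (\<forall>i\<in>{1..n}. is_quotient Q (F i) (F (i - 1)) (S i) \<and> semistable Q \<alpha> (S i)) \<and>
     (\<forall>i\<in>{1..<n}. slope Q \<alpha> (S i) > slope Q \<alpha> (S (i + 1)))"

definition is_HN_type ::
    "('a, 'e) pre_digraph \<Rightarrow> ('a \<Rightarrow> real) \<Rightarrow> ('a, 'e, 'f::field) qrep \<Rightarrow> ('a \<Rightarrow> nat) list \<Rightarrow> bool"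
    where
  "is_HN_type Q \<alpha> V T \<longleftrightarrow>
     (\<exists>n F S. HN_filtration Q \<alpha> V n F S \<and> T = map (\<lambda>i. dim_vector Q (S i)) [1..<n + 1])"

definition HN_type ::
    "('a, 'e) pre_digraph \<Rightarrow> ('a \<Rightarrow> real) \<Rightarrow> ('a, 'e, 'f::field) qrep \<Rightarrow> ('a \<Rightarrow> nat) list" where
  "HN_type Q \<alpha> V = (THE T. is_HN_type Q \<alpha> V T)"

text \<open>The \<open>itself\<close> argument names the ground field.\<close>

definition complete_charge ::
    "'f::field itself \<Rightarrow> ('a, 'e) pre_digraph \<Rightarrow> ('a \<Rightarrow> real) \<Rightarrow> bool" where
  "complete_charge _ Q \<alpha> \<longleftrightarrow>
     (\<forall>V W :: ('a, 'e, 'f) qrep.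
        is_rep Q V \<and> is_rep Q W \<and> HN_type Q \<alpha> V = HN_type Q \<alpha> W \<longrightarrow> rep_iso Q V W)"


section \<open>Quivers of type A\<close>

text \<open>
  The vertex \<open>x\<^sub>i\<close> is the number \<open>i\<close> and the edge \<open>e\<^sub>i\<close> is the number \<open>i\<close>.  The orientation is a
  predicate: \<open>\<tau> i\<close> holds iff \<open>\<tau>\<^sub>i = 1\<close>, for \<open>i\<close> between 1 and \<open>l\<close>.
\<close>

definition A_quiver :: "nat \<Rightarrow> (nat \<Rightarrow> bool) \<Rightarrow> (nat, nat) pre_digraph" where
  "A_quiver l \<tau> =
     \<lparr>verts = {0..l}, arcs = {1..l},
      tail = (\<lambda>i. if \<tau> i then i - 1 else i),
      head = (\<lambda>i. if \<tau> i then i else i - 1)\<rparr>"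

lemma fin_digraph_A_quiver: "fin_digraph (A_quiver l \<tau>)"
  by unfold_locales (auto simp: A_quiver_def)

text \<open>The copy of the field used below is the line of sequences supported at index 0.\<close>

definition field_line :: "(nat \<Rightarrow> 'f::field) set" where
  "field_line = {v. \<forall>n>0. v n = 0}"

text \<open>
  The interval module does not mention \<open>\<tau>\<close>: the edge \<open>i\<close> joins \<open>i - 1\<close> and \<open>i\<close> in either
  orientation, and its structure map is the identity or zero.
\<close>

definition interval_rep :: "nat \<Rightarrow> nat \<Rightarrow> (nat, nat, 'f::field) qrep" where
  "interval_rep a b =
     \<lparr>rspace = (\<lambda>x. if a \<le> x \<and> x \<le> b then field_line else {0}),
      rmap = (\<lambda>i v. if a \<le> i - 1 \<and> i \<le> b then v else 0)\<rparr>"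

lemma is_rep_interval_rep:
  "is_rep (A_quiver l \<tau>) (interval_rep a b :: (nat, nat, 'f::field) qrep)"
proof -
  let ?u = "(\<lambda>n. if n = 0 then 1 else 0) :: nat \<Rightarrow> 'f"
  have sub: "seqs.subspace (field_line :: (nat \<Rightarrow> 'f) set)"
    by (rule seqs.subspaceI) (auto simp: field_line_def seq_scale_def)
  have "seqs.span {?u} = field_line"
  proof
    show "seqs.span {?u} \<subseteq> field_line"
      by (rule seqs.span_minimal) (simp_all add: sub, simp add: field_line_def)
    show "field_line \<subseteq> seqs.span {?u}"
    proof
      fix v :: "nat \<Rightarrow> 'f" assume "v \<in> field_line"
      then have "v = seq_scale (v 0) ?u"
        by (auto simp: field_line_def seq_scale_def fun_eq_iff)
      then show "v \<in> seqs.span {?u}"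
        by (metis seqs.span_base seqs.span_scale singletonI)
    qed
  qed
  with sub have line: "fd_subspace (field_line :: (nat \<Rightarrow> 'f) set)"
    unfolding fd_subspace_def by (intro conjI exI[of _ "{?u}"]) simp_all
  have triv: "fd_subspace ({0} :: (nat \<Rightarrow> 'f) set)"
    unfolding fd_subspace_def
    by (intro conjI exI[of _ "{}"]) simp_all
  have "0 \<in> (field_line :: (nat \<Rightarrow> 'f) set)" "\<And>c. seq_scale c (0 :: nat \<Rightarrow> 'f) = 0"
    by (auto simp: field_line_def seq_scale_def fun_eq_iff)
  then show ?thesis
    using line triv
    by (auto simp: is_rep_def interval_rep_def A_quiver_def linear_between_def)
qed

primrec chi :: "(nat \<Rightarrow> bool) \<Rightarrow> nat \<Rightarrow> nat" where
  "chi \<tau> 0 = 0"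
| "chi \<tau> (Suc i) = (if \<tau> (Suc i) then chi \<tau> i + 1 else chi \<tau> i)"

primrec eta :: "(nat \<Rightarrow> bool) \<Rightarrow> nat \<Rightarrow> nat" where
  "eta \<tau> 0 = 0"
| "eta \<tau> (Suc i) = (if \<tau> (Suc i) then eta \<tau> i else eta \<tau> i + 1)"

text \<open>The interval module on the level set of \<open>f\<close> at height \<open>k\<close>, where \<open>f\<close> is \<open>chi \<tau>\<close> or \<open>eta \<tau>\<close>.\<close>

definition level_rep :: "nat \<Rightarrow> (nat \<Rightarrow> nat) \<Rightarrow> nat \<Rightarrow> (nat, nat, 'f::field) qrep" where
  "level_rep l f k = interval_rep (Min {i \<in> {0..l}. f i = k}) (Max {i \<in> {0..l}. f i = k})"

end

theory Submission
  imports Defs "HOL-Library.Product_Lexorder"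
begin

text \<open>
  Every representation is a direct sum of interval modules: order the strings that reach the last
  vertex so that earlier ones may be added to later ones, and reduce the kernel or the image of the
  next structure map to echelon form. A charge is complete if and only if all interval modules are
  stable. If they are, the summands of slope \<open>s\<close> form the factor of slope \<open>s\<close> of the
  Harder--Narasimhan filtration, and among intervals of equal slope the left end determines the
  right end, so the type determines the multiplicities. Conversely, a shortest unstable interval is
  a non-split extension of two stable ones, the subobject having at least the slope of the quotient;
  it has the same type as their direct sum.

  In terms of the partial sums \<open>P\<^sub>i = \<alpha>\<^sub>0 + \<dots> + \<alpha>\<^sub>i\<^sub>-\<^sub>1\<close>, stability of all intervals says that
  \<open>P\<^sub>b\<close> lies strictly above every chord spanning \<open>b\<close> if \<open>\<tau>\<^sub>b = 1\<close> and strictly below if \<open>\<tau>\<^sub>b = 0\<close>.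
  The two chains of inequalities say that the points with \<open>\<tau>\<^sub>b = 1\<close> and the end points span a
  strictly concave polygon, and those with \<open>\<tau>\<^sub>b = 0\<close> and the end points a strictly convex one.
\<close>

section \<open>Finite-dimensional spaces of sequences\<close>

text \<open>A type is introduced by a definite description, so its uniqueness has to come before any
  statement about completeness. For \<open>s\<close> different from all slopes, the step of a
  filtration that collects the slopes above \<open>s\<close> maximises the sum of
  \<open>(\<alpha> x - s) * dim U x\<close> over all subrepresentations \<open>U\<close>, and every
  maximiser has the same dimension vector; these truncations determine the type.

  A subrepresentation of a direct sum need not be a sum of subrepresentations of the summands. Its
  dimension is therefore counted by the leading terms of its elements, which reduces the degree
  estimate to one string at a time. Only triangularity of the structure maps enters, so the same
  estimate serves direct sums and non-split extensions.

  If subobject and quotient of the extension have equal slopes, the filtration has one step instead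
  of two; that case needs semistability of the extension itself.

  Negating the charge while reversing all arrows exchanges the two chains of inequalities, so only
  one of them is treated.\<close>

interpretation seqs_pair: vector_space_pair
  "seq_scale :: 'f::field \<Rightarrow> (nat \<Rightarrow> 'f) \<Rightarrow> (nat \<Rightarrow> 'f)" seq_scale
  by unfold_locales

section \<open>Indexed bases of subspaces\<close>

definition lin_comb :: "'j set \<Rightarrow> ('j \<Rightarrow> 'f::field) \<Rightarrow> ('j \<Rightarrow> nat \<Rightarrow> 'f) \<Rightarrow> nat \<Rightarrow> 'f" where
  "lin_comb J c b = (\<Sum>j\<in>J. seq_scale (c j) (b j))"

text \<open>An indexed basis. The index is the label of a string and keeps its meaning from vertex
  to vertex, which a basis given as a set of vectors could not express.\<close>

definition frame :: "'j set \<Rightarrow> ('j \<Rightarrow> nat \<Rightarrow> 'f::field) \<Rightarrow> (nat \<Rightarrow> 'f) set \<Rightarrow> bool" where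
  "frame J b S \<longleftrightarrow>
     finite J \<and> inj_on b J \<and> seqs.independent (b ` J) \<and> seqs.span (b ` J) = S"

lemma lin_comb_cong:
  "(\<And>j. j \<in> J \<Longrightarrow> c j = c' j) \<Longrightarrow> (\<And>j. j \<in> J \<Longrightarrow> b j = b' j) \<Longrightarrow> lin_comb J c b = lin_comb J c' b'"
  by (simp add: lin_comb_def)

lemma lin_comb_mem:
  "seqs.subspace S \<Longrightarrow> (\<And>j. j \<in> J \<Longrightarrow> b j \<in> S) \<Longrightarrow> lin_comb J c b \<in> S"
  unfolding lin_comb_def by (intro seqs.subspace_sum seqs.subspace_scale) auto

lemma span_image_lin_comb:
  assumes "finite J"
  shows "seqs.span (b ` J) = range (\<lambda>c. lin_comb J c b)"
proof
  show "range (\<lambda>c. lin_comb J c b) \<subseteq> seqs.span (b ` J)"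
    using lin_comb_mem[OF seqs.subspace_span, of J b] by (auto simp: seqs.span_base)
  show "seqs.span (b ` J) \<subseteq> range (\<lambda>c. lin_comb J c b)"
  proof (rule seqs.span_minimal)
    have "b j = lin_comb J (\<lambda>i. if i = j then 1 else 0) b" if "j \<in> J" for j
    proof -
      have "lin_comb J (\<lambda>i. if i = j then 1 else 0) b = (\<Sum>i\<in>J. if i = j then b i else 0)"
        unfolding lin_comb_def by (intro sum.cong) auto
      also have "\<dots> = b j" using assms that by simp
      finally show ?thesis by simp
    qed
    then show "b ` J \<subseteq> range (\<lambda>c. lin_comb J c b)" by blast
    show "seqs.subspace (range (\<lambda>c. lin_comb J c b))"
    proof (rule seqs.subspaceI)
      have "lin_comb J (\<lambda>_. 0) b = 0" by (simp add: lin_comb_def)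
      then show "0 \<in> range (\<lambda>c. lin_comb J c b)" by (metis rangeI)
      fix x y assume "x \<in> range (\<lambda>c. lin_comb J c b)" "y \<in> range (\<lambda>c. lin_comb J c b)"
      then obtain c d where "x = lin_comb J c b" "y = lin_comb J d b" by blast
      then have "x + y = lin_comb J (\<lambda>j. c j + d j) b"
        by (simp add: lin_comb_def seqs.scale_left_distrib sum.distrib)
      then show "x + y \<in> range (\<lambda>c. lin_comb J c b)" by blast
    next
      fix x k assume "x \<in> range (\<lambda>c. lin_comb J c b)"
      then obtain c where "x = lin_comb J c b" by blast
      then have "seq_scale k x = lin_comb J (\<lambda>j. k * c j) b"
        by (simp add: lin_comb_def seqs.scale_sum_right)
      then show "seq_scale k x \<in> range (\<lambda>c. lin_comb J c b)" by blast
    qed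
  qed
qed

lemma frame_insert:
  assumes "k \<notin> J"
  shows "frame (insert k J) b S \<longleftrightarrow>
    frame J b (seqs.span (b ` J)) \<and> b k \<notin> seqs.span (b ` J) \<and> S = seqs.span (insert (b k) (b ` J))"
  using assms seqs.independent_insert[of "b k" "b ` J"]
  by (auto simp: frame_def image_iff intro: seqs.span_base split: if_splits)

lemma frame_empty: "frame {} b S \<longleftrightarrow> S = {0}"
  by (auto simp: frame_def seqs.independent_empty)

lemma frame_cong: "(\<And>j. j \<in> J \<Longrightarrow> b j = b' j) \<Longrightarrow> frame J b S \<longleftrightarrow> frame J b' S"
  unfolding frame_def by (metis image_cong inj_on_cong)

lemma frame_subset: "frame J b S \<Longrightarrow> J' \<subseteq> J \<Longrightarrow> frame J' b (seqs.span (b ` J'))"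
  unfolding frame_def
  by (metis finite_subset image_mono inj_on_subset seqs.independent_mono)

lemma frame_subspace: "frame J b S \<Longrightarrow> seqs.subspace S"
  by (auto simp: frame_def)

lemma frame_fd: "frame J b S \<Longrightarrow> fd_subspace S"
  unfolding fd_subspace_def frame_def by (auto intro!: exI[of _ "b ` J"])

lemma frame_dim: "frame J b S \<Longrightarrow> seqs.dim S = card J"
  unfolding frame_def using seqs.dim_span_eq_card_independent card_image by metis

lemma frame_mem: "frame J b S \<Longrightarrow> j \<in> J \<Longrightarrow> b j \<in> S"
  unfolding frame_def using seqs.span_base by blast

lemma frame_eq_lin_comb: "frame J b S \<Longrightarrow> S = range (\<lambda>c. lin_comb J c b)"
  unfolding frame_def using span_image_lin_comb by blast

lemma frame_lin_comb_zero:
  assumes "frame J b S" "lin_comb J c b = 0" "j \<in> J"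
  shows "c j = 0"
proof -
  have fin: "finite (b ` J)" and ind: "seqs.independent (b ` J)" and inj: "inj_on b J"
    using assms(1) by (auto simp: frame_def)
  have "(\<Sum>v\<in>b ` J. seq_scale (c (the_inv_into J b v)) v) = 0"
    using assms(2) by (simp add: sum.reindex[OF inj] lin_comb_def the_inv_into_f_f[OF inj])
  then have "c (the_inv_into J b (b j)) = 0"
    using seqs.independentD[OF ind fin subset_refl, of "\<lambda>v. c (the_inv_into J b v)" "b j"] assms(3) by simp
  then show ?thesis by (simp add: the_inv_into_f_f[OF inj assms(3)])
qed

lemma frameI:
  fixes J :: "'j set" and b :: "'j \<Rightarrow> nat \<Rightarrow> 'f::field"
  assumes "finite J" and S: "S = range (\<lambda>c. lin_comb J c b)"
    and zero: "\<And>(c :: 'j \<Rightarrow> 'f) j. lin_comb J c b = 0 \<Longrightarrow> j \<in> J \<Longrightarrow> c j = 0"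
  shows "frame J b S"
proof -
  have inj: "inj_on b J"
  proof (rule inj_onI, rule ccontr)
    fix i j assume ij: "i \<in> J" "j \<in> J" "b i = b j" "i \<noteq> j"
    \<comment> \<open>If \<open>b i = b j\<close>, these coefficients give a nontrivial
      relation.\<close>
    let ?c = "\<lambda>k. if k = i then 1 else if k = j then - 1 else 0"

    have "lin_comb J ?c b = (\<Sum>k\<in>{i, j}. seq_scale (?c k) (b k))"
      unfolding lin_comb_def using ij assms(1) by (intro sum.mono_neutral_right) auto
    also have "\<dots> = 0" using ij by simp
    finally show False using zero[of ?c i] ij by simp
  qed
  have "seqs.independent (b ` J)"
  proof (rule seqs.independent_if_scalars_zero)
    show "finite (b ` J)" using assms(1) by simp
    fix f x assume f: "(\<Sum>x\<in>b ` J. seq_scale (f x) x) = 0" and "x \<in> b ` J"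
    then obtain j where j: "j \<in> J" "x = b j" by blast
    have "lin_comb J (f \<circ> b) b = 0" using f by (simp add: sum.reindex[OF inj] lin_comb_def)
    from zero[OF this j(1)] j show "f x = 0" by simp
  qed
  then show ?thesis
    using assms(1) inj S span_image_lin_comb by (auto simp: frame_def)
qed

lemma fd_subspace_subset:
  assumes "fd_subspace S" "seqs.subspace T" "T \<subseteq> S"
  shows "fd_subspace T" "seqs.dim T \<le> seqs.dim S"
proof -
  obtain B0 where B0: "finite B0" "seqs.span B0 = S" using assms(1) by (auto simp: fd_subspace_def)
  obtain B where B: "B \<subseteq> T" "seqs.independent B" "T \<subseteq> seqs.span B"
    using seqs.basis_exists[of T] by metis
  have "finite B" using seqs.independent_span_bound[OF B0(1) B(2)] B B0 assms by blast
  moreover have TB: "seqs.span B = T" using B assms(2) seqs.span_minimal by blast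
  ultimately show "fd_subspace T" using assms(2) by (auto simp: fd_subspace_def)
  obtain C where C: "B \<subseteq> C" "C \<subseteq> S" "seqs.independent C" "S \<subseteq> seqs.span C"
    using seqs.maximal_independent_subset_extend[of B S] B assms(3) by blast
  have "finite C" using seqs.independent_span_bound[OF B0(1) C(3)] C B0 by blast
  moreover have "seqs.span C = S" using C assms(1) seqs.span_minimal[of C S]
    by (auto simp: fd_subspace_def)
  ultimately show "seqs.dim T \<le> seqs.dim S"
    using B(2) C TB seqs.dim_span_eq_card_independent[of B] seqs.dim_span_eq_card_independent[of C]
      card_mono by metis
qed

text \<open>Basis extension with fresh labels. The added vectors will begin new strings, whose
  indices have to differ from those of all strings in \<open>J\<close>, including the ones that have
  already ended; so they are taken beyond a bound for \<open>J \<union> E\<close>.\<close>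

lemma frame_extend:
  assumes "fd_subspace S" "frame E v T" "T \<subseteq> S" "finite J"
  shows "\<exists>N v'. N \<inter> (J :: nat set) = {} \<and> (\<forall>j\<in>E - N. v' j = v j) \<and> N \<inter> E = {} \<and> frame (E \<union> N) v' S"
proof -
  have sub: "seqs.subspace S" using assms(1) by (simp add: fd_subspace_def)
  obtain B0 where B0: "finite B0" "seqs.span B0 = S" using assms(1) by (auto simp: fd_subspace_def)
  have E: "finite E" "inj_on v E" "seqs.independent (v ` E)" "v ` E \<subseteq> S"
    using assms(2,3) frame_mem[OF assms(2)] by (auto simp: frame_def)
  obtain B where B: "v ` E \<subseteq> B" "B \<subseteq> S" "seqs.independent B" "S \<subseteq> seqs.span B"
    using seqs.maximal_independent_subset_extend[OF E(4,3)] by blast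
  have SB: "seqs.span B = S" using B sub seqs.span_minimal by blast
  have "finite B" using seqs.independent_span_bound[OF B0(1) B(3)] B B0 by blast
  then have "finite (B - v ` E)" by simp
  from ex_bij_betw_nat_finite[OF this] obtain h where
    h: "bij_betw h {0..<card (B - v ` E)} (B - v ` E)" by blast
  obtain n where n: "J \<union> E \<subseteq> {..<n}"
    using finite_nat_iff_bounded[of "J \<union> E"] assms(4) E(1) by blast
  let ?m = "card (B - v ` E)"
  let ?N = "{n..<n + ?m}"
  let ?v = "\<lambda>j. if j < n then v j else h (j - n)"
  have "(\<lambda>j. j - n) ` ?N = {0..<?m}"
    by (auto simp: image_iff intro!: bexI[of _ "n + _"])
  then have hN: "?v ` ?N = B - v ` E"
    using h by (auto simp: bij_betw_def image_image[symmetric, of h "\<lambda>j. j - n"])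
  have vE: "?v ` E = v ` E" using n by (intro image_cong) auto
  have injN: "inj_on ?v ?N"
    using h by (auto simp: bij_betw_def inj_on_def)
      (metis atLeastLessThan_iff diff_less_mono le_add_diff_inverse nat_add_left_cancel_less zero_le)
  have "inj_on ?v E" using E(2) n by (auto simp: inj_on_def subset_iff)
  then have "inj_on ?v (E \<union> ?N)"
    using injN hN vE n unfolding inj_on_Un by blast
  moreover have "?v ` (E \<union> ?N) = B" unfolding image_Un hN vE using B(1) by blast
  ultimately have "frame (E \<union> ?N) ?v S"
    using B SB E(1) by (simp add: frame_def)
  moreover have "?N \<inter> J = {}" "?N \<inter> E = {}" "\<forall>j\<in>E - ?N. ?v j = v j" using n by auto
  ultimately show ?thesis by (intro exI[of _ ?N] exI[of _ ?v] conjI)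
qed

lemma fd_frame_exists:
  assumes "fd_subspace S" "finite J"
  shows "\<exists>N v. N \<inter> (J :: nat set) = {} \<and> frame N v S"
proof -
  have "frame {} (\<lambda>_. 0) {0 :: nat \<Rightarrow> 'a}" by (simp add: frame_empty)
  moreover have "{0} \<subseteq> S" using assms(1) by (auto simp: fd_subspace_def intro: seqs.subspace_0)
  ultimately show ?thesis using frame_extend[OF assms(1) _ _ assms(2), of "{}"] by fastforce
qed

section \<open>Linear maps between subspaces\<close>

lemma linear_betweenD:
  assumes "linear_between S T f"
  shows "v \<in> S \<Longrightarrow> f v \<in> T"
    and "v \<in> S \<Longrightarrow> w \<in> S \<Longrightarrow> f (v + w) = f v + f w"
    and "v \<in> S \<Longrightarrow> f (seq_scale c v) = seq_scale c (f v)"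
  using assms by (auto simp: linear_between_def)

lemma linear_between_zero:
  assumes "linear_between S T f" "seqs.subspace S"
  shows "f 0 = 0"
  using linear_betweenD(3)[OF assms(1), of 0 0] seqs.subspace_0[OF assms(2)] by simp

lemma linear_between_diff:
  assumes "linear_between S T f" "seqs.subspace S" "v \<in> S" "w \<in> S"
  shows "f (v - w) = f v - f w"
proof -
  have "f (v + seq_scale (- 1) w) = f v + seq_scale (- 1) (f w)"
    using linear_betweenD[OF assms(1)] assms(2-4) seqs.subspace_scale by metis
  then show ?thesis by simp
qed

lemma linear_between_lin_comb:
  assumes f: "linear_between S T f" and S: "seqs.subspace S" and b: "\<And>j. j \<in> J \<Longrightarrow> b j \<in> S"
  shows "f (lin_comb J c b) = lin_comb J c (\<lambda>j. f (b j))"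
  using b
proof (induction J rule: infinite_finite_induct)
  case (insert k J)
  have "lin_comb J c b \<in> S" using insert.prems by (intro lin_comb_mem[OF S]) auto
  moreover have "seq_scale (c k) (b k) \<in> S" using insert.prems S seqs.subspace_scale by auto
  moreover have "lin_comb (insert k J) c b = seq_scale (c k) (b k) + lin_comb J c b"
    "lin_comb (insert k J) c (\<lambda>j. f (b j)) = seq_scale (c k) (f (b k)) + lin_comb J c (\<lambda>j. f (b j))"
    unfolding lin_comb_def by (rule sum.insert[OF insert.hyps(1,2)])+
  moreover have "f (seq_scale (c k) (b k)) = seq_scale (c k) (f (b k))"
    using linear_betweenD(3)[OF f] insert.prems by simp
  moreover have "f (lin_comb J c b) = lin_comb J c (\<lambda>j. f (b j))"
    using insert.IH insert.prems by blast
  ultimately show ?case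
    using linear_betweenD(2)[OF f] by presburger
qed (auto simp: lin_comb_def linear_between_zero[OF f S])

lemma linear_between_kernel_subspace:
  assumes f: "linear_between S T f" and S: "seqs.subspace S"
  shows "seqs.subspace {v \<in> S. f v = 0}"
  using linear_between_zero[OF f S] linear_betweenD[OF f] S
  by (intro seqs.subspaceI) (auto intro: seqs.subspace_0 seqs.subspace_add seqs.subspace_scale)

lemma linear_between_image_subspace:
  assumes f: "linear_between S T f" and S: "seqs.subspace S"
  shows "seqs.subspace (f ` S)"
proof (rule seqs.subspaceI)
  show "0 \<in> f ` S" using linear_between_zero[OF f S] seqs.subspace_0[OF S] by force
next
  fix x y assume "x \<in> f ` S" "y \<in> f ` S"
  then obtain v w where "v \<in> S" "w \<in> S" "x = f v" "y = f w" by blast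
  then show "x + y \<in> f ` S"
    using linear_betweenD(2)[OF f, of v w] seqs.subspace_add[OF S] by (intro image_eqI[of _ _ "v + w"]) auto
next
  fix x c assume "x \<in> f ` S"
  then obtain v where "v \<in> S" "x = f v" by blast
  then show "seq_scale c x \<in> f ` S"
    using linear_betweenD(3)[OF f, of v c] seqs.subspace_scale[OF S]
    by (intro image_eqI[of _ _ "seq_scale c v"]) auto
qed

lemma linear_between_frame_exists:
  assumes b: "frame J b S" and "seqs.subspace T" and g: "\<And>j. j \<in> J \<Longrightarrow> g j \<in> T"
  shows "\<exists>f. linear_between S T f \<and> (\<forall>j\<in>J. f (b j) = g j)"
proof -
  have ind: "seqs.independent (b ` J)" and inj: "inj_on b J" and S: "S = seqs.span (b ` J)"
    using b by (auto simp: frame_def)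
  obtain f where lin: "Vector_Spaces.linear seq_scale seq_scale f"
    and f: "\<And>x. x \<in> b ` J \<Longrightarrow> f x = g (the_inv_into J b x)"
    using seqs_pair.linear_independent_extend[OF ind, of "\<lambda>x. g (the_inv_into J b x)"] by blast
  have fb: "f (b j) = g j" if "j \<in> J" for j using f that by (simp add: the_inv_into_f_f[OF inj])
  have "f ` S = seqs.span (f ` b ` J)"
    unfolding S using seqs_pair.linear_span_image[OF lin] by simp
  also have "\<dots> \<subseteq> T" using fb g by (intro seqs.span_minimal[OF _ assms(2)]) auto
  finally have "\<forall>v\<in>S. f v \<in> T" by blast
  then have "linear_between S T f"
    using seqs_pair.linear_add[OF lin] seqs_pair.linear_scale[OF lin]
    by (simp add: linear_between_def)
  then show ?thesis using fb by blast
qed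

lemma linear_between_eq_on_frame:
  assumes "frame J b S" "linear_between S T f" "linear_between S T' g"
    and "\<And>j. j \<in> J \<Longrightarrow> f (b j) = g (b j)" and "v \<in> S"
  shows "f v = g v"
proof -
  obtain c where "v = lin_comb J c b" using frame_eq_lin_comb[OF assms(1)] assms(5) by blast
  then show ?thesis
    using linear_between_lin_comb[OF assms(2) frame_subspace[OF assms(1)], of J b c]
      linear_between_lin_comb[OF assms(3) frame_subspace[OF assms(1)], of J b c]
      frame_mem[OF assms(1)] assms(4) by (simp cong: lin_comb_cong)
qed

lemma linear_between_frame_bij:
  assumes b: "frame J b S" and f: "linear_between S T f" and fb: "frame J (\<lambda>j. f (b j)) T"
  shows "bij_betw f S T"
proof -
  note lc = linear_between_lin_comb[OF f frame_subspace[OF b] frame_mem[OF b]]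
  have "inj_on f S"
  proof (rule inj_onI)
    fix v w assume v: "v \<in> S" "w \<in> S" "f v = f w"
    then have d: "v - w \<in> S" "f (v - w) = 0"
      using linear_between_diff[OF f frame_subspace[OF b]] seqs.subspace_diff[OF frame_subspace[OF b]]
      by auto
    obtain c where c: "v - w = lin_comb J c b" using d frame_eq_lin_comb[OF b] by blast
    then have "lin_comb J c (\<lambda>j. f (b j)) = 0" using d lc[where c = c and J = J] by simp
    then have "lin_comb J c b = lin_comb J (\<lambda>_. 0) b"
      using frame_lin_comb_zero[OF fb] by (intro lin_comb_cong) auto
    then show "v = w" using c by (simp add: lin_comb_def)
  qed
  moreover have "f ` S = T"
  proof -
    have "f ` S = range (\<lambda>c. f (lin_comb J c b))"
      by (subst frame_eq_lin_comb[OF b]) (simp add: image_image)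
    also have "\<dots> = T" by (subst frame_eq_lin_comb[OF fb]) (simp add: lc)
    finally show ?thesis .
  qed
  ultimately show ?thesis by (simp add: bij_betw_def)
qed

text \<open>Subtracting from a vector the lift of its image leaves a kernel vector. This is the
  argument for rank-nullity, kept with explicit bases because for an arrow pointing left the lifts
  continue old strings and the kernel vectors begin new ones.\<close>

lemma frame_split:
  assumes f: "linear_between S T f" and S: "seqs.subspace S"
    and Z: "frame Z u (f ` S)" and v: "\<And>j. j \<in> Z \<Longrightarrow> v j \<in> S \<and> f (v j) = u j"
    and N: "frame N v {v \<in> S. f v = 0}" and disj: "Z \<inter> N = {}"
  shows "frame (Z \<union> N) v S"
proof -
  have fin: "finite Z" "finite N" using Z N by (auto simp: frame_def)
  have Un: "lin_comb (Z \<union> N) c v = lin_comb Z c v + lin_comb N c v" for c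
    unfolding lin_comb_def using fin disj by (simp add: sum.union_disjoint)
  have vN: "v j \<in> S" "f (v j) = 0" if "j \<in> N" for j using frame_mem[OF N that] by auto
  have mem: "lin_comb Z c v \<in> S" "lin_comb N c v \<in> S" for c
    using v vN by (auto intro!: lin_comb_mem[OF S])
  have fZ: "f (lin_comb Z c v) = lin_comb Z c u" for c
    using linear_between_lin_comb[OF f S, of Z v c] v by (simp cong: lin_comb_cong)
  have fN: "f (lin_comb N c v) = 0" for c
    using linear_between_lin_comb[OF f S, of N v c] vN by (simp add: lin_comb_def)
  show ?thesis
  proof (rule frameI)
    show "finite (Z \<union> N)" using fin by simp
    show "S = range (\<lambda>c. lin_comb (Z \<union> N) c v)"
    proof
      show "range (\<lambda>c. lin_comb (Z \<union> N) c v) \<subseteq> S" 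
        unfolding Un using seqs.subspace_add[OF S mem(1) mem(2)] by (intro image_subsetI)
      show "S \<subseteq> range (\<lambda>c. lin_comb (Z \<union> N) c v)"
      proof
        fix w assume w: "w \<in> S"
        then obtain c where c: "f w = lin_comb Z c u" using frame_eq_lin_comb[OF Z] by blast
        then have "w - lin_comb Z c v \<in> {v \<in> S. f v = 0}"
          using w mem fZ linear_between_diff[OF f S] seqs.subspace_diff[OF S] by auto
        then obtain d where "w - lin_comb Z c v = lin_comb N d v" using frame_eq_lin_comb[OF N] by blast
        then have "w = lin_comb Z c v + lin_comb N d v" by (metis diff_eq_eq add.commute)
        also have "\<dots> = lin_comb (Z \<union> N) (\<lambda>j. if j \<in> Z then c j else d j) v"
          unfolding Un using disj by (intro arg_cong2[of _ _ _ _ "(+)"] lin_comb_cong) auto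
        finally show "w \<in> range (\<lambda>c. lin_comb (Z \<union> N) c v)" by blast
      qed
    qed
  next
    fix c j assume 0: "lin_comb (Z \<union> N) c v = 0" and j: "j \<in> Z \<union> N"
    have "f (lin_comb Z c v + lin_comb N c v) = lin_comb Z c u"
      using linear_betweenD(2)[OF f mem(1) mem(2)] fZ fN by simp
    then have "lin_comb Z c u = 0" using 0 Un linear_between_zero[OF f S] by simp
    then have cZ: "c i = 0" if "i \<in> Z" for i using frame_lin_comb_zero[OF Z] that by blast
    then have "lin_comb Z c v = 0" by (simp add: lin_comb_def)
    then have "lin_comb N c v = 0" using 0 Un by simp
    then show "c j = 0" using frame_lin_comb_zero[OF N] cZ j by blast
  qed
qed

lemma rank_nullity:
  assumes f: "linear_between S T f" and S: "fd_subspace S"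
  shows "fd_subspace (f ` S)" "seqs.dim S = seqs.dim {v \<in> S. f v = 0} + seqs.dim (f ` S)"
proof -
  have sub: "seqs.subspace S" using S by (simp add: fd_subspace_def)
  obtain B where B: "finite B" "seqs.span B = S" using S by (auto simp: fd_subspace_def)
  have Bid: "S = range (\<lambda>c. lin_comb B c id)"
    using span_image_lin_comb[OF B(1), of id] B(2) by simp
  have BS: "b \<in> S" if "b \<in> B" for b using B that seqs.span_base by blast
  have "f ` S = range (\<lambda>c. f (lin_comb B c id))"
    by (subst Bid) (simp add: image_image)
  also have "\<dots> = range (\<lambda>c. lin_comb B c f)"
    using linear_between_lin_comb[OF f sub, of B id] BS by simp
  also have "\<dots> = seqs.span (f ` B)" using span_image_lin_comb[OF B(1), of f] by simp
  finally show fd: "fd_subspace (f ` S)" using B(1) by (auto simp: fd_subspace_def)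
  obtain Z :: "nat set" and u where Z: "frame Z u (f ` S)"
    using fd_frame_exists[OF fd, of "{}"] by auto
  have K: "fd_subspace {v \<in> S. f v = 0}"
    using fd_subspace_subset(1)[OF S linear_between_kernel_subspace[OF f sub]] by auto
  obtain N n where N: "N \<inter> Z = {}" "frame N n {v \<in> S. f v = 0}"
    using fd_frame_exists[OF K, of Z] Z by (auto simp: frame_def)
  have "\<forall>j\<in>Z. \<exists>w. w \<in> S \<and> f w = u j" using frame_mem[OF Z] by fastforce
  then obtain w where w: "\<forall>j\<in>Z. w j \<in> S \<and> f (w j) = u j" by metis
  have N': "frame N (\<lambda>j. if j \<in> Z then w j else n j) {v \<in> S. f v = 0}"
    using N by (subst frame_cong[of N _ n]) auto
  have ZN: "frame (Z \<union> N) (\<lambda>j. if j \<in> Z then w j else n j) S"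
    using w N(1) by (intro frame_split[OF f sub Z _ N']) auto
  then show "seqs.dim S = seqs.dim {v \<in> S. f v = 0} + seqs.dim (f ` S)"
    using frame_dim[OF Z] frame_dim[OF N(2)] frame_dim[OF ZN] N(1) Z N(2)
      card_Un_disjoint[of Z N] by (simp add: frame_def Int_commute)
qed

lemma fd_dim_zero:
  assumes "fd_subspace S" "seqs.dim S = 0"
  shows "S = {0}"
proof -
  obtain N :: "nat set" and v where "frame N v S" using fd_frame_exists[OF assms(1), of "{}"] by auto
  moreover from this have "N = {}" using frame_dim assms(2) by (fastforce simp: frame_def)
  ultimately show ?thesis by (simp add: frame_empty)
qed

section \<open>Triangular changes of basis and echelon form\<close>

lemma rank_induct:
  fixes r :: "'j \<Rightarrow> 'o::linorder"
  assumes "finite J" and r: "inj_on r J" and empty: "P {}"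
    and insert: "\<And>k M. k \<in> J \<Longrightarrow> M = {j \<in> J. r j < r k} \<Longrightarrow> k \<notin> M \<Longrightarrow> P M \<Longrightarrow> P (insert k M)"
  shows "P J"
proof -
  \<comment> \<open>Only initial segments of \<open>J\<close> matter; for them the elements already
    inserted are exactly those below the new one, which is what triangular conditions refer
    to.\<close>
  have "M \<subseteq> J \<longrightarrow> (\<forall>k\<in>M. \<forall>j\<in>J. r j < r k \<longrightarrow> j \<in> M) \<longrightarrow> P M" if "finite M" for M
    using that
  proof (induction rule: finite_ranking_induct[where f = r])
    case (insert k M)
    show ?case
    proof (cases "k \<in> M")
      case True
      then show ?thesis using insert.IH by (simp add: insert_absorb)
    next
      case False
      have "P (insert k M)"
        if MJ: "insert k M \<subseteq> J" and init: "\<forall>i\<in>insert k M. \<forall>j\<in>J. r j < r i \<longrightarrow> j \<in> insert k M"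
      proof -
        have lt: "r j < r k" if "j \<in> M" for j
        proof -
          have "r j \<noteq> r k" using that r MJ False by (auto dest: inj_onD)
          then show ?thesis using insert.hyps(2)[OF that] by simp
        qed
        have "M = {j \<in> J. r j < r k}" using lt init MJ by auto
        moreover have "\<forall>i\<in>M. \<forall>j\<in>J. r j < r i \<longrightarrow> j \<in> M"
          using init lt by (metis insertCI insertE order.asym)
        ultimately show ?thesis using insert.IH MJ False by (intro assms(4)) auto
      qed
      then show ?thesis by blast
    qed
  qed (simp add: empty)
  from this[of J] assms(1) show ?thesis by blast
qed

text \<open>The initial segments of \<open>u\<close> and of \<open>b\<close> span the same spaces,
  so \<open>u k\<close> is independent of its predecessors because \<open>b k\<close> is.\<close>

lemma frame_unitriangular:
  fixes r :: "'j \<Rightarrow> 'o::linorder"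
  assumes b: "frame J b S" and r: "inj_on r J"
    and u: "\<And>k. k \<in> J \<Longrightarrow> u k - b k \<in> seqs.span (b ` {j \<in> J. r j < r k})"
  shows "frame J u S"
proof -
  have "frame J u (seqs.span (b ` J))"
  proof (rule rank_induct[where P = "\<lambda>M. frame M u (seqs.span (b ` M))", OF _ r])
    show "finite J" using b by (simp add: frame_def)
    show "frame {} u (seqs.span (b ` {}))" by (simp add: frame_empty)
    fix k M assume k: "k \<in> J" "k \<notin> M" and M: "M = {j \<in> J. r j < r k}" and F: "frame M u (seqs.span (b ` M))"
    have span: "seqs.span (u ` M) = seqs.span (b ` M)" using F by (simp add: frame_def)
    have "insert k M \<subseteq> J" using k M by auto
    then have "frame (insert k M) b (seqs.span (b ` insert k M))" by (rule frame_subset[OF b])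
    then have bk: "b k \<notin> seqs.span (b ` M)" using frame_insert[OF k(2)] by blast
    have d: "u k - b k \<in> seqs.span (b ` M)" using u[OF k(1)] M by simp
    have "u k \<notin> seqs.span (u ` M)"
      using bk d span seqs.span_diff[of "u k" "b ` M" "u k - b k"] by auto
    moreover have "seqs.span (insert (u k) (u ` M)) = seqs.span (insert (u k) (b ` M))"
      by (simp add: seqs.span_insert span)
    moreover have "\<dots> = seqs.span (b ` insert k M)"
      using seqs.eq_span_insert_eq[OF d] by simp
    ultimately show "frame (insert k M) u (seqs.span (b ` insert k M))"
      using F span frame_insert[OF k(2)] by metis
  qed
  then show ?thesis using b by (simp add: frame_def)
qed

text \<open>The pivots of \<open>K\<close>: the positions of the leading terms, with respect to
  \<open>r\<close>, of the nonzero elements of \<open>K\<close>, normalised to leading coefficient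
  one.\<close>

definition lead :: "'j set \<Rightarrow> ('j \<Rightarrow> nat \<Rightarrow> 'f::field) \<Rightarrow> ('j \<Rightarrow> 'o::linorder) \<Rightarrow> (nat \<Rightarrow> 'f) set \<Rightarrow> 'j set" where
  "lead J b r K = {k \<in> J. \<exists>v\<in>K. v - b k \<in> seqs.span (b ` {j \<in> J. r j < r k})}"

text \<open>At each pivot the basis vector is replaced by an element of \<open>K\<close> with that
  leading term, a unitriangular change. The leading position of a nonzero element of
  \<open>K\<close> is always a pivot, so subtracting a multiple of the new basis vector stays in
  \<open>K\<close> and lowers the position, until nothing is left.\<close>

lemma echelon:
  fixes r :: "'j \<Rightarrow> 'o::linorder"
  assumes b: "frame J b S" and r: "inj_on r J" and K: "seqs.subspace K" "K \<subseteq> S"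
  shows "\<exists>u. (\<forall>k\<in>J. u k - b k \<in> seqs.span (b ` {j \<in> J. r j < r k})) \<and> frame J u S \<and>
    frame (lead J b r K) u K"
proof -
  have "\<forall>k. \<exists>v. k \<in> lead J b r K \<longrightarrow> v \<in> K \<and> v - b k \<in> seqs.span (b ` {j \<in> J. r j < r k})"
    by (auto simp: lead_def)
  then obtain w where w: "w k \<in> K" "w k - b k \<in> seqs.span (b ` {j \<in> J. r j < r k})"
    if "k \<in> lead J b r K" for k by metis
  define u where "u k = (if k \<in> lead J b r K then w k else b k)" for k
  have u: "u k - b k \<in> seqs.span (b ` {j \<in> J. r j < r k})" for k
    using w by (simp add: u_def seqs.span_zero)
  have uK: "u k \<in> K" if "k \<in> lead J b r K" for k using w that by (simp add: u_def)
  have F: "frame J u S" using frame_unitriangular[OF b r u] .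
  have sub: "lead J b r K \<subseteq> J" by (auto simp: lead_def)
  let ?L = "seqs.span (u ` lead J b r K)"
  have "K \<inter> seqs.span (b ` J) \<subseteq> ?L"
  proof (rule rank_induct[where P = "\<lambda>M. K \<inter> seqs.span (b ` M) \<subseteq> ?L", OF _ r])
    show "finite J" using b by (simp add: frame_def)
    show "K \<inter> seqs.span (b ` {}) \<subseteq> ?L" using seqs.span_zero by auto
    fix k M assume kJ: "k \<in> J" and M: "M = {j \<in> J. r j < r k}"
      and IH: "K \<inter> seqs.span (b ` M) \<subseteq> ?L"
    show "K \<inter> seqs.span (b ` insert k M) \<subseteq> ?L"
    proof
      fix v assume v: "v \<in> K \<inter> seqs.span (b ` insert k M)"
      then obtain c where c: "v - seq_scale c (b k) \<in> seqs.span (b ` M)"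
        using seqs.span_breakdown_eq[of v "b k" "b ` M"] by auto
      show "v \<in> ?L"
      proof (cases "c = 0")
        case True
        then show ?thesis using c v IH by auto
      next
        case c0: False
        \<comment> \<open>Division by the leading coefficient shows that \<open>k\<close> is a
          pivot.\<close>
        have "seq_scale (inverse c) (v - seq_scale c (b k)) = seq_scale (inverse c) v - b k"
          using c0 by (simp add: seqs.scale_right_diff_distrib)
        then have "seq_scale (inverse c) v - b k \<in> seqs.span (b ` M)"
          using seqs.span_scale[OF c, of "inverse c"] by simp
        then have k: "k \<in> lead J b r K"
          using kJ M v seqs.subspace_scale[OF K(1)] by (auto simp: lead_def)
        have d: "seq_scale c (u k - b k) \<in> seqs.span (b ` M)"
          using seqs.span_scale[OF u[of k]] M by simp
        have "v - seq_scale c (u k) = v - seq_scale c (b k) - seq_scale c (u k - b k)"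
          by (simp add: seqs.scale_right_diff_distrib)
        then have "v - seq_scale c (u k) \<in> seqs.span (b ` M)"
          using seqs.span_diff[OF c d] by metis
        moreover have "v - seq_scale c (u k) \<in> K"
          using v uK[OF k] K(1) seqs.subspace_scale seqs.subspace_diff by blast
        ultimately have "v - seq_scale c (u k) \<in> ?L" using IH by blast
        moreover have "seq_scale c (u k) \<in> ?L"
          using k by (simp add: seqs.span_scale seqs.span_base)
        ultimately have "(v - seq_scale c (u k)) + seq_scale c (u k) \<in> ?L"
          by (rule seqs.span_add)
        then show ?thesis by simp
      qed
    qed
  qed
  then have "K \<subseteq> ?L" using b K(2) by (auto simp: frame_def)
  moreover have "?L \<subseteq> K"
    using uK by (intro seqs.span_minimal[OF _ K(1)]) auto
  ultimately have "frame (lead J b r K) u K" using frame_subset[OF F sub] by simp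
  then show ?thesis using u F by blast
qed

text \<open>This is how the dimension of a subrepresentation at a vertex becomes a number of
  strings.\<close>

lemma dim_eq_card_lead:
  fixes r :: "'j \<Rightarrow> 'o::linorder"
  assumes "frame J b S" "inj_on r J" "seqs.subspace K" "K \<subseteq> S"
  shows "seqs.dim K = card (lead J b r K)"
  using echelon[OF assms] frame_dim by blast

section \<open>Uniqueness of the Harder--Narasimhan type\<close>

text \<open>Additive substitute for the slope: on a nonzero dimension vector it has the sign of the
  slope minus \<open>s\<close>.\<close>

definition deg :: "('a, 'e) pre_digraph \<Rightarrow> ('a \<Rightarrow> real) \<Rightarrow> real \<Rightarrow> ('a \<Rightarrow> nat) \<Rightarrow> real" where
  "deg Q \<alpha> s d = (\<Sum>x\<in>verts Q. (\<alpha> x - s) * real (d x))"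

definition total_dim :: "('a, 'e) pre_digraph \<Rightarrow> ('a \<Rightarrow> nat) \<Rightarrow> nat" where
  "total_dim Q d = (\<Sum>x\<in>verts Q. d x)"

text \<open>The slope is a function of the dimension vector alone, so the slopes of the factors can
  be read off from the entries of a type.\<close>

definition mean :: "('a, 'e) pre_digraph \<Rightarrow> ('a \<Rightarrow> real) \<Rightarrow> ('a \<Rightarrow> nat) \<Rightarrow> real" where
  "mean Q \<alpha> d = (\<Sum>x\<in>verts Q. \<alpha> x * real (d x)) / (\<Sum>x\<in>verts Q. real (d x))"

lemma slope_eq_mean: "slope Q \<alpha> V = mean Q \<alpha> (dim_vector Q V)"
  by (simp add: slope_def mean_def)

lemma dim_zero: "seqs.dim {0 :: nat \<Rightarrow> 'f::field} = 0"
  using frame_dim[of "{} :: nat set" "\<lambda>_. 0" "{0 :: nat \<Rightarrow> 'f}"] by (simp add: frame_empty)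

lemma deg_cong: "(\<And>x. x \<in> verts Q \<Longrightarrow> d x = d' x) \<Longrightarrow> deg Q \<alpha> s d = deg Q \<alpha> s d'"
  by (simp add: deg_def)

lemma deg_sum: "deg Q \<alpha> s (\<lambda>x. \<Sum>i\<in>I. e i x) = (\<Sum>i\<in>I. deg Q \<alpha> s (e i))"
  unfolding deg_def by (subst sum.swap) (simp add: sum_distrib_left)

lemma deg_shift: "deg Q \<alpha> s d = deg Q \<alpha> m d + (m - s) * real (total_dim Q d)"
  by (simp add: deg_def total_dim_def sum_distrib_left sum.distrib[symmetric] algebra_simps)

lemma deg_mean:
  assumes "total_dim Q d > 0"
  shows "deg Q \<alpha> (mean Q \<alpha> d) d = 0"
proof -
  have "real (total_dim Q d) > 0" using assms by simp
  then have "(\<Sum>x\<in>verts Q. real (d x)) \<noteq> 0" by (simp add: total_dim_def)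
  then have "mean Q \<alpha> d * (\<Sum>x\<in>verts Q. real (d x)) = (\<Sum>x\<in>verts Q. \<alpha> x * real (d x))"
    by (simp add: mean_def)
  then show ?thesis by (simp add: deg_def left_diff_distrib sum_subtractf sum_distrib_left)
qed

lemma is_rep_fd: "is_rep Q V \<Longrightarrow> x \<in> verts Q \<Longrightarrow> fd_subspace (rspace V x)"
  by (simp add: is_rep_def)

lemma is_rep_subspace: "is_rep Q V \<Longrightarrow> x \<in> verts Q \<Longrightarrow> seqs.subspace (rspace V x)"
  by (simp add: is_rep_def fd_subspace_def)

lemma subrep_is_rep: "subrep Q U V \<Longrightarrow> is_rep Q U"
  by (simp add: subrep_def)

lemma subrep_dim_le:
  assumes "subrep Q U V" "is_rep Q V" "x \<in> verts Q"
  shows "seqs.dim (rspace U x) \<le> seqs.dim (rspace V x)"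
  using fd_subspace_subset(2)[OF is_rep_fd[OF assms(2,3)] is_rep_subspace[OF subrep_is_rep[OF assms(1)] assms(3)]]
    assms by (auto simp: subrep_def)

lemma zero_rep_iff_total_dim:
  assumes "is_rep Q V" "finite (verts Q)"
  shows "zero_rep Q V \<longleftrightarrow> total_dim Q (dim_vector Q V) = 0"
  using assms fd_dim_zero[OF is_rep_fd[OF assms(1)]] dim_zero
  by (auto simp: zero_rep_def total_dim_def dim_vector_def)

text \<open>In terms of degrees, semistability makes no exception for the zero
  subrepresentation.\<close>

lemma semistable_deg_le:
  assumes S: "semistable Q \<alpha> S" and U: "subrep Q U S" and fin: "finite (verts Q)"
  shows "deg Q \<alpha> (slope Q \<alpha> S) (dim_vector Q U) \<le> 0"
proof (cases "zero_rep Q U")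
  case True
  then have "total_dim Q (dim_vector Q U) = 0"
    using zero_rep_iff_total_dim[OF subrep_is_rep[OF U] fin] by simp
  then show ?thesis using fin by (simp add: total_dim_def deg_def)
next
  case False
  then have pos: "total_dim Q (dim_vector Q U) > 0"
    using zero_rep_iff_total_dim[OF subrep_is_rep[OF U] fin] by simp
  have "slope Q \<alpha> U \<le> slope Q \<alpha> S" using S U False by (simp add: semistable_def)
  then show ?thesis
    using deg_shift[of Q \<alpha> "slope Q \<alpha> S" "dim_vector Q U" "slope Q \<alpha> U"] deg_mean[OF pos, of \<alpha>]
    by (simp add: slope_eq_mean mult_nonpos_nonneg)
qed

section \<open>Intersections and images of subrepresentations\<close>

lemma subrep_Int:
  assumes U: "subrep Q U V" and F: "subrep Q F V"
    and wf: "\<And>e. e \<in> arcs Q \<Longrightarrow> tail Q e \<in> verts Q \<and> head Q e \<in> verts Q"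
  shows "subrep Q \<lparr>rspace = \<lambda>x. rspace U x \<inter> rspace F x, rmap = rmap V\<rparr> F"
proof -
  have eq: "rmap U e v = rmap V e v" if "e \<in> arcs Q" "v \<in> rspace U (tail Q e)" for e v
    using U that by (simp add: subrep_def)
  have eq': "rmap F e v = rmap V e v" if "e \<in> arcs Q" "v \<in> rspace F (tail Q e)" for e v
    using F that by (simp add: subrep_def)
  have linU: "linear_between (rspace U (tail Q e)) (rspace U (head Q e)) (rmap U e)"
    and linF: "linear_between (rspace F (tail Q e)) (rspace F (head Q e)) (rmap F e)"
    if "e \<in> arcs Q" for e using that U F by (auto simp: subrep_def is_rep_def)
  have "fd_subspace (rspace U x \<inter> rspace F x)" if "x \<in> verts Q" for x
    using fd_subspace_subset(1)[OF is_rep_fd[OF subrep_is_rep[OF U] that], of "rspace U x \<inter> rspace F x"]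
      is_rep_subspace[OF subrep_is_rep[OF U] that] is_rep_subspace[OF subrep_is_rep[OF F] that]
      seqs.subspace_inter by blast
  moreover have "linear_between (rspace U (tail Q e) \<inter> rspace F (tail Q e))
      (rspace U (head Q e) \<inter> rspace F (head Q e)) (rmap V e)" if e: "e \<in> arcs Q" for e
  proof -
    have sub: "seqs.subspace (rspace U (tail Q e))"
      using is_rep_subspace[OF subrep_is_rep[OF U]] wf[OF e] by blast
    have m: "rmap V e v \<in> rspace U (head Q e) \<inter> rspace F (head Q e)"
      if "v \<in> rspace U (tail Q e) \<inter> rspace F (tail Q e)" for v
      using linear_betweenD(1)[OF linU[OF e], of v] linear_betweenD(1)[OF linF[OF e], of v]
        eq[OF e, of v] eq'[OF e, of v] that by simp
    moreover have "rmap V e (v + w) = rmap V e v + rmap V e w"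
      if "v \<in> rspace U (tail Q e)" "w \<in> rspace U (tail Q e)" for v w
      using linear_betweenD(2)[OF linU[OF e] that] eq[OF e] that seqs.subspace_add[OF sub that] by metis
    moreover have "rmap V e (seq_scale c v) = seq_scale c (rmap V e v)"
      if "v \<in> rspace U (tail Q e)" for v c
      using linear_betweenD(3)[OF linU[OF e] that] eq[OF e] that seqs.subspace_scale[OF sub that] by metis
    ultimately show ?thesis by (simp add: linear_between_def)
  qed
  ultimately show ?thesis using eq' by (simp add: subrep_def is_rep_def)
qed

lemma subrep_image:
  assumes \<pi>: "rep_morphism Q F S \<pi>" and U: "subrep Q U F" and S: "is_rep Q S"
    and wf: "\<And>e. e \<in> arcs Q \<Longrightarrow> tail Q e \<in> verts Q \<and> head Q e \<in> verts Q"
  shows "subrep Q \<lparr>rspace = \<lambda>x. \<pi> x ` rspace U x, rmap = rmap S\<rparr> S"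
    "\<And>x. x \<in> verts Q \<Longrightarrow> linear_between (rspace U x) (rspace S x) (\<pi> x)"
proof -
  show lin: "linear_between (rspace U x) (rspace S x) (\<pi> x)" if "x \<in> verts Q" for x
    using \<pi> U that unfolding rep_morphism_def subrep_def linear_between_def by (meson subsetD)
  have sub: "\<pi> x ` rspace U x \<subseteq> rspace S x" if "x \<in> verts Q" for x
    using linear_betweenD(1)[OF lin[OF that]] by blast
  have "linear_between (\<pi> (tail Q e) ` rspace U (tail Q e)) (\<pi> (head Q e) ` rspace U (head Q e)) (rmap S e)"
    if e: "e \<in> arcs Q" for e
  proof -
    have "rmap S e (\<pi> (tail Q e) v) \<in> \<pi> (head Q e) ` rspace U (head Q e)"
      if v: "v \<in> rspace U (tail Q e)" for v
    proof -
      have "v \<in> rspace F (tail Q e)" using U wf[OF e] v by (auto simp: subrep_def)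
      then have "rmap S e (\<pi> (tail Q e) v) = \<pi> (head Q e) (rmap F e v)"
        using \<pi> e by (simp add: rep_morphism_def)
      moreover have "rmap F e v = rmap U e v" using U e v by (simp add: subrep_def)
      moreover have "rmap U e v \<in> rspace U (head Q e)"
        using U e v by (auto simp: subrep_def is_rep_def linear_between_def)
      ultimately show ?thesis by simp
    qed
    moreover have "linear_between (rspace S (tail Q e)) (rspace S (head Q e)) (rmap S e)"
      using S e by (simp add: is_rep_def)
    ultimately show ?thesis
      using sub[of "tail Q e"] wf[OF e] unfolding linear_between_def by blast
  qed
  moreover have "fd_subspace (\<pi> x ` rspace U x)" if "x \<in> verts Q" for x
    using rank_nullity(1)[OF lin[OF that] is_rep_fd[OF subrep_is_rep[OF U] that]] .
  ultimately show "subrep Q \<lparr>rspace = \<lambda>x. \<pi> x ` rspace U x, rmap = rmap S\<rparr> S"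
    using sub by (simp add: subrep_def is_rep_def)
qed

section \<open>Subrepresentations compared with a Harder-Narasimhan filtration\<close>

lemma HN_filtration_step:
  assumes "HN_filtration Q \<alpha> V n F S" "Suc k \<le> n"
  shows "is_quotient Q (F (Suc k)) (F k) (S (Suc k))" "semistable Q \<alpha> (S (Suc k))"
    "subrep Q (F (Suc k)) V"
proof -
  have "\<forall>i\<in>{1..n}. is_quotient Q (F i) (F (i - 1)) (S i) \<and> semistable Q \<alpha> (S i)"
    and "\<forall>i\<in>{0..n}. subrep Q (F i) V" using assms(1) by (simp_all add: HN_filtration_def)
  from bspec[OF this(1), of "Suc k"] bspec[OF this(2), of "Suc k"] assms(2)
  show "is_quotient Q (F (Suc k)) (F k) (S (Suc k))" "semistable Q \<alpha> (S (Suc k))"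
    "subrep Q (F (Suc k)) V" by simp_all
qed

text \<open>The witness \<open>e i\<close> is the dimension vector of the image of
  \<open>U \<inter> F i\<close> in the factor \<open>S i\<close>. The kernel of that projection is
  \<open>U \<inter> F (i - 1)\<close>, so the dimensions telescope, and semistability of the factor
  bounds the degree of the image.\<close>

lemma HN_filtration_subrep_dim:
  assumes HN: "HN_filtration Q \<alpha> V n F S" and U: "subrep Q U V" and Q: "fin_digraph Q" and "k \<le> n"
  shows "\<exists>e. (\<forall>x\<in>verts Q. seqs.dim (rspace U x \<inter> rspace (F k) x) = (\<Sum>i\<in>{1..k}. e i x)) \<and>
    (\<forall>i\<in>{1..k}. (\<forall>x\<in>verts Q. e i x \<le> dim_vector Q (S i) x) \<and> deg Q \<alpha> (slope Q \<alpha> (S i)) (e i) \<le> 0)"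
  using \<open>k \<le> n\<close>
proof (induction k)
  case 0
  have "rspace U x \<inter> rspace (F 0) x = {0}" if "x \<in> verts Q" for x
    using HN is_rep_subspace[OF subrep_is_rep[OF U] that] that
    by (auto simp: HN_filtration_def zero_rep_def intro: seqs.subspace_0)
  moreover have "seqs.dim {0 :: nat \<Rightarrow> 'c} = 0" by (rule dim_zero)
  ultimately show ?case by simp
next
  case (Suc k)
  interpret fin_digraph Q by (rule Q)
  from Suc obtain e where e: "\<forall>x\<in>verts Q. seqs.dim (rspace U x \<inter> rspace (F k) x) = (\<Sum>i\<in>{1..k}. e i x)"
    "\<forall>i\<in>{1..k}. (\<forall>x\<in>verts Q. e i x \<le> dim_vector Q (S i) x) \<and> deg Q \<alpha> (slope Q \<alpha> (S i)) (e i) \<le> 0"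
    by auto
  note q = HN_filtration_step(1)[OF HN Suc.prems] and ss = HN_filtration_step(2)[OF HN Suc.prems]
    and FV = HN_filtration_step(3)[OF HN Suc.prems]
  from q obtain \<pi> where \<pi>: "rep_morphism Q (F (Suc k)) (S (Suc k)) \<pi>"
    and ker: "\<And>x. x \<in> verts Q \<Longrightarrow> {v \<in> rspace (F (Suc k)) x. \<pi> x v = 0} = rspace (F k) x"
    by (auto simp: is_quotient_def)
  have S: "is_rep Q (S (Suc k))" using q by (simp add: is_quotient_def)
  let ?I = "\<lparr>rspace = \<lambda>x. rspace U x \<inter> rspace (F (Suc k)) x, rmap = rmap V\<rparr>"
  have I: "subrep Q ?I (F (Suc k))" using subrep_Int[OF U FV] by simp
  let ?M = "\<lparr>rspace = \<lambda>x. \<pi> x ` rspace ?I x, rmap = rmap (S (Suc k))\<rparr>"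
  have M: "subrep Q ?M (S (Suc k))"
    and lin: "\<And>x. x \<in> verts Q \<Longrightarrow> linear_between (rspace ?I x) (rspace (S (Suc k)) x) (\<pi> x)"
    using subrep_image[OF \<pi> I S] by simp_all
  define e' where "e' = e(Suc k := dim_vector Q ?M)"
  have "seqs.dim (rspace U x \<inter> rspace (F (Suc k)) x) = (\<Sum>i\<in>{1..Suc k}. e' i x)" if x: "x \<in> verts Q" for x
  proof -
    have "{v \<in> rspace ?I x. \<pi> x v = 0} = rspace U x \<inter> rspace (F k) x" using ker[OF x] by auto
    then have "seqs.dim (rspace ?I x) = seqs.dim (rspace U x \<inter> rspace (F k) x) + dim_vector Q ?M x"
      using rank_nullity(2)[OF lin[OF x] is_rep_fd[OF subrep_is_rep[OF I] x]] x
      by (simp add: dim_vector_def)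
    moreover have "(\<Sum>i\<in>{1..k}. e' i x) = (\<Sum>i\<in>{1..k}. e i x)"
      by (intro sum.cong) (auto simp: e'_def)
    ultimately show ?thesis using e(1) x by (simp add: e'_def)
  qed
  moreover have "e' (Suc k) x \<le> dim_vector Q (S (Suc k)) x" if "x \<in> verts Q" for x
    using subrep_dim_le[OF M S that] that by (simp add: e'_def dim_vector_def)
  moreover have "deg Q \<alpha> (slope Q \<alpha> (S (Suc k))) (e' (Suc k)) \<le> 0"
    using semistable_deg_le[OF ss M] by (simp add: e'_def)
  moreover have "(\<forall>x\<in>verts Q. e' i x \<le> dim_vector Q (S i) x) \<and> deg Q \<alpha> (slope Q \<alpha> (S i)) (e' i) \<le> 0"
    if "i \<in> {1..k}" for i using e(2) that by (auto simp: e'_def)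
  ultimately show ?case by (metis atLeastAtMostSuc_conv insertE le_add1 plus_1_eq_Suc)
qed

lemma HN_filtration_dim:
  assumes HN: "HN_filtration Q \<alpha> V n F S" and "k \<le> n" and x: "x \<in> verts Q"
  shows "seqs.dim (rspace (F k) x) = (\<Sum>i\<in>{1..k}. dim_vector Q (S i) x)"
  using \<open>k \<le> n\<close>
proof (induction k)
  case 0
  have "rspace (F 0) x = {0}" using HN x by (simp add: HN_filtration_def zero_rep_def)
  moreover have "seqs.dim {0 :: nat \<Rightarrow> 'c} = 0" by (rule dim_zero)
  ultimately show ?case by simp
next
  case (Suc k)
  note q = HN_filtration_step(1)[OF HN Suc.prems] and FV = HN_filtration_step(3)[OF HN Suc.prems]
  from q x obtain \<pi> where \<pi>: "rep_morphism Q (F (Suc k)) (S (Suc k)) \<pi>"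
    and ker: "{v \<in> rspace (F (Suc k)) x. \<pi> x v = 0} = rspace (F k) x"
    and im: "\<pi> x ` rspace (F (Suc k)) x = rspace (S (Suc k)) x"
    by (auto simp: is_quotient_def)
  have "linear_between (rspace (F (Suc k)) x) (rspace (S (Suc k)) x) (\<pi> x)"
    using \<pi> x by (simp add: rep_morphism_def)
  from rank_nullity(2)[OF this is_rep_fd[OF subrep_is_rep[OF FV] x]] ker im Suc x
  show ?case by (simp add: dim_vector_def)
qed

text \<open>The estimate is made factor by factor. A factor of slope above \<open>s\<close>
  contributes at most its own degree, and that only if the image of \<open>U\<close> has the full
  dimension vector; a factor of slope below \<open>s\<close> contributes at most zero, and that only
  if the image vanishes.\<close>

lemma HN_filtration_maximal:
  assumes HN: "HN_filtration Q \<alpha> V n F S" and U: "subrep Q U V" and Q: "fin_digraph Q"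
    and k: "k \<le> n" "\<And>i. i \<in> {1..k} \<Longrightarrow> slope Q \<alpha> (S i) > s"
      "\<And>i. i \<in> {k<..n} \<Longrightarrow> slope Q \<alpha> (S i) < s"
  shows "deg Q \<alpha> s (dim_vector Q U) \<le> deg Q \<alpha> s (dim_vector Q (F k))"
    and "deg Q \<alpha> s (dim_vector Q U) = deg Q \<alpha> s (dim_vector Q (F k)) \<Longrightarrow>
      x \<in> verts Q \<Longrightarrow> dim_vector Q U x = dim_vector Q (F k) x"
proof -
  interpret fin_digraph Q by (rule Q)
  obtain e where e: "\<forall>x\<in>verts Q. seqs.dim (rspace U x \<inter> rspace (F n) x) = (\<Sum>i\<in>{1..n}. e i x)"
    and e2: "\<forall>i\<in>{1..n}. (\<forall>x\<in>verts Q. e i x \<le> dim_vector Q (S i) x) \<and> deg Q \<alpha> (slope Q \<alpha> (S i)) (e i) \<le> 0"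
    using HN_filtration_subrep_dim[OF HN U Q order_refl] by blast
  have UF: "rspace U x \<inter> rspace (F n) x = rspace U x" if "x \<in> verts Q" for x
    using HN U that by (auto simp: HN_filtration_def same_spaces_def subrep_def)
  \<comment> \<open>The contribution of \<open>F k\<close> to each factor: everything up to
    \<open>k\<close>, nothing beyond.\<close>
  define d where "d i x = (if i \<le> k then dim_vector Q (S i) x else 0)" for i x
  have dU: "dim_vector Q U x = (\<Sum>i\<in>{1..n}. e i x)" if "x \<in> verts Q" for x
    using e UF that by (simp add: dim_vector_def)
  have dF: "dim_vector Q (F k) x = (\<Sum>i\<in>{1..n}. d i x)" if "x \<in> verts Q" for x
  proof -
    have "(\<Sum>i\<in>{1..n}. d i x) = (\<Sum>i\<in>{1..k}. d i x)"
      using k(1) by (intro sum.mono_neutral_right) (auto simp: d_def)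
    also have "\<dots> = (\<Sum>i\<in>{1..k}. dim_vector Q (S i) x)" by (intro sum.cong) (auto simp: d_def)
    finally show ?thesis using HN_filtration_dim[OF HN k(1) that] that by (simp add: dim_vector_def)
  qed
  have step: "deg Q \<alpha> s (e i) \<le> deg Q \<alpha> s (d i) \<and>
      (deg Q \<alpha> s (e i) = deg Q \<alpha> s (d i) \<longrightarrow> (\<forall>x\<in>verts Q. e i x = d i x))" if i: "i \<in> {1..n}" for i
  proof -
    let ?m = "slope Q \<alpha> (S i)"
    have le: "\<forall>x\<in>verts Q. e i x \<le> dim_vector Q (S i) x" and deg0: "deg Q \<alpha> ?m (e i) \<le> 0"
      using e2 i by auto
    \<comment> \<open>The first summand is at most zero by semistability. The second is monotone in
      the total dimension, increasing or decreasing with the sign of \<open>?m - s\<close>, and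
      strictly so since \<open>s\<close> is not a slope.\<close>
    have shift: "deg Q \<alpha> s (e i) = deg Q \<alpha> ?m (e i) + (?m - s) * real (total_dim Q (e i))"
      by (rule deg_shift)
    have "semistable Q \<alpha> (S i)" using HN i by (simp add: HN_filtration_def)
    then have pos: "total_dim Q (dim_vector Q (S i)) > 0"
      using zero_rep_iff_total_dim[of Q "S i"] by (auto simp: semistable_def)
    show ?thesis
    proof (cases "i \<le> k")
      case True
      have m: "?m > s" using k(2) i True by simp
      have tle: "total_dim Q (e i) \<le> total_dim Q (dim_vector Q (S i))"
        unfolding total_dim_def using le by (intro sum_mono) auto
      have D: "deg Q \<alpha> s (d i) = (?m - s) * real (total_dim Q (dim_vector Q (S i)))"
        using deg_shift[of Q \<alpha> s "dim_vector Q (S i)" ?m] deg_mean[OF pos, of \<alpha>]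
          deg_cong[of Q "d i" "dim_vector Q (S i)" \<alpha> s] True
        by (simp add: slope_eq_mean d_def)
      have t: "(?m - s) * real (total_dim Q (e i)) \<le> (?m - s) * real (total_dim Q (dim_vector Q (S i)))"
        using m tle by (intro mult_left_mono) auto
      moreover have "\<forall>x\<in>verts Q. e i x = d i x" if "deg Q \<alpha> s (e i) = deg Q \<alpha> s (d i)"
      proof -
        have "(?m - s) * real (total_dim Q (e i)) = (?m - s) * real (total_dim Q (dim_vector Q (S i)))"
          using that D shift deg0 t by linarith
        then have "total_dim Q (e i) = total_dim Q (dim_vector Q (S i))" using m by simp
        then have "(\<Sum>x\<in>verts Q. e i x) = (\<Sum>x\<in>verts Q. dim_vector Q (S i) x)" by (simp add: total_dim_def)
        then show ?thesis
          using sum_mono_inv[of "e i" "verts Q" "dim_vector Q (S i)"] le True by (simp add: d_def)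
      qed
      ultimately show ?thesis using D shift deg0 by linarith
    next
      case False
      have m: "?m < s" using k(3) i False by simp
      have D: "deg Q \<alpha> s (d i) = 0" using False by (simp add: d_def deg_def)
      have t: "(?m - s) * real (total_dim Q (e i)) \<le> 0"
        using m by (simp add: mult_nonpos_nonneg)
      moreover have "\<forall>x\<in>verts Q. e i x = d i x" if "deg Q \<alpha> s (e i) = deg Q \<alpha> s (d i)"
      proof -
        have "(?m - s) * real (total_dim Q (e i)) = 0" using that D shift deg0 t by linarith
        then have "total_dim Q (e i) = 0" using m by simp
        then show ?thesis using False by (simp add: total_dim_def d_def)
      qed
      ultimately show ?thesis using D shift deg0 by linarith
    qed
  qed
  have degU: "deg Q \<alpha> s (dim_vector Q U) = (\<Sum>i\<in>{1..n}. deg Q \<alpha> s (e i))"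
    unfolding deg_sum[symmetric] by (rule deg_cong) (rule dU)
  have degF: "deg Q \<alpha> s (dim_vector Q (F k)) = (\<Sum>i\<in>{1..n}. deg Q \<alpha> s (d i))"
    unfolding deg_sum[symmetric] by (rule deg_cong) (rule dF)
  show "deg Q \<alpha> s (dim_vector Q U) \<le> deg Q \<alpha> s (dim_vector Q (F k))"
    unfolding degU degF using step by (intro sum_mono) auto
  assume eq: "deg Q \<alpha> s (dim_vector Q U) = deg Q \<alpha> s (dim_vector Q (F k))" and x: "x \<in> verts Q"
  have "deg Q \<alpha> s (e i) = deg Q \<alpha> s (d i)" if "i \<in> {1..n}" for i
    using sum_mono_inv[of "\<lambda>i. deg Q \<alpha> s (e i)" "{1..n}" "\<lambda>i. deg Q \<alpha> s (d i)" i] eq step that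
    unfolding degU degF by auto
  then have "e i x = d i x" if "i \<in> {1..n}" for i using step that x by blast
  then show "dim_vector Q U x = dim_vector Q (F k) x" using dU[OF x] dF[OF x] by simp
qed

section \<open>Recovering a type from its truncations\<close>

lemma ex_real_between_avoiding:
  assumes "finite B" and "a < (b::real)"
  obtains s :: real where "a < s" "s < b" "s \<notin> B"
proof -
  have "infinite {a<..<b}" using assms(2) by (simp add: infinite_Ioo)
  then have "\<not> {a<..<b} \<subseteq> B" using assms(1) finite_subset by blast
  then obtain s where "s \<in> {a<..<b}" "s \<notin> B" by blast
  then show ?thesis using that by (metis greaterThanLessThan_iff)
qed

text \<open>A threshold between the largest and the second largest value of \<open>m\<close>
  isolates the first entry, and the tails follow by induction. The finite set \<open>B\<close>
  stands for the slopes, at which no truncation by maximality is available; a threshold can always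
  be moved off it.\<close>

lemma strictly_decreasing_lists_eq:
  fixes m :: "('a \<Rightarrow> nat) \<Rightarrow> real"
  assumes "sorted_wrt (\<lambda>c d. m c > m d) T" "sorted_wrt (\<lambda>c d. m c > m d) T'"
    and "\<And>d. d \<in> set T \<union> set T' \<Longrightarrow> d \<in> extensional X \<and> (\<exists>x\<in>X. d x > 0)"
    and "finite B"
    and "\<And>s x. s \<notin> B \<Longrightarrow> x \<in> X \<Longrightarrow>
      (\<Sum>d\<leftarrow>filter (\<lambda>d. m d > s) T. d x) = (\<Sum>d\<leftarrow>filter (\<lambda>d. m d > s) T'. d x)"
  shows "T = T'"
  using assms
proof (induction T arbitrary: T')
  case Nil
  show ?case
  proof (cases T')
    case (Cons d' ts')
    obtain s where "m d' - 1 < s" "s < m d'" "s \<notin> B"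
      using ex_real_between_avoiding[OF Nil(4), of "m d' - 1" "m d'"] by auto
    moreover obtain x where "x \<in> X" "d' x > 0" using Nil(3) Cons by auto
    ultimately show ?thesis using Nil(5)[of s x] Cons by simp
  qed simp
next
  case (Cons d ts)
  show ?case
  proof (cases T')
    case Nil
    obtain s where "m d - 1 < s" "s < m d" "s \<notin> B"
      using ex_real_between_avoiding[OF Cons.prems(4), of "m d - 1" "m d"] by auto
    moreover obtain x where "x \<in> X" "d x > 0" using Cons.prems(3) by auto
    ultimately show ?thesis using Cons.prems(5)[of s x] Nil by simp
  next
    case C': (Cons d' ts')
    have lt: "m c < m d" if "c \<in> set ts" for c using Cons.prems(1) that by simp
    have lt': "m c < m d'" if "c \<in> set ts'" for c using Cons.prems(2) C' that by simp
    have meq: "m d = m d'"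
    proof (rule ccontr)
      assume "m d \<noteq> m d'"
      then consider "m d' < m d" | "m d < m d'" by linarith
      then show False
      proof cases
        case 1
        obtain s where s: "m d' < s" "s < m d" "s \<notin> B"
          using ex_real_between_avoiding[OF Cons.prems(4) 1] by auto
        obtain x where x: "x \<in> X" "d x > 0" using Cons.prems(3) by auto
        have "filter (\<lambda>d. m d > s) T' = []" using s lt' C' by (force simp: filter_empty_conv)
        then show False using Cons.prems(5)[OF s(3) x(1)] s x(2) by simp
      next
        case 2
        obtain s where s: "m d < s" "s < m d'" "s \<notin> B"
          using ex_real_between_avoiding[OF Cons.prems(4) 2] by auto
        obtain x where x: "x \<in> X" "d' x > 0" using Cons.prems(3) C' by auto
        have "filter (\<lambda>d. m d > s) (d # ts) = []" using s lt by (force simp: filter_empty_conv)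
        then show False using Cons.prems(5)[OF s(3) x(1)] s x(2) C' by simp
      qed
    qed
    \<comment> \<open>The largest value on the two tails; \<open>m d - 1\<close> is the default when
      both are empty.\<close>
    define a where "a = Max (insert (m d - 1) (m ` (set ts \<union> set ts')))"
    have "a < m d" using lt lt' meq by (auto simp: a_def)
    from ex_real_between_avoiding[OF Cons.prems(4) this] obtain s where
      s: "a < s" "s < m d" "s \<notin> B" by auto
    have "m c \<le> a" if "c \<in> set ts \<union> set ts'" for c unfolding a_def using that by (intro Max_ge) auto
    then have ms: "\<not> m c > s" if "c \<in> set ts \<union> set ts'" for c using s(1) that by fastforce
    then have "filter (\<lambda>d. m d > s) ts = []" "filter (\<lambda>d. m d > s) ts' = []"
      by (auto simp: filter_empty_conv)
    then have "d x = d' x" if "x \<in> X" for x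
      using Cons.prems(5)[OF s(3) that] s(2) meq C' by simp
    then have dd: "d = d'" using Cons.prems(3)[of d] Cons.prems(3)[of d'] C' extensionalityI[of d X d'] by simp
    have "ts = ts'"
    proof (rule Cons.IH)
      show "sorted_wrt (\<lambda>c d. m c > m d) ts" "sorted_wrt (\<lambda>c d. m c > m d) ts'"
        using Cons.prems(1,2) C' by simp_all
      show "c \<in> extensional X \<and> (\<exists>x\<in>X. c x > 0)" if "c \<in> set ts \<union> set ts'" for c
        using Cons.prems(3)[of c] C' that by auto
      show "finite B" by (rule Cons.prems(4))
      fix s x assume sx: "s \<notin> B" "x \<in> X"
      show "(\<Sum>d\<leftarrow>filter (\<lambda>d. m d > s) ts. d x) = (\<Sum>d\<leftarrow>filter (\<lambda>d. m d > s) ts'. d x)"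
      proof (cases "m d > s")
        case True
        then show ?thesis using Cons.prems(5)[OF sx] C' dd by simp
      next
        case False
        then have "filter (\<lambda>d. m d > s) ts = []" "filter (\<lambda>d. m d > s) ts' = []"
          using lt lt' meq by (force simp: filter_empty_conv)+
        then show ?thesis by simp
      qed
    qed
    then show ?thesis using dd C' by simp
  qed
qed

lemma HN_filtration_slope_less:
  assumes "HN_filtration Q \<alpha> V n F S" "1 \<le> i" "i < j" "j \<le> n"
  shows "slope Q \<alpha> (S j) < slope Q \<alpha> (S i)"
  using assms(3,4)
proof (induction j rule: less_induct)
  case (less j)
  then obtain j' where j': "j = Suc j'" by (cases j) auto
  have "slope Q \<alpha> (S j) < slope Q \<alpha> (S j')"
    using assms(1,2) less.prems j' by (simp add: HN_filtration_def)
  then show ?case using less j' by (cases "i = j'") force+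
qed

text \<open>For \<open>s\<close> off the slopes of both filtrations, each filtration has a step that
  maximises the degree for \<open>s\<close>. The two steps have the same dimension vector, and this
  vector is the sum of the entries of the type with mean above \<open>s\<close>.\<close>

lemma is_HN_type_unique:
  assumes Q: "fin_digraph Q" and T: "is_HN_type Q \<alpha> V T" and T': "is_HN_type Q \<alpha> V T'"
  shows "T = T'"
proof -
  interpret fin_digraph Q by (rule Q)
  obtain n F S where HN: "HN_filtration Q \<alpha> V n F S" and Tn: "T = map (\<lambda>i. dim_vector Q (S i)) [1..<n + 1]"
    using T by (auto simp: is_HN_type_def)
  obtain n' F' S' where HN': "HN_filtration Q \<alpha> V n' F' S'"
    and Tn': "T' = map (\<lambda>i. dim_vector Q (S' i)) [1..<n' + 1]"
    using T' by (auto simp: is_HN_type_def)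
  have cut: "\<exists>k\<le>n. (\<forall>i\<in>{1..k}. slope Q \<alpha> (S i) > s) \<and> (\<forall>i\<in>{k<..n}. slope Q \<alpha> (S i) < s) \<and>
      (\<forall>x\<in>verts Q. (\<Sum>d\<leftarrow>filter (\<lambda>d. mean Q \<alpha> d > s) (map (\<lambda>i. dim_vector Q (S i)) [1..<n + 1]). d x)
        = dim_vector Q (F k) x)"
    if HN: "HN_filtration Q \<alpha> V n F S" and s: "s \<notin> (\<lambda>i. slope Q \<alpha> (S i)) ` {1..n}" for s n F S
  proof -
    define P where "P = {i \<in> {1..n}. slope Q \<alpha> (S i) > s}"
    \<comment> \<open>Inserting 0 covers the case that all slopes lie below \<open>s\<close>, where
      the truncation is the zero step.\<close>
    define k where "k = Max (insert 0 P)"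
    have finP: "finite P" by (simp add: P_def)
    have kn: "k \<le> n" unfolding k_def by (subst Max_le_iff) (auto simp: P_def)
    have "k \<in> insert 0 P" unfolding k_def using finP by (intro Max_in) auto
    have Pk: "P = {1..k}"
    proof
      show "P \<subseteq> {1..k}" using finP unfolding k_def by (auto intro: Max_ge simp: P_def)
      show "{1..k} \<subseteq> P"
      proof
        fix i assume i: "i \<in> {1..k}"
        then have "k \<in> P" using \<open>k \<in> insert 0 P\<close> by auto
        then show "i \<in> P"
          using HN_filtration_slope_less[OF HN, of i k] i by (cases "i = k") (auto simp: P_def)
      qed
    qed
    have "slope Q \<alpha> (S i) < s" if "i \<in> {k<..n}" for i
    proof -
      have "i \<notin> P" using Pk that by auto
      then have "slope Q \<alpha> (S i) \<le> s" using that by (auto simp: P_def)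
      moreover have "slope Q \<alpha> (S i) \<noteq> s" using s that by auto
      ultimately show ?thesis by simp
    qed
    moreover have "(\<Sum>d\<leftarrow>filter (\<lambda>d. mean Q \<alpha> d > s) (map (\<lambda>i. dim_vector Q (S i)) [1..<n + 1]). d x)
        = dim_vector Q (F k) x" if x: "x \<in> verts Q" for x
    proof -
      let ?L = "filter (\<lambda>i. slope Q \<alpha> (S i) > s) [1..<n + 1]"
      have "set ?L = P" by (auto simp: P_def)
      moreover have "distinct ?L" by simp
      ultimately have "(\<Sum>i\<in>P. dim_vector Q (S i) x) = (\<Sum>i\<leftarrow>?L. dim_vector Q (S i) x)"
        using sum.distinct_set_conv_list[of ?L "\<lambda>i. dim_vector Q (S i) x"] by simp
      then show ?thesis
        using HN_filtration_dim[OF HN kn x] x Pk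
        by (simp add: filter_map comp_def slope_eq_mean dim_vector_def)
    qed
    ultimately show ?thesis using kn Pk by (auto simp: P_def)
  qed
  have ne: "d \<in> extensional (verts Q) \<and> (\<exists>x\<in>verts Q. d x > 0)"
    if HN: "HN_filtration Q \<alpha> V n F S" and d: "d \<in> set (map (\<lambda>i. dim_vector Q (S i)) [1..<n + 1])" for d n F S
  proof -
    obtain i where i: "i \<in> {1..n}" "d = dim_vector Q (S i)"
      using d by (fastforce simp del: upt_Suc)
    then have "semistable Q \<alpha> (S i)" using HN by (simp add: HN_filtration_def)
    then have "total_dim Q (dim_vector Q (S i)) \<noteq> 0"
      using zero_rep_iff_total_dim[of Q "S i"] by (auto simp: semistable_def)
    then show ?thesis using i by (auto simp: total_dim_def dim_vector_def)
  qed
  have sorted: "sorted_wrt (\<lambda>c d. mean Q \<alpha> c > mean Q \<alpha> d) (map (\<lambda>i. dim_vector Q (S i)) [1..<n + 1])"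
    if HN: "HN_filtration Q \<alpha> V n F S" for n F S
    using HN_filtration_slope_less[OF HN] by (simp add: sorted_wrt_iff_nth_less slope_eq_mean del: upt_Suc)
  show ?thesis
  proof (rule strictly_decreasing_lists_eq[of "mean Q \<alpha>"])
    show "sorted_wrt (\<lambda>c d. mean Q \<alpha> c > mean Q \<alpha> d) T" "sorted_wrt (\<lambda>c d. mean Q \<alpha> c > mean Q \<alpha> d) T'"
      using sorted[OF HN] sorted[OF HN'] Tn Tn' by simp_all
    show "d \<in> extensional (verts Q) \<and> (\<exists>x\<in>verts Q. d x > 0)" if "d \<in> set T \<union> set T'" for d
      using ne[OF HN, of d] ne[OF HN', of d] Tn Tn' that by auto
    let ?B = "(\<lambda>i. slope Q \<alpha> (S i)) ` {1..n} \<union> (\<lambda>i. slope Q \<alpha> (S' i)) ` {1..n'}"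
    show "finite ?B" by simp
    fix s x assume s: "s \<notin> ?B" and x: "x \<in> verts Q"
    from cut[OF HN, of s] s obtain k where k: "k \<le> n" "\<forall>i\<in>{1..k}. slope Q \<alpha> (S i) > s"
      "\<forall>i\<in>{k<..n}. slope Q \<alpha> (S i) < s"
      "(\<Sum>d\<leftarrow>filter (\<lambda>d. mean Q \<alpha> d > s) T. d x) = dim_vector Q (F k) x" using x Tn by auto
    from cut[OF HN', of s] s obtain k' where k': "k' \<le> n'" "\<forall>i\<in>{1..k'}. slope Q \<alpha> (S' i) > s"
      "\<forall>i\<in>{k'<..n'}. slope Q \<alpha> (S' i) < s"
      "(\<Sum>d\<leftarrow>filter (\<lambda>d. mean Q \<alpha> d > s) T'. d x) = dim_vector Q (F' k') x" using x Tn' by auto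
    have FV: "subrep Q (F k) V" and FV': "subrep Q (F' k') V"
      using HN HN' k(1) k'(1) by (auto simp: HN_filtration_def)
    \<comment> \<open>Each of the two steps is a competitor in the maximality of the other.\<close>
    have "deg Q \<alpha> s (dim_vector Q (F' k')) = deg Q \<alpha> s (dim_vector Q (F k))"
      using HN_filtration_maximal(1)[OF HN FV' Q k(1), of s]
        HN_filtration_maximal(1)[OF HN' FV Q k'(1), of s] k k' by fastforce
    then have "dim_vector Q (F' k') x = dim_vector Q (F k) x"
      using HN_filtration_maximal(2)[OF HN FV' Q k(1), of s x] k x by blast
    then show "(\<Sum>d\<leftarrow>filter (\<lambda>d. mean Q \<alpha> d > s) T. d x) = (\<Sum>d\<leftarrow>filter (\<lambda>d. mean Q \<alpha> d > s) T'. d x)"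
      using k(4) k'(4) by simp
  qed
qed

lemma HN_type_eqI:
  assumes "fin_digraph Q" "is_HN_type Q \<alpha> V T"
  shows "HN_type Q \<alpha> V = T"
  unfolding HN_type_def using assms is_HN_type_unique by (blast intro: the_equality)

section \<open>Averages over intervals\<close>

definition avg :: "(nat \<Rightarrow> real) \<Rightarrow> nat \<Rightarrow> nat \<Rightarrow> real" where
  "avg \<alpha> a c = (\<Sum>x\<in>{a..c}. \<alpha> x) / real (Suc c - a)"

text \<open>Cutting \<open>[a, c]\<close> at the edge \<open>b\<close> leaves a subrepresentation on
  the side of the head of that edge and a quotient on the side of its tail; the subrepresentation
  must have the smaller slope. Summation by parts reduces all subrepresentations to these single
  cuts.\<close>

definition stable_interval :: "(nat \<Rightarrow> real) \<Rightarrow> (nat \<Rightarrow> bool) \<Rightarrow> nat \<Rightarrow> nat \<Rightarrow> bool" where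
  "stable_interval \<alpha> \<tau> a c \<longleftrightarrow> (\<forall>b. a < b \<and> b \<le> c \<longrightarrow>
     (if \<tau> b then avg \<alpha> a (b - 1) > avg \<alpha> b c else avg \<alpha> a (b - 1) < avg \<alpha> b c))"

lemma avg_times: "a \<le> c \<Longrightarrow> avg \<alpha> a c * (real (Suc c) - real a) = (\<Sum>x\<in>{a..c}. \<alpha> x)"
  by (simp add: avg_def of_nat_diff)

lemma avg_split:
  assumes "a < b" "b \<le> c"
  shows "avg \<alpha> a c * (real (Suc c) - real a) =
    avg \<alpha> a (b - 1) * (real b - real a) + avg \<alpha> b c * (real (Suc c) - real b)"
proof -
  have "{a..c} = {a..b - 1} \<union> {b..c}" "{a..b - 1} \<inter> {b..c} = {}" using assms by auto
  then have "(\<Sum>x\<in>{a..c}. \<alpha> x) = (\<Sum>x\<in>{a..b - 1}. \<alpha> x) + (\<Sum>x\<in>{b..c}. \<alpha> x)"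
    by (simp add: sum.union_disjoint)
  then show ?thesis
    using avg_times[of a c \<alpha>] avg_times[of a "b - 1" \<alpha>] avg_times[of b c \<alpha>] assms by simp
qed

lemma avg_split_diff:
  assumes "a < b" "b \<le> c"
  shows "(avg \<alpha> a (b - 1) - avg \<alpha> a c) * (real (Suc c) - real a) =
    (avg \<alpha> a (b - 1) - avg \<alpha> b c) * (real (Suc c) - real b)"
  using avg_split[OF assms, of \<alpha>] by (simp add: algebra_simps)

lemma avg_left_less_iff:
  assumes "a < b" "b \<le> c"
  shows "avg \<alpha> a c < avg \<alpha> a (b - 1) \<longleftrightarrow> avg \<alpha> b c < avg \<alpha> a (b - 1)"
    and "avg \<alpha> a (b - 1) < avg \<alpha> a c \<longleftrightarrow> avg \<alpha> a (b - 1) < avg \<alpha> b c"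
proof -
  have pos: "real (Suc c) - real a > 0" "real (Suc c) - real b > 0" using assms by auto
  show "avg \<alpha> a c < avg \<alpha> a (b - 1) \<longleftrightarrow> avg \<alpha> b c < avg \<alpha> a (b - 1)"
    using avg_split_diff[OF assms, of \<alpha>] pos
    by (metis diff_gt_0_iff_gt zero_less_mult_pos2 mult_pos_pos)
  have "(avg \<alpha> a c - avg \<alpha> a (b - 1)) * (real (Suc c) - real a) =
    (avg \<alpha> b c - avg \<alpha> a (b - 1)) * (real (Suc c) - real b)"
    using avg_split_diff[OF assms, of \<alpha>] by (simp add: algebra_simps)
  then show "avg \<alpha> a (b - 1) < avg \<alpha> a c \<longleftrightarrow> avg \<alpha> a (b - 1) < avg \<alpha> b c"
    using pos by (metis diff_gt_0_iff_gt zero_less_mult_pos2 mult_pos_pos)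
qed

text \<open>The cut of \<open>[a, c']\<close> behind \<open>c\<close> is a strict inequality in
  either orientation. Hence the left end and the slope of a stable interval determine its right
  end.\<close>

lemma stable_interval_avg_neq:
  assumes "stable_interval \<alpha> \<tau> a c'" "a \<le> c" "c < c'"
  shows "avg \<alpha> a c \<noteq> avg \<alpha> a c'"
  using assms avg_left_less_iff[of a "Suc c" c' \<alpha>]
  unfolding stable_interval_def by (force dest: spec[of _ "Suc c"] split: if_splits)

text \<open>Summation by parts: the partial sums of \<open>\<alpha> - avg \<alpha> a c\<close> have the sign of the arrow
  at which they end.\<close>

lemma stable_interval_closed_sum:
  assumes st: "stable_interval \<alpha> \<tau> a c" and ac: "a \<le> c" and G: "G \<subseteq> {a..c}"
    and closed: "\<And>i. a < i \<Longrightarrow> i \<le> c \<Longrightarrow> if \<tau> i then i - 1 \<in> G \<longrightarrow> i \<in> G else i \<in> G \<longrightarrow> i - 1 \<in> G"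
  shows "(\<Sum>x\<in>G. \<alpha> x - avg \<alpha> a c) \<le> 0"
proof -
  let ?s = "avg \<alpha> a c"
  define p where "p i = (\<Sum>x\<in>{a..<i}. \<alpha> x - ?s)" for i
  define g :: "nat \<Rightarrow> real" where "g x = (if x \<in> G then 1 else 0)" for x
  have pavg: "p (Suc b) = (avg \<alpha> a b - ?s) * (real (Suc b) - real a)" if "a \<le> b" for b
    using avg_times[OF that, of \<alpha>] that
    by (simp add: p_def sum_subtractf atLeastLessThanSuc_atLeastAtMost algebra_simps of_nat_diff)
  have pend: "p (Suc c) = 0" using pavg[OF ac] by simp
  have sign: "(g (i - 1) - g i) * p i \<le> 0" if i: "a < i" "i \<le> c" for i
  proof -
    have p: "p i = (avg \<alpha> a (i - 1) - ?s) * (real i - real a)" using pavg[of "i - 1"] i by simp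
    show ?thesis
    proof (cases "\<tau> i")
      case True
      then have "avg \<alpha> a (i - 1) > ?s"
        using st i avg_left_less_iff(1)[OF i, of \<alpha>] by (auto simp: stable_interval_def)
      then have "p i \<ge> 0" unfolding p using i by simp
      moreover have "g (i - 1) \<le> g i" using closed[OF i] True by (simp add: g_def)
      ultimately show ?thesis by (simp add: mult_nonpos_nonneg)
    next
      case False
      then have "avg \<alpha> a (i - 1) < ?s"
        using st i avg_left_less_iff(2)[OF i, of \<alpha>] by (auto simp: stable_interval_def)
      then have "p i \<le> 0" unfolding p using i by (simp add: mult_nonpos_nonneg)
      moreover have "g (i - 1) \<ge> g i" using closed[OF i] False by (simp add: g_def)
      ultimately show ?thesis by (simp add: mult_nonneg_nonpos)
    qed
  qed
  have pSuc: "\<alpha> x - ?s = p (Suc x) - p x" if "a \<le> x" for x using that by (simp add: p_def)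
  \<comment> \<open>Abel summation as an inequality; the boundary term disappears at
    \<open>c\<close> because \<open>p (Suc c) = 0\<close>.\<close>
  have part: "(\<Sum>x\<in>{a..e}. g x * (\<alpha> x - ?s)) \<le> g e * p (Suc e)" if "a \<le> e" "e \<le> c" for e
    using that
  proof (induction e rule: dec_induct)
    case base
    then show ?case by (simp add: p_def)
  next
    case (step e)
    have "(\<Sum>x\<in>{a..Suc e}. g x * (\<alpha> x - ?s)) \<le> g e * p (Suc e) + g (Suc e) * (p (Suc (Suc e)) - p (Suc e))"
      using step pSuc[of "Suc e"] by (simp add: sum.cl_ivl_Suc)
    also have "\<dots> = g (Suc e) * p (Suc (Suc e)) + (g e - g (Suc e)) * p (Suc e)"
      by (simp add: algebra_simps)
    also have "\<dots> \<le> g (Suc e) * p (Suc (Suc e))" using sign[of "Suc e"] step by simp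
    finally show ?case .
  qed
  have "(\<Sum>x\<in>{a..c}. g x * (\<alpha> x - ?s)) = (\<Sum>x\<in>{a..c}. if x \<in> G then \<alpha> x - ?s else 0)"
    by (intro sum.cong) (auto simp: g_def)
  also have "\<dots> = (\<Sum>x\<in>G. \<alpha> x - ?s)"
    using G by (subst sum.inter_restrict[symmetric]) (auto simp: Int_absorb1)
  finally show ?thesis using part[OF ac order_refl] pend by simp
qed

lemma avg_deviation_sum: "a \<le> c \<Longrightarrow> (\<Sum>x\<in>{a..c}. \<alpha> x - avg \<alpha> a c) = 0"
  using avg_times[of a c \<alpha>] by (simp add: sum_subtractf algebra_simps of_nat_diff)

lemma sum_times_card:
  fixes f :: "'x \<Rightarrow> real"
  assumes "finite X" "finite J"
  shows "(\<Sum>x\<in>X. f x * real (card {k \<in> J. R k x})) = (\<Sum>k\<in>J. \<Sum>x\<in>{x \<in> X. R k x}. f x)"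
proof -
  have "(\<Sum>x\<in>X. f x * real (card {k \<in> J. R k x})) = (\<Sum>x\<in>X. \<Sum>k\<in>{k \<in> J. R k x}. f x)"
    by (simp add: mult.commute)
  also have "\<dots> = (\<Sum>k\<in>J. \<Sum>x\<in>{x \<in> X. R k x}. f x)"
    by (rule sum.swap_restrict[OF assms])
  finally show ?thesis .
qed

section \<open>Interval decompositions\<close>

type_synonym 'f Arep = "(nat, nat, 'f) qrep"

lemma A_quiver_simps [simp]:
  "verts (A_quiver l \<tau>) = {0..l}" "arcs (A_quiver l \<tau>) = {1..l}"
  "tail (A_quiver l \<tau>) i = (if \<tau> i then i - 1 else i)"
  "head (A_quiver l \<tau>) i = (if \<tau> i then i else i - 1)"
  by (simp_all add: A_quiver_def)

definition active :: "nat set \<Rightarrow> (nat \<Rightarrow> nat) \<Rightarrow> (nat \<Rightarrow> nat) \<Rightarrow> nat \<Rightarrow> nat set" where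
  "active J A C x = {j \<in> J. A j \<le> x \<and> x \<le> C j}"

text \<open>The structure maps are left out on purpose: the same data also describe representations
  whose maps are only triangular on the strings.\<close>

definition string_frames ::
    "nat \<Rightarrow> ('f::field) Arep \<Rightarrow> nat set \<Rightarrow> (nat \<Rightarrow> nat) \<Rightarrow> (nat \<Rightarrow> nat) \<Rightarrow>
     (nat \<Rightarrow> nat \<Rightarrow> nat \<Rightarrow> 'f) \<Rightarrow> bool" where
  "string_frames l V J A C w \<longleftrightarrow> finite J \<and> (\<forall>j\<in>J. A j \<le> C j \<and> C j \<le> l) \<and>
     (\<forall>x\<le>l. frame (active J A C x) (\<lambda>j. w j x) (rspace V x)) \<and>
     (\<forall>j\<in>J. \<forall>x. \<not> (A j \<le> x \<and> x \<le> C j) \<longrightarrow> w j x = 0)"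

text \<open>Since \<open>w j\<close> vanishes off the interval of \<open>j\<close>, one equation
  says both that a string is carried along an arrow inside its interval and that it is killed by an
  arrow leaving it. An arrow entering the interval from outside carries no condition, as
  \<open>j\<close> is not active at its tail.\<close>

definition strings ::
    "nat \<Rightarrow> (nat \<Rightarrow> bool) \<Rightarrow> ('f::field) Arep \<Rightarrow> nat set \<Rightarrow> (nat \<Rightarrow> nat) \<Rightarrow> (nat \<Rightarrow> nat) \<Rightarrow>
     (nat \<Rightarrow> nat \<Rightarrow> nat \<Rightarrow> 'f) \<Rightarrow> bool" where
  "strings l \<tau> V J A C w \<longleftrightarrow> string_frames l V J A C w \<and>
     (\<forall>i\<in>arcs (A_quiver l \<tau>). \<forall>j\<in>active J A C (tail (A_quiver l \<tau>) i).
        rmap V i (w j (tail (A_quiver l \<tau>) i)) = w j (head (A_quiver l \<tau>) i))"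

lemma linear_between_span:
  assumes f: "linear_between S S' f" and S: "seqs.subspace S" and T: "seqs.subspace T"
    and B: "B \<subseteq> S" and fB: "\<And>b. b \<in> B \<Longrightarrow> f b \<in> T" and v: "v \<in> seqs.span B"
  shows "f v \<in> T"
proof -
  have "seqs.subspace {v \<in> S. f v \<in> T}"
    using linear_between_zero[OF f S] linear_betweenD[OF f] S T
    by (intro seqs.subspaceI) (auto intro: seqs.subspace_0 seqs.subspace_add seqs.subspace_scale)
  then have "seqs.span B \<subseteq> {v \<in> S. f v \<in> T}" using B fB by (intro seqs.span_minimal) auto
  then show ?thesis using v by blast
qed

lemma subrep_closed:
  assumes "subrep Q U V" "e \<in> arcs Q" "v \<in> rspace U (tail Q e)"
  shows "rmap V e v \<in> rspace U (head Q e)"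
proof -
  have "linear_between (rspace U (tail Q e)) (rspace U (head Q e)) (rmap U e)"
    using assms(1,2) by (simp add: subrep_def is_rep_def)
  from linear_betweenD(1)[OF this assms(3)] show ?thesis
    using assms by (simp add: subrep_def)
qed

text \<open>The structure maps only need to be triangular with respect to some order of the strings: the
  leading strings of a subrepresentation then form subrepresentations of the interval modules.\<close>

lemma semistable_triangular:
  fixes r :: "nat \<Rightarrow> 'o::linorder" and V :: "('f::field) Arep"
  assumes V: "is_rep (A_quiver l \<tau>) V" and fr: "string_frames l V J A C w" and "J \<noteq> {}"
    and r: "inj_on r J"
    and tri: "\<And>i j. i \<in> arcs (A_quiver l \<tau>) \<Longrightarrow> j \<in> active J A C (tail (A_quiver l \<tau>) i) \<Longrightarrow>
      rmap V i (w j (tail (A_quiver l \<tau>) i)) - w j (head (A_quiver l \<tau>) i) \<in>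
        seqs.span ((\<lambda>k. w k (head (A_quiver l \<tau>) i)) ` {k \<in> active J A C (head (A_quiver l \<tau>) i). r k < r j})"
    and st: "\<And>j. j \<in> J \<Longrightarrow> stable_interval \<alpha> \<tau> (A j) (C j) \<and> avg \<alpha> (A j) (C j) = s"
  shows "semistable (A_quiver l \<tau>) \<alpha> V \<and> slope (A_quiver l \<tau>) \<alpha> V = s"
proof -
  let ?Q = "A_quiver l \<tau>"
  interpret fin_digraph ?Q by (rule fin_digraph_A_quiver)
  have finJ: "finite J" and AC: "\<And>j. j \<in> J \<Longrightarrow> A j \<le> C j \<and> C j \<le> l"
    and F: "\<And>x. x \<le> l \<Longrightarrow> frame (active J A C x) (\<lambda>j. w j x) (rspace V x)"
    and w0: "\<And>j x. j \<in> J \<Longrightarrow> \<not> (A j \<le> x \<and> x \<le> C j) \<Longrightarrow> w j x = 0"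
    using fr by (auto simp: string_frames_def)
  have act: "active J A C x \<subseteq> J" for x by (auto simp: active_def)
  have rx: "inj_on r (active J A C x)" for x using inj_on_subset[OF r act] .
  \<comment> \<open>The leading strings of \<open>U\<close> at the vertex \<open>x\<close>.\<close>
  define Z where "Z U x = lead (active J A C x) (\<lambda>j. w j x) r (rspace U x)"
    for U :: "'f Arep" and x
  have deg_le: "deg ?Q \<alpha> s (dim_vector ?Q U) \<le> 0" if U: "subrep ?Q U V" for U
  proof -
    have sub: "seqs.subspace (rspace U x)" if "x \<le> l" for x
      using is_rep_subspace[OF subrep_is_rep[OF U], of x] that by simp
    have UV: "rspace U x \<subseteq> rspace V x" if "x \<le> l" for x using U that by (simp add: subrep_def)
    have dimU: "seqs.dim (rspace U x) = card (Z U x)" if "x \<le> l" for x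
      unfolding Z_def using dim_eq_card_lead[OF F[OF that] rx sub[OF that] UV[OF that]] .
    have ZJ: "Z U x \<subseteq> active J A C x" for x by (auto simp: Z_def lead_def)
    define G where "G k = {x. x \<le> l \<and> k \<in> Z U x}" for k
    \<comment> \<open>If \<open>v\<close> in \<open>U\<close> has leading string \<open>k\<close>,
      its image still has leading term \<open>w k\<close>, because triangular maps send lower
      strings to lower strings. So \<open>k\<close> remains a leading string of \<open>U\<close> as
      long as it is alive at the head.\<close>
    have closed: "head ?Q i \<in> G k"
      if i: "i \<in> arcs ?Q" and t: "tail ?Q i \<in> G k" and h: "A k \<le> head ?Q i" "head ?Q i \<le> C k" for i k
    proof -
      let ?t = "tail ?Q i" and ?h = "head ?Q i"
      let ?T = "seqs.span ((\<lambda>j. w j ?h) ` {j \<in> active J A C ?h. r j < r k})"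
      have tl: "?t \<le> l" "?h \<le> l" using i by (auto split: if_splits)
      have lin: "linear_between (rspace V ?t) (rspace V ?h) (rmap V i)"
        using V i by (simp add: is_rep_def)
      have sV: "seqs.subspace (rspace V ?t)" using frame_subspace[OF F[OF tl(1)]] .
      obtain v where v: "v \<in> rspace U ?t"
        "v - w k ?t \<in> seqs.span ((\<lambda>j. w j ?t) ` {j \<in> active J A C ?t. r j < r k})"
        and k: "k \<in> active J A C ?t"
        using t by (auto simp: G_def Z_def lead_def)
      have kJ: "k \<in> J" using k by (simp add: active_def)
      have vV: "v \<in> rspace V ?t" using v UV tl by blast
      have wV: "w j ?t \<in> rspace V ?t" if "j \<in> active J A C ?t" for j
        using frame_mem[OF F[OF tl(1)] that] .
      have "rmap V i (v - w k ?t) \<in> ?T"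
      proof (rule linear_between_span[OF lin sV _ _ _ v(2)])
        show "seqs.subspace ?T" by simp
        show "(\<lambda>j. w j ?t) ` {j \<in> active J A C ?t. r j < r k} \<subseteq> rspace V ?t" using wV by auto
        fix b assume "b \<in> (\<lambda>j. w j ?t) ` {j \<in> active J A C ?t. r j < r k}"
        then obtain j where j: "j \<in> active J A C ?t" "r j < r k" "b = w j ?t" by blast
        have "rmap V i b - w j ?h \<in> ?T"
          using tri[OF i j(1)] j seqs.span_mono[of
              "(\<lambda>k. w k ?h) ` {k \<in> active J A C ?h. r k < r j}" "(\<lambda>j. w j ?h) ` {j \<in> active J A C ?h. r j < r k}"]
          by fastforce
        moreover have "w j ?h \<in> ?T"
        proof (cases "j \<in> active J A C ?h")
          case True
          then show ?thesis using j(2) by (intro seqs.span_base) auto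
        next
          case False
          then have "w j ?h = 0" using w0 j(1) by (auto simp: active_def)
          then show ?thesis by (simp add: seqs.span_zero)
        qed
        ultimately have "(rmap V i b - w j ?h) + w j ?h \<in> ?T" by (rule seqs.span_add)
        then show "rmap V i b \<in> ?T" by simp
      qed
      moreover have "rmap V i (w k ?t) - w k ?h \<in> ?T" using tri[OF i k] .
      ultimately have "rmap V i (v - w k ?t) + (rmap V i (w k ?t) - w k ?h) \<in> ?T"
        by (rule seqs.span_add)
      moreover have "rmap V i (v - w k ?t) + (rmap V i (w k ?t) - w k ?h) = rmap V i v - w k ?h"
        using linear_between_diff[OF lin sV vV wV[OF k]] by simp
      ultimately have d: "rmap V i v - w k ?h \<in> ?T" by metis
      have "rmap V i v \<in> rspace U ?h"
        using subrep_closed[OF U i v(1)] .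
      then show ?thesis using d h kJ tl by (auto simp: G_def Z_def lead_def active_def)
    qed
    have Gle: "(\<Sum>x\<in>G k. \<alpha> x - s) \<le> 0" if k: "k \<in> J" for k
    proof -
      have "G k \<subseteq> {A k..C k}" using ZJ unfolding G_def active_def by fastforce
      moreover have "if \<tau> i then i - 1 \<in> G k \<longrightarrow> i \<in> G k else i \<in> G k \<longrightarrow> i - 1 \<in> G k"
        if "A k < i" "i \<le> C k" for i
        using closed[of i k] that AC[OF k] by auto
      ultimately have "(\<Sum>x\<in>G k. \<alpha> x - avg \<alpha> (A k) (C k)) \<le> 0"
        using stable_interval_closed_sum[of \<alpha> \<tau> "A k" "C k" "G k"] st[OF k] AC[OF k] by blast
      then show ?thesis using st[OF k] by simp
    qed
    \<comment> \<open>Double counting: the degree of \<open>U\<close> is the sum over the strings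
      \<open>k\<close> of the degrees of the vertex sets \<open>G k\<close>.\<close>
    have "Z U x = {k \<in> J. k \<in> Z U x}" for x using ZJ act by blast
    then have "deg ?Q \<alpha> s (dim_vector ?Q U) = (\<Sum>x\<in>{0..l}. (\<alpha> x - s) * real (card {k \<in> J. k \<in> Z U x}))"
      unfolding deg_def by (intro sum.cong) (auto simp: dim_vector_def dimU)
    also have "\<dots> = (\<Sum>k\<in>J. \<Sum>x\<in>{x \<in> {0..l}. k \<in> Z U x}. \<alpha> x - s)"
      by (rule sum_times_card[OF _ finJ]) simp
    also have "\<dots> = (\<Sum>k\<in>J. \<Sum>x\<in>G k. \<alpha> x - s)" by (simp add: G_def)
    also have "\<dots> \<le> 0" by (rule sum_nonpos) (rule Gle)
    finally show ?thesis .
  qed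
  have dimV: "dim_vector ?Q V x = card (active J A C x)" if "x \<le> l" for x
    using frame_dim[OF F[OF that]] that by (simp add: dim_vector_def)
  have "deg ?Q \<alpha> s (dim_vector ?Q V) =
      (\<Sum>x\<in>{0..l}. (\<alpha> x - s) * real (card {k \<in> J. A k \<le> x \<and> x \<le> C k}))"
    unfolding deg_def by (intro sum.cong) (auto simp: dimV active_def)
  also have "\<dots> = (\<Sum>k\<in>J. \<Sum>x\<in>{x \<in> {0..l}. A k \<le> x \<and> x \<le> C k}. \<alpha> x - s)"
    by (rule sum_times_card[OF _ finJ]) simp
  also have "\<dots> = (\<Sum>k\<in>J. 0)"
  proof (rule sum.cong[OF refl])
    fix k assume k: "k \<in> J"
    have "{x \<in> {0..l}. A k \<le> x \<and> x \<le> C k} = {A k..C k}" using AC[OF k] by auto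
    then show "(\<Sum>x\<in>{x \<in> {0..l}. A k \<le> x \<and> x \<le> C k}. \<alpha> x - s) = 0"
      using avg_deviation_sum[of "A k" "C k" \<alpha>] AC[OF k] st[OF k] by simp
  qed
  finally have deg0: "deg ?Q \<alpha> s (dim_vector ?Q V) = 0" by simp
  obtain j where j: "j \<in> J" using \<open>J \<noteq> {}\<close> by blast
  have "j \<in> active J A C (A j)" using j AC[OF j] by (simp add: active_def)
  then have "dim_vector ?Q V (A j) > 0"
    using dimV[of "A j"] AC[OF j] finite_subset[OF act finJ] by (auto simp: card_gt_0_iff)
  then have pos: "total_dim ?Q (dim_vector ?Q V) > 0"
    using AC[OF j] by (auto simp: total_dim_def intro!: sum_pos2[of _ "A j"])
  then have nz: "\<not> zero_rep ?Q V" using zero_rep_iff_total_dim[OF V] by simp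
  have slope: "slope ?Q \<alpha> V = s"
    using deg_shift[of ?Q \<alpha> s "dim_vector ?Q V" "mean ?Q \<alpha> (dim_vector ?Q V)"] deg_mean[OF pos, of \<alpha>] deg0 pos
    by (simp add: slope_eq_mean)
  have "slope ?Q \<alpha> U \<le> slope ?Q \<alpha> V" if U: "subrep ?Q U V" and nzU: "\<not> zero_rep ?Q U" for U
  proof -
    have posU: "total_dim ?Q (dim_vector ?Q U) > 0"
      using zero_rep_iff_total_dim[OF subrep_is_rep[OF U]] nzU by simp
    have "(mean ?Q \<alpha> (dim_vector ?Q U) - s) * real (total_dim ?Q (dim_vector ?Q U)) \<le> 0"
      using deg_shift[of ?Q \<alpha> s "dim_vector ?Q U" "mean ?Q \<alpha> (dim_vector ?Q U)"] deg_mean[OF posU, of \<alpha>]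
        deg_le[OF U] by simp
    then show ?thesis using posU slope by (simp add: slope_eq_mean mult_le_0_iff)
  qed
  then show ?thesis using V nz slope by (simp add: semistable_def)
qed

section \<open>The Harder--Narasimhan type of a sum of stable intervals\<close>

text \<open>The span of the strings in \<open>M\<close> inside \<open>V\<close>. It is a step of the
  filtration for one choice of \<open>M\<close> and a model of the successive quotient for another,
  since the strings split \<open>V\<close>.\<close>

definition string_rep ::
    "('f::field) Arep \<Rightarrow> (nat \<Rightarrow> nat) \<Rightarrow> (nat \<Rightarrow> nat) \<Rightarrow> (nat \<Rightarrow> nat \<Rightarrow> nat \<Rightarrow> 'f) \<Rightarrow>
     nat set \<Rightarrow> 'f Arep" where
  "string_rep V A C w M =
     \<lparr>rspace = (\<lambda>x. seqs.span ((\<lambda>j. w j x) ` active M A C x)), rmap = rmap V\<rparr>"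

lemma active_mono: "M \<subseteq> M' \<Longrightarrow> active M A C x \<subseteq> active M' A C x"
  by (auto simp: active_def)

lemma active_Un: "active (M \<union> M') A C x = active M A C x \<union> active M' A C x"
  by (auto simp: active_def)

lemma A_quiver_ends: "i \<in> arcs (A_quiver l \<tau>) \<Longrightarrow> tail (A_quiver l \<tau>) i \<le> l \<and> head (A_quiver l \<tau>) i \<le> l"
  by auto

context
  fixes l :: nat and \<tau> :: "nat \<Rightarrow> bool" and V :: "('f::field) Arep"
    and J :: "nat set" and A C :: "nat \<Rightarrow> nat" and w :: "nat \<Rightarrow> nat \<Rightarrow> nat \<Rightarrow> 'f"
  assumes V: "is_rep (A_quiver l \<tau>) V" and str: "strings l \<tau> V J A C w"
begin

private abbreviation (input) Q where "Q \<equiv> A_quiver l \<tau>"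

private abbreviation (input) part where "part \<equiv> string_rep V A C w"

lemma string_frame: "x \<le> l \<Longrightarrow> frame (active J A C x) (\<lambda>j. w j x) (rspace V x)"
  using str by (simp add: strings_def string_frames_def)

lemma string_bounds: "j \<in> J \<Longrightarrow> A j \<le> C j \<and> C j \<le> l"
  using str by (simp add: strings_def string_frames_def)

lemma string_rmap:
  "i \<in> arcs Q \<Longrightarrow> j \<in> active J A C (tail Q i) \<Longrightarrow>
    rmap V i (w j (tail Q i)) = w j (head Q i)"
  using str unfolding strings_def by blast

lemma string_zero: "j \<in> J \<Longrightarrow> \<not> (A j \<le> x \<and> x \<le> C j) \<Longrightarrow> w j x = 0"
  using str by (auto simp: strings_def string_frames_def)

lemma string_linear: "i \<in> arcs Q \<Longrightarrow>
    linear_between (rspace V (tail Q i)) (rspace V (head Q i)) (rmap V i)"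
  using V by (simp add: is_rep_def)

lemma string_rep_frame:
  "M \<subseteq> J \<Longrightarrow> x \<le> l \<Longrightarrow> frame (active M A C x) (\<lambda>j. w j x) (rspace (part M) x)"
  unfolding string_rep_def using frame_subset[OF string_frame active_mono] by simp

lemma string_rep_subset: "M \<subseteq> M' \<Longrightarrow> rspace (part M) x \<subseteq> rspace (part M') x"
  unfolding string_rep_def by (simp add: seqs.span_mono image_mono active_mono)

lemma string_rep_all: "x \<le> l \<Longrightarrow> rspace (part J) x = rspace V x"
  using string_frame[of x] by (simp add: string_rep_def frame_def)

lemma string_rep_is_rep:
  assumes M: "M \<subseteq> J"
  shows "is_rep Q (part M)"
proof -
  let ?S = "part M"
  have "linear_between (rspace ?S (tail Q i)) (rspace ?S (head Q i)) (rmap V i)"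
    if i: "i \<in> arcs Q" for i
  proof -
    let ?t = "tail Q i" and ?h = "head Q i"
    have tl: "?t \<le> l" "?h \<le> l" using A_quiver_ends[OF i] by auto
    have sub: "rspace ?S ?t \<subseteq> rspace V ?t"
      using string_rep_subset[OF M] string_rep_all[OF tl(1)] by blast
    have "rmap V i v \<in> rspace ?S ?h" if v: "v \<in> rspace ?S ?t" for v
    proof (rule linear_between_span[OF string_linear[OF i]])
      show "seqs.subspace (rspace V ?t)" using frame_subspace[OF string_frame[OF tl(1)]] .
      show "seqs.subspace (rspace ?S ?h)" by (simp add: string_rep_def)
      show "(\<lambda>j. w j ?t) ` active M A C ?t \<subseteq> rspace V ?t"
        using frame_mem[OF string_frame[OF tl(1)]] active_mono[OF M] by blast
      show "v \<in> seqs.span ((\<lambda>j. w j ?t) ` active M A C ?t)" using v by (simp add: string_rep_def)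
      fix b assume "b \<in> (\<lambda>j. w j ?t) ` active M A C ?t"
      then obtain j where j: "j \<in> active M A C ?t" "b = w j ?t" by blast
      then have "rmap V i b = w j ?h" using string_rmap[OF i] active_mono[OF M] by blast
      moreover have "w j ?h \<in> rspace ?S ?h"
      proof (cases "j \<in> active M A C ?h")
        case True
        then show ?thesis using frame_mem[OF string_rep_frame[OF M tl(2)]] by blast
      next
        case False
        then have "w j ?h = 0" using j M by (intro string_zero) (auto simp: active_def)
        then show ?thesis by (simp add: string_rep_def seqs.span_zero)
      qed
      ultimately show "rmap V i b \<in> rspace ?S ?h" by simp
    qed
    then show ?thesis
      using string_linear[OF i] sub unfolding linear_between_def by (meson subsetD)
  qed
  then show ?thesis
    using frame_fd[OF string_rep_frame[OF M]] unfolding is_rep_def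
    by (auto simp: string_rep_def simp del: A_quiver_simps(3,4))
qed

lemma string_rep_subrep:
  "M \<subseteq> M' \<Longrightarrow> M' \<subseteq> J \<Longrightarrow> subrep Q (part M) (part M')"
  unfolding subrep_def using string_rep_is_rep string_rep_subset
  by (auto simp: string_rep_def simp del: A_quiver_simps)

lemma string_rep_subrep_all:
  assumes "M \<subseteq> J"
  shows "subrep Q (part M) V"
proof -
  have "rspace (part M) x \<subseteq> rspace V x" if "x \<le> l" for x
    using string_rep_subset[OF assms, of x] string_rep_all[OF that] by simp
  then show ?thesis
    using string_rep_is_rep[OF assms] unfolding subrep_def by (auto simp: string_rep_def)
qed

text \<open>The projection is defined on basis vectors, killing the strings of \<open>M1\<close> and
  fixing those of \<open>M2\<close>. It commutes with the structure maps because both spans are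
  stable under them.\<close>

lemma string_rep_quotient:
  assumes M: "M1 \<union> M2 \<subseteq> J" "M1 \<inter> M2 = {}"
  shows "is_quotient Q (part (M1 \<union> M2)) (part M1) (part M2)"
proof -
  let ?Q = Q
  let ?F = "part (M1 \<union> M2)" and ?F1 = "part M1" and ?F2 = "part M2"
  have M1: "M1 \<subseteq> J" and M2: "M2 \<subseteq> J" using M by auto
  have "\<exists>f. linear_between (rspace ?F x) (rspace ?F2 x) f \<and>
      (\<forall>j\<in>active (M1 \<union> M2) A C x. f (w j x) = (if j \<in> M2 then w j x else 0))" if x: "x \<le> l" for x
  proof (rule linear_between_frame_exists[OF string_rep_frame[OF M(1) x]])
    show sub: "seqs.subspace (rspace ?F2 x)" using frame_subspace[OF string_rep_frame[OF M2 x]] .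
    show "(if j \<in> M2 then w j x else 0) \<in> rspace ?F2 x" if "j \<in> active (M1 \<union> M2) A C x" for j
      using that frame_mem[OF string_rep_frame[OF M2 x], of j] seqs.subspace_0[OF sub]
      by (auto simp: active_def)
  qed
  then obtain \<pi> where lin: "\<And>x. x \<le> l \<Longrightarrow> linear_between (rspace ?F x) (rspace ?F2 x) (\<pi> x)"
    and \<pi>: "\<And>x j. x \<le> l \<Longrightarrow> j \<in> active (M1 \<union> M2) A C x \<Longrightarrow> \<pi> x (w j x) = (if j \<in> M2 then w j x else 0)"
    by metis
  have split: "\<exists>v1 v2. v = v1 + v2 \<and> v1 \<in> rspace ?F1 x \<and> v2 \<in> rspace ?F2 x" if "v \<in> rspace ?F x" for v x
    using that by (auto simp: string_rep_def active_Un image_Un seqs.span_Un)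
  have \<pi>1: "\<pi> x v = 0" if "x \<le> l" "v \<in> rspace ?F1 x" for x v
  proof (rule linear_between_eq_on_frame[OF string_rep_frame[OF M1 that(1)], where f = "\<pi> x" and g = "\<lambda>_. 0" and v = v
      and T = "rspace ?F2 x" and T' = "{0}"])
    show "linear_between (rspace ?F1 x) (rspace ?F2 x) (\<pi> x)"
      using lin[OF that(1)] string_rep_subset[of M1 "M1 \<union> M2" x] unfolding linear_between_def
      by (meson Un_upper1 subsetD)
    show "linear_between (rspace ?F1 x) {0} (\<lambda>_. 0)" by (simp add: linear_between_def)
    show "\<pi> x (w j x) = 0" if "j \<in> active M1 A C x" for j
    proof -
      have "j \<in> active (M1 \<union> M2) A C x" "j \<notin> M2" using that M(2) by (auto simp: active_def)
      then show ?thesis using \<pi>[OF \<open>x \<le> l\<close>] by simp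
    qed
    show "v \<in> rspace ?F1 x" by fact
  qed
  have \<pi>2: "\<pi> x v = v" if "x \<le> l" "v \<in> rspace ?F2 x" for x v
  proof (rule linear_between_eq_on_frame[OF string_rep_frame[OF M2 that(1)], where f = "\<pi> x" and g = "\<lambda>v. v" and v = v
      and T = "rspace ?F2 x" and T' = "rspace ?F2 x"])
    show "linear_between (rspace ?F2 x) (rspace ?F2 x) (\<pi> x)"
      using lin[OF that(1)] string_rep_subset[of M2 "M1 \<union> M2" x] unfolding linear_between_def
      by (meson Un_upper2 subsetD)
    show "linear_between (rspace ?F2 x) (rspace ?F2 x) (\<lambda>v. v)" by (simp add: linear_between_def)
    show "\<pi> x (w j x) = w j x" if "j \<in> active M2 A C x" for j
    proof -
      have "j \<in> active (M1 \<union> M2) A C x" "j \<in> M2" using that by (auto simp: active_def)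
      then show ?thesis using \<pi>[OF \<open>x \<le> l\<close>] by simp
    qed
    show "v \<in> rspace ?F2 x" by fact
  qed
  have sub12: "rspace ?F1 x \<subseteq> rspace ?F x" "rspace ?F2 x \<subseteq> rspace ?F x" for x
    by (simp_all add: string_rep_subset)
  have \<pi>12: "\<pi> x (v1 + v2) = v2" if "x \<le> l" "v1 \<in> rspace ?F1 x" "v2 \<in> rspace ?F2 x" for x v1 v2
    using linear_betweenD(2)[OF lin[OF that(1)], of v1 v2] sub12 that \<pi>1 \<pi>2 by auto
  have "\<pi> (head ?Q i) (rmap ?F i v) = rmap ?F2 i (\<pi> (tail ?Q i) v)"
    if i: "i \<in> arcs ?Q" and v: "v \<in> rspace ?F (tail ?Q i)" for i v
  proof -
    let ?t = "tail ?Q i" and ?h = "head ?Q i"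
    have tl: "?t \<le> l" "?h \<le> l" using A_quiver_ends[OF i] by auto
    obtain v1 v2 where v12: "v = v1 + v2" "v1 \<in> rspace ?F1 ?t" "v2 \<in> rspace ?F2 ?t" using split[OF v] by blast
    have r1: "rmap V i v1 \<in> rspace ?F1 ?h" and r2: "rmap V i v2 \<in> rspace ?F2 ?h"
      using string_rep_is_rep[OF M1] string_rep_is_rep[OF M2] i v12
      unfolding is_rep_def linear_between_def by (auto simp: string_rep_def simp del: A_quiver_simps)
    have "rmap V i v = rmap V i v1 + rmap V i v2"
      using linear_betweenD(2)[OF string_linear[OF i], of v1 v2] v12 string_rep_subset[OF M1, of ?t]
        string_rep_subset[OF M2, of ?t] string_rep_all[OF tl(1)] by blast
    then have "\<pi> ?h (rmap V i v) = rmap V i v2" using \<pi>12[OF tl(2) r1 r2] by simp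
    moreover have "\<pi> ?t v = v2" using \<pi>12[OF tl(1) v12(2,3)] v12(1) by simp
    ultimately show ?thesis by (simp add: string_rep_def)
  qed
  then have mor: "rep_morphism ?Q ?F ?F2 \<pi>" using lin by (auto simp: rep_morphism_def simp del: A_quiver_simps(3,4))
  have "\<pi> x ` rspace ?F x = rspace ?F2 x" if "x \<le> l" for x
  proof
    show "\<pi> x ` rspace ?F x \<subseteq> rspace ?F2 x" using linear_betweenD(1)[OF lin[OF that]] by blast
    show "rspace ?F2 x \<subseteq> \<pi> x ` rspace ?F x" 
    proof
      fix v assume "v \<in> rspace ?F2 x"
      then show "v \<in> \<pi> x ` rspace ?F x" using \<pi>2[OF that] sub12(2)[of x] by (intro image_eqI[of _ _ v]) auto
    qed
  qed
  moreover have "{v \<in> rspace ?F x. \<pi> x v = 0} = rspace ?F1 x" if x: "x \<le> l" for x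
  proof
    show "rspace ?F1 x \<subseteq> {v \<in> rspace ?F x. \<pi> x v = 0}" using sub12(1)[of x] \<pi>1[OF x] by blast
    show "{v \<in> rspace ?F x. \<pi> x v = 0} \<subseteq> rspace ?F1 x"
    proof
      fix v assume v: "v \<in> {v \<in> rspace ?F x. \<pi> x v = 0}"
      then obtain v1 v2 where v12: "v = v1 + v2" "v1 \<in> rspace ?F1 x" "v2 \<in> rspace ?F2 x" using split[of v x] by blast
      then have "v2 = 0" using \<pi>12[OF x v12(2,3)] v by simp
      then show "v \<in> rspace ?F1 x" using v12 by simp
    qed
  qed
  ultimately have "\<forall>x\<in>verts ?Q. \<pi> x ` rspace ?F x = rspace ?F2 x \<and>
      {v \<in> rspace ?F x. \<pi> x v = 0} = rspace ?F1 x" by simp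
  then show ?thesis
    using mor string_rep_subrep[of M1 "M1 \<union> M2", OF _ M(1)] string_rep_is_rep[OF M2]
    unfolding is_quotient_def by blast
qed

lemma string_rep_strings:
  assumes M: "M \<subseteq> J"
  shows "string_frames l (part M) M A C w"
  unfolding string_frames_def
  using string_rep_frame[OF M] string_bounds string_zero M str
  by (auto simp: strings_def string_frames_def intro: finite_subset)

text \<open>The diagonal case of \<open>semistable_triangular\<close>: the lower terms vanish, so
  the order of the labels will do.\<close>

lemma string_rep_semistable:
  assumes M: "M \<subseteq> J" "M \<noteq> {}"
    and st: "\<And>j. j \<in> M \<Longrightarrow> stable_interval \<alpha> \<tau> (A j) (C j) \<and> avg \<alpha> (A j) (C j) = s"
  shows "semistable Q \<alpha> (part M)"
    and "slope Q \<alpha> (part M) = s"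
proof -
  have "semistable Q \<alpha> (part M) \<and> slope Q \<alpha> (part M) = s"
  proof (rule semistable_triangular[OF string_rep_is_rep[OF M(1)] string_rep_strings[OF M(1)] M(2), of id])
    show "rmap (part M) i (w j (tail Q i)) - w j (head Q i)
        \<in> seqs.span ((\<lambda>k. w k (head Q i)) ` {k \<in> active M A C (head Q i). id k < id j})"
      if "i \<in> arcs Q" "j \<in> active M A C (tail Q i)" for i j
    proof -
      have "j \<in> active J A C (tail Q i)" using that(2) active_mono[OF M(1)] by blast
      from string_rmap[OF that(1) this]
      have "rmap (part M) i (w j (tail Q i)) - w j (head Q i) = 0"
        unfolding string_rep_def by (simp only: qrep.simps diff_self)
      then show ?thesis by (simp only: seqs.span_zero)
    qed
  qed (use st in auto)
  then show "semistable Q \<alpha> (part M)"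
    "slope Q \<alpha> (part M) = s" by auto
qed

text \<open>The strings enter the filtration by decreasing slope, all strings of one slope at once.
  The second claim recovers the list of slopes from the type, so that equal types can be compared
  slope by slope.\<close>

lemma string_HN_type:
  assumes st: "\<And>j. j \<in> J \<Longrightarrow> stable_interval \<alpha> \<tau> (A j) (C j)"
  defines "L \<equiv> rev (sorted_list_of_set ((\<lambda>j. avg \<alpha> (A j) (C j)) ` J))"
  shows "HN_type Q \<alpha> V =
      map (\<lambda>s. \<lambda>x\<in>{0..l}. card {j \<in> J. avg \<alpha> (A j) (C j) = s \<and> A j \<le> x \<and> x \<le> C j}) L"
    and "map (mean Q \<alpha>) (HN_type Q \<alpha> V) = L"
proof -
  let ?Q = Q
  let ?sl = "\<lambda>j. avg \<alpha> (A j) (C j)"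
  define n where "n = length L"
  \<comment> \<open>The list \<open>L\<close> is indexed from 0, while the factors are numbered from
    1.\<close>
  define P where "P i = {j \<in> J. ?sl j = L ! (i - 1)}" for i
  define R where "R i = (\<Union>k\<in>{1..i}. P k)" for i
  define F where "F i = part (R i)" for i
  define S where "S i = part (P i)" for i
  have finJ: "finite J" using str by (simp add: strings_def string_frames_def)
  have setL: "set L = ?sl ` J" using finJ by (simp add: L_def)
  have dec: "L ! j < L ! i" if "i < j" "j < length L" for i j
  proof -
    have "sorted_wrt (<) (sorted_list_of_set (?sl ` J))" by simp
    then have "sorted_wrt (>) L" unfolding L_def by (simp add: sorted_wrt_rev)
    then show ?thesis using that by (simp add: sorted_wrt_iff_nth_less)
  qed
  have PJ: "P i \<subseteq> J" and RJ: "R i \<subseteq> J" for i by (auto simp: P_def R_def)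
  have Pne: "P i \<noteq> {}" if "i \<in> {1..n}" for i
  proof -
    have "i - 1 < length L" using that by (auto simp: n_def)
    then have "L ! (i - 1) \<in> ?sl ` J" using nth_mem[of "i - 1" L] setL by (simp add: n_def)
    then show ?thesis by (auto simp: P_def)
  qed
  have disj: "R (i - 1) \<inter> P i = {}" if i: "i \<in> {1..n}" for i
  proof -
    have "L ! (i - 1) < L ! (k - 1)" if "k \<in> {1..i - 1}" for k
      using dec[of "k - 1" "i - 1"] i that by (auto simp: n_def)
    then show ?thesis by (force simp: R_def P_def)
  qed
  have RUn: "R i = R (i - 1) \<union> P i" if i: "i \<in> {1..n}" for i
  proof -
    have "{1..i} = insert i {1..i - 1}" using i by auto
    then show ?thesis by (auto simp: R_def)
  qed
  have ss: "semistable ?Q \<alpha> (S i)" "slope ?Q \<alpha> (S i) = L ! (i - 1)" if i: "i \<in> {1..n}" for i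
    unfolding S_def using string_rep_semistable[OF PJ Pne[OF i], of \<alpha> "L ! (i - 1)"] st
    by (auto simp: P_def)
  have q: "is_quotient ?Q (F i) (F (i - 1)) (S i)" if i: "i \<in> {1..n}" for i
    unfolding F_def S_def
    using string_rep_quotient[of "R (i - 1)" "P i"] RUn[OF i] RJ[of i] disj[OF i] by simp
  \<comment> \<open>A string of the new slope makes the dimension grow at its own left end.\<close>
  have nsame: "\<not> same_spaces ?Q (F (i - 1)) (F i)" if i: "i \<in> {1..n}" for i
  proof
    assume same: "same_spaces ?Q (F (i - 1)) (F i)"
    obtain j where j: "j \<in> P i" using Pne[OF i] by blast
    have jl: "A j \<le> l" and jA: "j \<in> active (R i) A C (A j)"
      using j string_bounds[of j] PJ RUn[OF i] by (fastforce simp: active_def)+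
    have dims: "seqs.dim (rspace (F k) (A j)) = card (active (R k) A C (A j))" for k
      unfolding F_def using frame_dim[OF string_rep_frame[OF RJ jl]] .
    have "card (active (R (i - 1)) A C (A j)) < card (active (R i) A C (A j))"
    proof (rule psubset_card_mono)
      show "finite (active (R i) A C (A j))"
        using finite_subset[OF RJ finJ] by (simp add: active_def)
      have "j \<notin> active (R (i - 1)) A C (A j)" using j disj[OF i] by (auto simp: active_def)
      then show "active (R (i - 1)) A C (A j) \<subset> active (R i) A C (A j)"
        using jA active_mono[of "R (i - 1)" "R i" A C] RUn[OF i] by blast
    qed
    moreover have "rspace (F (i - 1)) (A j) = rspace (F i) (A j)"
      using same jl by (simp add: same_spaces_def)
    ultimately show False using dims[of "i - 1"] dims[of i] by simp
  qed
  have Rn: "R n = J"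
  proof
    show "J \<subseteq> R n"
    proof
      fix j assume j: "j \<in> J"
      then obtain k where "k < n" "L ! k = ?sl j" using setL by (metis imageI in_set_conv_nth n_def)
      then show "j \<in> R n" using j by (auto simp: R_def P_def intro!: bexI[of _ "Suc k"])
    qed
  qed (rule RJ)
  have "HN_filtration ?Q \<alpha> V n F S"
    unfolding HN_filtration_def
  proof (intro conjI ballI)
    show "subrep ?Q (F i) V" for i unfolding F_def by (rule string_rep_subrep_all[OF RJ])
    show "zero_rep ?Q (F 0)" by (simp add: zero_rep_def F_def R_def string_rep_def active_def)
    show "same_spaces ?Q (F n) V" using string_rep_all by (simp add: same_spaces_def F_def Rn)
    show "subrep ?Q (F (i - 1)) (F i)" if "i \<in> {1..n}" for i
      unfolding F_def using RUn[OF that] RJ by (intro string_rep_subrep) auto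
    show "slope ?Q \<alpha> (S (i + 1)) < slope ?Q \<alpha> (S i)" if "i \<in> {1..<n}" for i
      using ss(2)[of i] ss(2)[of "i + 1"] dec[of "i - 1" i] that by (auto simp: n_def)
  qed (use nsame q ss(1) in auto)
  then have HN: "HN_type ?Q \<alpha> V = map (\<lambda>i. dim_vector ?Q (S i)) [1..<n + 1]"
    by (intro HN_type_eqI[OF fin_digraph_A_quiver]) (auto simp: is_HN_type_def)
  have dS: "dim_vector ?Q (S i) = (\<lambda>x\<in>{0..l}. card {j \<in> J. ?sl j = L ! (i - 1) \<and> A j \<le> x \<and> x \<le> C j})" for i
  proof -
    have "seqs.dim (rspace (S i) x) = card {j \<in> J. ?sl j = L ! (i - 1) \<and> A j \<le> x \<and> x \<le> C j}"
      if "x \<in> {0..l}" for x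
      using frame_dim[OF string_rep_frame[OF PJ, of x i]] that
      by (simp add: S_def active_def P_def conj_ac)
    then show ?thesis by (auto simp: dim_vector_def restrict_def fun_eq_iff)
  qed
  have idx: "map (\<lambda>i. f (L ! (i - 1))) [1..<n + 1] = map f L" for f :: "real \<Rightarrow> 'z"
    by (rule nth_equalityI) (simp_all add: n_def del: upt_Suc)
  show "HN_type ?Q \<alpha> V = map (\<lambda>s. \<lambda>x\<in>{0..l}. card {j \<in> J. ?sl j = s \<and> A j \<le> x \<and> x \<le> C j}) L"
    unfolding HN dS by (rule idx)
  have "map (mean ?Q \<alpha>) (HN_type ?Q \<alpha> V) = map (\<lambda>i. L ! (i - 1)) [1..<n + 1]"
    unfolding HN map_map comp_def slope_eq_mean[symmetric]
    using ss(2) by (intro map_cong) (auto simp del: upt_Suc)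
  then show "map (mean ?Q \<alpha>) (HN_type ?Q \<alpha> V) = L" using idx[of "\<lambda>s. s"] by simp
qed

end

section \<open>Stability of all intervals implies completeness\<close>

text \<open>Equal types give equal lists of slopes, hence equal counts at each slope that occurs; at
  any other \<open>s\<close> both counts are zero.\<close>

lemma strings_counts_eq:
  fixes V W :: "('f::field) Arep"
  assumes V: "is_rep (A_quiver l \<tau>) V" "strings l \<tau> V J A C w"
    and W: "is_rep (A_quiver l \<tau>) W" "strings l \<tau> W J' A' C' w'"
    and st: "\<And>a c. a \<le> c \<Longrightarrow> c \<le> l \<Longrightarrow> stable_interval \<alpha> \<tau> a c"
    and HN: "HN_type (A_quiver l \<tau>) \<alpha> V = HN_type (A_quiver l \<tau>) \<alpha> W"
    and x: "x \<le> l"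
  shows "card {j \<in> J. avg \<alpha> (A j) (C j) = s \<and> A j \<le> x \<and> x \<le> C j} =
    card {j \<in> J'. avg \<alpha> (A' j) (C' j) = s \<and> A' j \<le> x \<and> x \<le> C' j}"
proof -
  let ?f = "\<lambda>s. \<lambda>x\<in>{0..l}. card {j \<in> J. avg \<alpha> (A j) (C j) = s \<and> A j \<le> x \<and> x \<le> C j}"
  let ?f' = "\<lambda>s. \<lambda>x\<in>{0..l}. card {j \<in> J'. avg \<alpha> (A' j) (C' j) = s \<and> A' j \<le> x \<and> x \<le> C' j}"
  let ?L = "rev (sorted_list_of_set ((\<lambda>j. avg \<alpha> (A j) (C j)) ` J))"
  let ?L' = "rev (sorted_list_of_set ((\<lambda>j. avg \<alpha> (A' j) (C' j)) ` J'))"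
  have stV: "stable_interval \<alpha> \<tau> (A j) (C j)" if "j \<in> J" for j
    using st string_bounds[OF V that] by blast
  have stW: "stable_interval \<alpha> \<tau> (A' j) (C' j)" if "j \<in> J'" for j
    using st string_bounds[OF W that] by blast
  have L: "?L = ?L'"
    using string_HN_type(2)[OF V stV] string_HN_type(2)[OF W stW] HN by simp
  have "map ?f ?L = map ?f' ?L'"
    using string_HN_type(1)[OF V stV] string_HN_type(1)[OF W stW] HN by simp
  then have eq: "\<forall>s\<in>set ?L. ?f s = ?f' s" unfolding L by (simp only: map_eq_conv)
  have fin: "finite J" "finite J'" using V(2) W(2) by (auto simp: strings_def string_frames_def)
  have set: "set ?L = (\<lambda>j. avg \<alpha> (A j) (C j)) ` J" "set ?L' = (\<lambda>j. avg \<alpha> (A' j) (C' j)) ` J'"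
    using fin by simp_all
  show ?thesis
  proof (cases "s \<in> set ?L")
    case True
    have "?f s x = ?f' s x" using fun_cong[OF bspec[OF eq True], of x] .
    then show ?thesis using x by simp
  next
    case False
    then have "{j \<in> J. avg \<alpha> (A j) (C j) = s \<and> A j \<le> x \<and> x \<le> C j} = {}" using set(1) by blast
    moreover have "s \<notin> set ?L'" using False L by simp
    then have "{j \<in> J'. avg \<alpha> (A' j) (C' j) = s \<and> A' j \<le> x \<and> x \<le> C' j} = {}" using set(2) by blast
    ultimately show ?thesis by (simp only: card.empty)
  qed
qed

text \<open>For a fixed left end \<open>a\<close> at most one right end yields the mean
  \<open>s\<close>, so the strings of slope \<open>s\<close> starting at \<open>a\<close> either all
  reach \<open>x\<close> or all stop before it. The count at \<open>x\<close> is therefore the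
  number starting at \<open>x\<close> plus a term determined by the numbers starting
  earlier.\<close>

lemma card_intervals_through:
  fixes \<alpha> :: "nat \<Rightarrow> real"
  assumes "finite J" and AC: "\<And>j. j \<in> J \<Longrightarrow> A j \<le> C j \<and> C j \<le> l"
    and neq: "\<And>a c c'. a \<le> c \<Longrightarrow> c < c' \<Longrightarrow> c' \<le> l \<Longrightarrow> avg \<alpha> a c \<noteq> avg \<alpha> a c'"
  shows "card {j \<in> J. avg \<alpha> (A j) (C j) = s \<and> A j \<le> x \<and> x \<le> C j} =
    card {j \<in> J. avg \<alpha> (A j) (C j) = s \<and> A j = x} +
    (\<Sum>a<x. if \<exists>c. a \<le> c \<and> x \<le> c \<and> c \<le> l \<and> avg \<alpha> a c = s
      then card {j \<in> J. avg \<alpha> (A j) (C j) = s \<and> A j = a} else 0)"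
proof -
  define M where "M a = {j \<in> J. avg \<alpha> (A j) (C j) = s \<and> A j = a \<and> x \<le> C j}" for a
  have fin: "finite (M a)" for a using assms(1) by (simp add: M_def)
  have "{j \<in> J. avg \<alpha> (A j) (C j) = s \<and> A j \<le> x \<and> x \<le> C j} = (\<Union>a\<in>{..x}. M a)"
    by (auto simp: M_def)
  then have "card {j \<in> J. avg \<alpha> (A j) (C j) = s \<and> A j \<le> x \<and> x \<le> C j} = (\<Sum>a\<le>x. card (M a))"
    using fin by (subst card_UN_disjoint[symmetric]) (auto simp: M_def)
  also have "\<dots> = card (M x) + (\<Sum>a<x. card (M a))"
    by (simp add: lessThan_Suc_atMost[symmetric])
  also have "M x = {j \<in> J. avg \<alpha> (A j) (C j) = s \<and> A j = x}" using AC by (auto simp: M_def)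
  also have "(\<Sum>a<x. card (M a)) = (\<Sum>a<x. if \<exists>c. a \<le> c \<and> x \<le> c \<and> c \<le> l \<and> avg \<alpha> a c = s
      then card {j \<in> J. avg \<alpha> (A j) (C j) = s \<and> A j = a} else 0)"
  proof (rule sum.cong[OF refl])
    fix a
    show "card (M a) = (if \<exists>c. a \<le> c \<and> x \<le> c \<and> c \<le> l \<and> avg \<alpha> a c = s
      then card {j \<in> J. avg \<alpha> (A j) (C j) = s \<and> A j = a} else 0)"
    proof (cases "\<exists>c. a \<le> c \<and> x \<le> c \<and> c \<le> l \<and> avg \<alpha> a c = s")
      case True
      then obtain c where c: "a \<le> c" "x \<le> c" "c \<le> l" "avg \<alpha> a c = s" by blast
      have "x \<le> C j" if "j \<in> J" "avg \<alpha> (A j) (C j) = s" "A j = a" for j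
        using neq[of a c "C j"] neq[of a "C j" c] c AC[OF that(1)] that by (cases c "C j" rule: linorder_cases) auto
      then have "M a = {j \<in> J. avg \<alpha> (A j) (C j) = s \<and> A j = a}" by (auto simp: M_def)
      then show ?thesis using True by simp
    next
      case False
      then have "M a = {}" using AC by (auto simp: M_def)
      then show ?thesis unfolding if_not_P[OF False] by simp
    qed
  qed
  finally show ?thesis .
qed

text \<open>The recursion of \<open>card_intervals_through\<close> is solved from left to right for
  the number of strings with given slope and left end; these two data fix the right end.\<close>

lemma multiplicity_eq:
  fixes \<alpha> :: "nat \<Rightarrow> real"
  assumes J: "finite J" "\<And>j. j \<in> J \<Longrightarrow> A j \<le> C j \<and> C j \<le> l"
    and J': "finite J'" "\<And>j. j \<in> J' \<Longrightarrow> A' j \<le> C' j \<and> C' j \<le> l"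
    and neq: "\<And>a c c'. a \<le> c \<Longrightarrow> c < c' \<Longrightarrow> c' \<le> l \<Longrightarrow> avg \<alpha> a c \<noteq> avg \<alpha> a c'"
    and eq: "\<And>s x. x \<le> l \<Longrightarrow> card {j \<in> J. avg \<alpha> (A j) (C j) = s \<and> A j \<le> x \<and> x \<le> C j} =
      card {j \<in> J'. avg \<alpha> (A' j) (C' j) = s \<and> A' j \<le> x \<and> x \<le> C' j}"
  shows "card {j \<in> J. A j = a \<and> C j = c} = card {j \<in> J'. A' j = a \<and> C' j = c}"
proof (cases "a \<le> c \<and> c \<le> l")
  case False
  then have e: "{j \<in> J. A j = a \<and> C j = c} = {}" "{j \<in> J'. A' j = a \<and> C' j = c} = {}"
    using J(2) J'(2) by blast+
  show ?thesis by (simp only: e card.empty)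
next
  case True
  define s where "s = avg \<alpha> a c"
  have *: "card {j \<in> J. avg \<alpha> (A j) (C j) = s \<and> A j = x} = card {j \<in> J'. avg \<alpha> (A' j) (C' j) = s \<and> A' j = x}"
    if "x \<le> l" for x
    using that
  proof (induction x rule: less_induct)
    case (less x)
    let ?n = "\<lambda>J A C a. card {j \<in> J. avg \<alpha> (A j) (C j) = s \<and> A j = a}"
    have "card {j \<in> J. avg \<alpha> (A j) (C j) = s \<and> A j \<le> x \<and> x \<le> C j} = ?n J A C x +
        (\<Sum>a<x. if \<exists>c. a \<le> c \<and> x \<le> c \<and> c \<le> l \<and> avg \<alpha> a c = s then ?n J A C a else 0)"
      by (rule card_intervals_through[OF J neq])
    moreover have "card {j \<in> J'. avg \<alpha> (A' j) (C' j) = s \<and> A' j \<le> x \<and> x \<le> C' j} = ?n J' A' C' x +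
        (\<Sum>a<x. if \<exists>c. a \<le> c \<and> x \<le> c \<and> c \<le> l \<and> avg \<alpha> a c = s then ?n J' A' C' a else 0)"
      by (rule card_intervals_through[OF J' neq])
    moreover have "(\<Sum>a<x. if \<exists>c. a \<le> c \<and> x \<le> c \<and> c \<le> l \<and> avg \<alpha> a c = s
        then card {j \<in> J. avg \<alpha> (A j) (C j) = s \<and> A j = a} else 0) =
      (\<Sum>a<x. if \<exists>c. a \<le> c \<and> x \<le> c \<and> c \<le> l \<and> avg \<alpha> a c = s
        then card {j \<in> J'. avg \<alpha> (A' j) (C' j) = s \<and> A' j = a} else 0)"
      using less by (intro sum.cong) auto
    ultimately show ?case
      using eq[OF less.prems, of s] by linarith
  qed
  have c: "c' = c" if "a \<le> c'" "c' \<le> l" "avg \<alpha> a c' = s" for c'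
  proof (rule ccontr)
    assume "c' \<noteq> c"
    then consider "c < c'" | "c' < c" by linarith
    then show False
    proof cases
      case 1
      then show False using neq[OF _ 1 that(2), of a] True that(3) by (simp add: s_def)
    next
      case 2
      then show False using neq[OF that(1) 2] True that(3) by (simp add: s_def)
    qed
  qed
  have "{j \<in> J. A j = a \<and> C j = c} = {j \<in> J. avg \<alpha> (A j) (C j) = s \<and> A j = a}"
    using c J(2) unfolding s_def by blast
  moreover have "{j \<in> J'. A' j = a \<and> C' j = c} = {j \<in> J'. avg \<alpha> (A' j) (C' j) = s \<and> A' j = a}"
    using c J'(2) unfolding s_def by blast
  ultimately show ?thesis using *[of a] True by simp
qed

section \<open>Isomorphisms from a matching of strings\<close>

lemma bij_betw_of_fibres:
  assumes "finite J" "finite J'"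
    and card: "\<And>q. card {j \<in> J. f j = q} = card {j \<in> J'. f' j = q}"
  shows "\<exists>\<sigma>. bij_betw \<sigma> J J' \<and> (\<forall>j\<in>J. f' (\<sigma> j) = f j)"
proof -
  have "\<exists>h. bij_betw h {j \<in> J. f j = q} {j \<in> J'. f' j = q}" for q
    using assms by (intro finite_same_card_bij) auto
  then obtain h where h: "\<And>q. bij_betw (h q) {j \<in> J. f j = q} {j \<in> J'. f' j = q}" by metis
  let ?s = "\<lambda>j. h (f j) j"
  have s: "?s j \<in> J' \<and> f' (?s j) = f j" if "j \<in> J" for j
    using bij_betwE[OF h[of "f j"]] that by blast
  have "inj_on ?s J"
  proof (rule inj_onI)
    fix i j assume ij: "i \<in> J" "j \<in> J" "?s i = ?s j"
    then have "f i = f j" using s by metis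
    then show "i = j" using ij bij_betw_imp_inj_on[OF h[of "f j"]] by (auto dest: inj_onD)
  qed
  moreover have "?s ` J = J'"
  proof
    show "?s ` J \<subseteq> J'" using s by blast
    show "J' \<subseteq> ?s ` J"
    proof
      fix k assume "k \<in> J'"
      then have "k \<in> h (f' k) ` {j \<in> J. f j = f' k}" using bij_betw_imp_surj_on[OF h[of "f' k"]] by simp
      then obtain j where "j \<in> J" "f j = f' k" "k = h (f' k) j" by auto
      then show "k \<in> ?s ` J" by (intro image_eqI[of _ _ j]) simp_all
    qed
  qed
  ultimately show ?thesis using s by (auto simp: bij_betw_def intro!: exI[of _ ?s])
qed

lemma frame_reindex:
  assumes "frame J' b S" "bij_betw \<sigma> J J'"
  shows "frame J (\<lambda>j. b (\<sigma> j)) S"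
proof -
  have "(\<lambda>j. b (\<sigma> j)) ` J = b ` J'" using assms(2) by (auto simp: bij_betw_def)
  moreover have "inj_on (\<lambda>j. b (\<sigma> j)) J"
    using assms comp_inj_on[of \<sigma> J b] by (auto simp: bij_betw_def frame_def comp_def)
  ultimately show ?thesis using assms bij_betw_finite[OF assms(2)] by (simp add: frame_def)
qed

lemma linear_between_comp:
  "linear_between S T f \<Longrightarrow> linear_between T U g \<Longrightarrow> linear_between S U (\<lambda>v. g (f v))"
  by (simp add: linear_between_def)

lemma strings_iso:
  fixes V W :: "('f::field) Arep"
  assumes V: "is_rep (A_quiver l \<tau>) V" "strings l \<tau> V J A C w"
    and W: "is_rep (A_quiver l \<tau>) W" "strings l \<tau> W J' A' C' w'"
    and \<sigma>: "bij_betw \<sigma> J J'" "\<And>j. j \<in> J \<Longrightarrow> A' (\<sigma> j) = A j \<and> C' (\<sigma> j) = C j"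
  shows "rep_iso (A_quiver l \<tau>) V W"
proof -
  let ?Q = "A_quiver l \<tau>"
  have \<sigma>act: "bij_betw \<sigma> (active J A C x) (active J' A' C' x)" for x
  proof (rule bij_betw_imageI)
    show "inj_on \<sigma> (active J A C x)"
      using \<sigma>(1) by (auto simp: bij_betw_def active_def inj_on_def)
    have "J' = \<sigma> ` J" using \<sigma>(1) by (simp add: bij_betw_def)
    then show "\<sigma> ` active J A C x = active J' A' C' x"
      using \<sigma>(2) by (auto simp: active_def)
  qed
  have "\<exists>f. linear_between (rspace V x) (rspace W x) f \<and> (\<forall>j\<in>active J A C x. f (w j x) = w' (\<sigma> j) x)"
    if x: "x \<le> l" for x
  proof (rule linear_between_frame_exists[OF string_frame[OF V x] frame_subspace[OF string_frame[OF W x]]])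
    show "w' (\<sigma> j) x \<in> rspace W x" if "j \<in> active J A C x" for j
      using frame_mem[OF string_frame[OF W x]] bij_betwE[OF \<sigma>act] that by blast
  qed
  then obtain \<phi> where lin: "\<And>x. x \<le> l \<Longrightarrow> linear_between (rspace V x) (rspace W x) (\<phi> x)"
    and \<phi>: "\<And>x j. x \<le> l \<Longrightarrow> j \<in> active J A C x \<Longrightarrow> \<phi> x (w j x) = w' (\<sigma> j) x" by metis
  have bij: "bij_betw (\<phi> x) (rspace V x) (rspace W x)" if x: "x \<le> l" for x
  proof (rule linear_between_frame_bij[OF string_frame[OF V x] lin[OF x]])
    show "frame (active J A C x) (\<lambda>j. \<phi> x (w j x)) (rspace W x)"
      using frame_reindex[OF string_frame[OF W x] \<sigma>act] \<phi>[OF x]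
      by (subst frame_cong[of _ _ "\<lambda>j. w' (\<sigma> j) x"]) auto
  qed
  have "\<phi> (head ?Q i) (rmap V i v) = rmap W i (\<phi> (tail ?Q i) v)"
    if i: "i \<in> arcs ?Q" and v: "v \<in> rspace V (tail ?Q i)" for i v
  proof -
    let ?t = "tail ?Q i" and ?h = "head ?Q i"
    have tl: "?t \<le> l" "?h \<le> l" using A_quiver_ends[OF i] by auto
    show ?thesis
    proof (rule linear_between_eq_on_frame[OF string_frame[OF V tl(1)], where
          f = "\<lambda>v. \<phi> ?h (rmap V i v)" and g = "\<lambda>v. rmap W i (\<phi> ?t v)" and v = v])
      show "linear_between (rspace V ?t) (rspace W ?h) (\<lambda>v. \<phi> ?h (rmap V i v))"
        by (rule linear_between_comp[OF string_linear[OF V i] lin[OF tl(2)]])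
      show "linear_between (rspace V ?t) (rspace W ?h) (\<lambda>v. rmap W i (\<phi> ?t v))"
        by (rule linear_between_comp[OF lin[OF tl(1)] string_linear[OF W i]])
      show "v \<in> rspace V ?t" by (rule v)
      fix j assume j: "j \<in> active J A C ?t"
      have jJ: "j \<in> J" using j by (simp add: active_def)
      have "\<sigma> j \<in> active J' A' C' ?t" using bij_betwE[OF \<sigma>act] j by blast
      then have R: "rmap W i (\<phi> ?t (w j ?t)) = w' (\<sigma> j) ?h"
        using string_rmap[OF W i] \<phi>[OF tl(1) j] by simp
      have "\<phi> ?h (w j ?h) = w' (\<sigma> j) ?h"
      proof (cases "j \<in> active J A C ?h")
        case True
        then show ?thesis by (rule \<phi>[OF tl(2)])
      next
        case False
        \<comment> \<open>The arrow leads out of the interval of \<open>j\<close>. Matched strings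
          have the same ends, so both images vanish.\<close>
        then have out: "\<not> (A j \<le> ?h \<and> ?h \<le> C j)" using jJ by (simp add: active_def del: A_quiver_simps)
        then have "w j ?h = 0" by (rule string_zero[OF V jJ])
        moreover have "w' (\<sigma> j) ?h = 0"
          using out \<sigma>(2)[OF jJ] bij_betwE[OF \<sigma>(1)] jJ string_zero[OF W] by metis
        moreover have "\<phi> ?h 0 = 0"
          by (rule linear_between_zero[OF lin[OF tl(2)] frame_subspace[OF string_frame[OF V tl(2)]]])
        ultimately show ?thesis by metis
      qed
      then show "\<phi> ?h (rmap V i (w j ?t)) = rmap W i (\<phi> ?t (w j ?t))"
        using R string_rmap[OF V i j] by metis
    qed
  qed
  then have "rep_morphism ?Q V W \<phi>"
    using lin unfolding rep_morphism_def by (auto simp del: A_quiver_simps(3,4))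
  then show ?thesis using bij unfolding rep_iso_def by (auto intro!: exI[of _ \<phi>])
qed

lemma strings_iso_of_HN_type:
  fixes V W :: "('f::field) Arep"
  assumes V: "is_rep (A_quiver l \<tau>) V" "strings l \<tau> V J A C w"
    and W: "is_rep (A_quiver l \<tau>) W" "strings l \<tau> W J' A' C' w'"
    and st: "\<And>a c. a \<le> c \<Longrightarrow> c \<le> l \<Longrightarrow> stable_interval \<alpha> \<tau> a c"
    and HN: "HN_type (A_quiver l \<tau>) \<alpha> V = HN_type (A_quiver l \<tau>) \<alpha> W"
  shows "rep_iso (A_quiver l \<tau>) V W"
proof -
  have fin: "finite J" "finite J'" using V(2) W(2) by (auto simp: strings_def string_frames_def)
  have neq: "avg \<alpha> a c \<noteq> avg \<alpha> a c'" if "a \<le> c" "c < c'" "c' \<le> l" for a c c'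
    using stable_interval_avg_neq[of \<alpha> \<tau> a c' c] st[of a c'] that by simp
  have m: "card {j \<in> J. A j = a \<and> C j = c} = card {j \<in> J'. A' j = a \<and> C' j = c}" for a c
    by (rule multiplicity_eq[OF fin(1) string_bounds[OF V] fin(2) string_bounds[OF W] neq
          strings_counts_eq[OF V W st HN]])
  have "card {j \<in> J. (A j, C j) = q} = card {j \<in> J'. (A' j, C' j) = q}" for q
    using m[of "fst q" "snd q"] by (cases q) simp
  from bij_betw_of_fibres[OF fin this] obtain \<sigma> where
    "bij_betw \<sigma> J J'" "\<forall>j\<in>J. (A' (\<sigma> j), C' (\<sigma> j)) = (A j, C j)" by blast
  then show ?thesis using strings_iso[OF V W, of \<sigma>] by simp
qed

section \<open>Every representation is a sum of intervals\<close>

lemma linear_between_add_lin_comb: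
  assumes f: "linear_between S T f" and S: "seqs.subspace S" and v: "v \<in> S"
    and b: "\<And>j. j \<in> J \<Longrightarrow> b j \<in> S"
  shows "f (v + lin_comb J c b) = f v + lin_comb J c (\<lambda>j. f (b j))"
proof -
  have "lin_comb J c b \<in> S" by (rule lin_comb_mem[OF S b])
  moreover have "f (lin_comb J c b) = lin_comb J c (\<lambda>j. f (b j))"
    by (rule linear_between_lin_comb[OF f S b])
  ultimately show ?thesis using linear_betweenD(2)[OF f v] by presburger
qed

text \<open>A relation among the images of the vectors outside \<open>Z\<close> is a kernel vector
  in their span, hence also a combination of the vectors in \<open>Z\<close>, and so trivial. For an
  arrow pointing right, \<open>Z\<close> are the strings that end and the others continue by their
  images.\<close>

lemma frame_image:
  assumes f: "linear_between S T f" and u: "frame P u S" and Z: "Z \<subseteq> P" "frame Z u {v \<in> S. f v = 0}"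
  shows "frame (P - Z) (\<lambda>j. f (u j)) (f ` S)"
proof -
  have S: "seqs.subspace S" using frame_subspace[OF u] .
  have finP: "finite P" using u by (simp add: frame_def)
  have fZ: "f (u j) = 0" if "j \<in> Z" for j using frame_mem[OF Z(2) that] by simp
  have fS: "f (lin_comb M c u) = lin_comb M c (\<lambda>j. f (u j))" if "M \<subseteq> P" for M c
    by (rule linear_between_lin_comb[OF f S frame_mem[OF u subsetD[OF that]]])
  have cut: "lin_comb P c (\<lambda>j. f (u j)) = lin_comb (P - Z) c (\<lambda>j. f (u j))" for c
    unfolding lin_comb_def using fZ finP by (intro sum.mono_neutral_right) auto
  show ?thesis
  proof (rule frameI)
    show "finite (P - Z)" using finP by simp
    have "f ` S = range (\<lambda>c. f (lin_comb P c u))"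
      by (subst frame_eq_lin_comb[OF u]) (simp add: image_image)
    then show "f ` S = range (\<lambda>c. lin_comb (P - Z) c (\<lambda>j. f (u j)))"
      using fS[OF subset_refl] cut by simp
    fix c j assume 0: "lin_comb (P - Z) c (\<lambda>j. f (u j)) = 0" and j: "j \<in> P - Z"
    have "lin_comb (P - Z) c u \<in> {v \<in> S. f v = 0}"
      using 0 fS[of "P - Z" c] lin_comb_mem[OF S, of "P - Z" u c] frame_mem[OF u] by simp
    then obtain d where d: "lin_comb (P - Z) c u = lin_comb Z d u" using frame_eq_lin_comb[OF Z(2)] by blast
    \<comment> \<open>The equation for \<open>d\<close> brought to one side, so the coefficients on
      \<open>Z\<close> change sign.\<close>
    let ?e = "\<lambda>j. if j \<in> Z then - d j else c j"
    have "lin_comb P ?e u = lin_comb (P - Z) ?e u + lin_comb Z ?e u"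
      unfolding lin_comb_def by (rule sum.subset_diff[OF Z(1) finP])
    also have "lin_comb (P - Z) ?e u = lin_comb Z d u"
      unfolding d[symmetric] by (rule lin_comb_cong) auto
    also have "lin_comb Z ?e u = - lin_comb Z d u"
      unfolding lin_comb_def sum_negf[symmetric] by (rule sum.cong) (auto simp: seqs.scale_minus_left)
    also have "lin_comb Z d u + - lin_comb Z d u = 0" by (rule right_minus)
    finally have "lin_comb P ?e u = 0" .
    from frame_lin_comb_zero[OF u this, of j] j show "c j = 0" by simp
  qed
qed

text \<open>A nonzero morphism from the interval module of \<open>[a, p]\<close> to that of \<open>[b, p]\<close> exists if
  \<open>key \<tau> b \<le> key \<tau> a\<close>; then a string on \<open>[b, p]\<close> may be added to one on \<open>[a, p]\<close>.\<close>

definition key :: "(nat \<Rightarrow> bool) \<Rightarrow> nat \<Rightarrow> int" where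
  "key \<tau> a = (if \<tau> a then int a else - int a)"

text \<open>A unitriangular change of basis at the last vertex is carried back along the strings:
  what is added to the string \<open>k\<close> at \<open>p\<close> is added on its whole interval.
  The second component of \<open>r\<close> only breaks ties, which occur between strings with the
  same left end.\<close>

lemma strings_modify:
  fixes V :: "('f::field) Arep" and A :: "nat \<Rightarrow> nat" and c :: "nat \<Rightarrow> nat \<Rightarrow> 'f"
  assumes V: "is_rep (A_quiver p \<tau>) V" and str: "strings p \<tau> V J A C w"
  defines "P \<equiv> {j \<in> J. C j = p}" and "r \<equiv> \<lambda>k. (key \<tau> (A k), k)"
  defines "u \<equiv> \<lambda>k x. if k \<in> P \<and> A k \<le> x \<and> x \<le> p
    then w k x + lin_comb {j \<in> P. r j < r k} (c k) (\<lambda>j. w j x) else w k x"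
  shows "strings p \<tau> V J A C u"
proof -
  let ?Q = "A_quiver p \<tau>"
  have keyle: "key \<tau> (A j) \<le> key \<tau> (A k)" if "r j < r k" for j k
    using that by (auto simp: r_def less_prod_def)
  have rinj: "inj_on r M" for M by (auto simp: r_def inj_on_def)
  have fin: "finite J" using str by (simp add: strings_def string_frames_def)
  have "frame (active J A C x) (\<lambda>j. u j x) (rspace V x)" if x: "x \<le> p" for x
  proof (rule frame_unitriangular[OF string_frame[OF V str x] rinj])
    fix k assume k: "k \<in> active J A C x"
    let ?T = "seqs.span ((\<lambda>j. w j x) ` {j \<in> active J A C x. r j < r k})"
    show "u k x - w k x \<in> ?T"
    proof (cases "k \<in> P")
      case True
      have "lin_comb {j \<in> P. r j < r k} (c k) (\<lambda>j. w j x) \<in> ?T"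
      proof (rule lin_comb_mem)
        show "seqs.subspace ?T" by simp
        fix j assume j: "j \<in> {j \<in> P. r j < r k}"
        show "w j x \<in> ?T"
        proof (cases "A j \<le> x")
          case True
          then have "j \<in> active J A C x" using j x by (simp add: active_def P_def)
          then show ?thesis using j by (intro seqs.span_base) auto
        next
          case False
          then have "w j x = 0" using string_zero[OF V str, of j x] j by (simp add: P_def)
          then show ?thesis by (simp add: seqs.span_zero)
        qed
      qed
      then show ?thesis using True k x by (simp add: u_def active_def)
    next
      case False
      then show ?thesis by (simp add: u_def seqs.span_zero)
    qed
  qed
  moreover have "u k x = 0" if "k \<in> J" "\<not> (A k \<le> x \<and> x \<le> C k)" for k x
    using that string_zero[OF V str that] by (auto simp: u_def P_def)
  ultimately have fr: "string_frames p V J A C u"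
    using string_bounds[OF V str] fin by (simp add: string_frames_def)
  have "rmap V i (u k (tail ?Q i)) = u k (head ?Q i)"
    if i: "i \<in> arcs ?Q" and k: "k \<in> active J A C (tail ?Q i)" for i k
  proof (cases "k \<in> P")
    case False
    then show ?thesis using string_rmap[OF V str i k] by (simp add: u_def del: A_quiver_simps)
  next
    case True
    let ?t = "tail ?Q i" and ?h = "head ?Q i"
    let ?M = "{j \<in> P. r j < r k}"
    have tl: "?t \<le> p" "?h \<le> p" using A_quiver_ends[OF i] by auto
    have th: "if \<tau> i then ?t = i - 1 \<and> ?h = i else ?t = i \<and> ?h = i - 1" and i1: "1 \<le> i" using i by auto
    have Ak: "A k \<le> ?t" using k by (simp add: active_def del: A_quiver_simps)
    note sub = frame_subspace[OF string_frame[OF V str tl(1)]]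
    have r0: "rmap V i 0 = 0" by (rule linear_between_zero[OF string_linear[OF V str i] sub])
    have wV: "w j ?t \<in> rspace V ?t" if "j \<in> P" for j
    proof (cases "j \<in> active J A C ?t")
      case True
      then show ?thesis by (rule frame_mem[OF string_frame[OF V str tl(1)]])
    next
      case False
      then have "w j ?t = 0"
        using that by (intro string_zero[OF V str]) (auto simp: active_def P_def simp del: A_quiver_simps)
      then show ?thesis using seqs.subspace_0[OF sub] by simp
    qed
    have wj: "rmap V i (w j ?t) = (if A k \<le> ?h then w j ?h else 0)" if j: "j \<in> ?M" for j
    proof -
      have jJ: "j \<in> J" and Cj: "C j = p" and kl: "key \<tau> (A j) \<le> key \<tau> (A k)"
        using j keyle by (auto simp: P_def)
      show ?thesis
      proof (cases "A j \<le> ?t")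
        case True
        then have "j \<in> active J A C ?t" using jJ Cj tl by (simp add: active_def del: A_quiver_simps)
        then have R: "rmap V i (w j ?t) = w j ?h" by (rule string_rmap[OF V str i])
        \<comment> \<open>The arrow leaves the interval of \<open>k\<close> through its left end and
          points left. The order of the keys then keeps \<open>j\<close> from extending further
          left, so the added term is killed as well.\<close>
        have "w j ?h = 0" if "\<not> A k \<le> ?h"
        proof (rule string_zero[OF V str jJ])
          have i': "\<not> \<tau> i" "?t = i" "?h = i - 1" using that Ak th by (auto split: if_splits)
          then have "A k = i" using that Ak i1 by linarith
          then have "?t = A k" "\<not> \<tau> (A k)" using i' by metis+
          moreover have "\<not> A j < A k" using kl \<open>\<not> \<tau> (A k)\<close> by (auto simp: key_def split: if_splits)
          ultimately show "\<not> (A j \<le> ?h \<and> ?h \<le> C j)" using that by linarith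
        qed
        then show ?thesis using R by metis
      next
        case False
        then have "w j ?t = 0" by (intro string_zero[OF V str jJ]) blast
        \<comment> \<open>Otherwise \<open>j\<close> would begin inside the interval of
          \<open>k\<close> at an arrow pointing right, and its key would exceed that of
          \<open>k\<close>.\<close>
        moreover have "w j ?h = 0"
        proof (rule string_zero[OF V str jJ], rule notI)
          assume "A j \<le> ?h \<and> ?h \<le> C j"
          then have "A j = i" "\<tau> i" using False th by (auto split: if_splits)
          then show False using kl False Ak by (auto simp: key_def split: if_splits)
        qed
        ultimately show ?thesis using r0 by metis
      qed
    qed
    have "u k ?t = w k ?t + lin_comb ?M (c k) (\<lambda>j. w j ?t)"
      using True Ak tl unfolding u_def by (simp del: A_quiver_simps)
    then have "rmap V i (u k ?t) = rmap V i (w k ?t) + lin_comb ?M (c k) (\<lambda>j. rmap V i (w j ?t))"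
      using linear_between_add_lin_comb[OF string_linear[OF V str i] sub wV[OF True], of ?M "\<lambda>j. w j ?t" "c k"] wV
      by simp
    also have "rmap V i (w k ?t) = w k ?h" by (rule string_rmap[OF V str i k])
    also have "lin_comb ?M (c k) (\<lambda>j. rmap V i (w j ?t)) =
        lin_comb ?M (c k) (\<lambda>j. if A k \<le> ?h then w j ?h else 0)"
      by (rule lin_comb_cong) (use wj in auto)
    also have "w k ?h + \<dots> = u k ?h"
    proof (cases "A k \<le> ?h")
      case h: True
      then show ?thesis using True tl unfolding u_def by (simp del: A_quiver_simps)
    next
      case h: False
      have "lin_comb ?M (c k) (\<lambda>j. 0) = 0" by (simp add: lin_comb_def)
      then show ?thesis using h unfolding u_def by (simp del: A_quiver_simps)
    qed
    finally show ?thesis .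
  qed
  then show ?thesis using fr by (simp add: strings_def del: A_quiver_simps)
qed

text \<open>Strings in \<open>E\<close> continue to the new vertex and those in \<open>N\<close> are
  born there. For an arrow pointing right the strings at \<open>p\<close> outside \<open>E\<close>
  must be killed; for an arrow pointing left they just end, whereas the newborn strings must lie in
  the kernel.\<close>

lemma strings_extend:
  fixes V :: "('f::field) Arep"
  assumes str: "strings p \<tau> V J A C w" and E: "E \<subseteq> {j \<in> J. C j = p}" and NJ: "N \<inter> J = {}"
    and v: "frame (E \<union> N) v (rspace V (Suc p))"
    and fwd: "\<And>j. \<tau> (Suc p) \<Longrightarrow> j \<in> J \<Longrightarrow> C j = p \<Longrightarrow> rmap V (Suc p) (w j p) = (if j \<in> E then v j else 0)"
    and bwd: "\<And>j. \<not> \<tau> (Suc p) \<Longrightarrow> j \<in> E \<Longrightarrow> rmap V (Suc p) (v j) = w j p"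
    and bwd0: "\<And>j. \<not> \<tau> (Suc p) \<Longrightarrow> j \<in> N \<Longrightarrow> rmap V (Suc p) (v j) = 0"
  shows "\<exists>J A C w. strings (Suc p) \<tau> V J A C w"
proof -
  define A' where "A' j = (if j \<in> N then Suc p else A j)" for j
  define C' where "C' j = (if j \<in> E \<union> N then Suc p else C j)" for j
  define w' where "w' j x = (if x = Suc p then (if j \<in> E \<union> N then v j else 0)
    else if j \<in> N then 0 else w j x)" for j x
  have fin: "finite J" and AC: "\<And>j. j \<in> J \<Longrightarrow> A j \<le> C j \<and> C j \<le> p"
    and F: "\<And>x. x \<le> p \<Longrightarrow> frame (active J A C x) (\<lambda>j. w j x) (rspace V x)"
    and w0: "\<And>j x. j \<in> J \<Longrightarrow> \<not> (A j \<le> x \<and> x \<le> C j) \<Longrightarrow> w j x = 0"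
    and R: "\<And>i j. i \<in> arcs (A_quiver p \<tau>) \<Longrightarrow> j \<in> active J A C (tail (A_quiver p \<tau>) i) \<Longrightarrow>
      rmap V i (w j (tail (A_quiver p \<tau>) i)) = w j (head (A_quiver p \<tau>) i)"
    using str unfolding strings_def string_frames_def by blast+
  have EJ: "j \<in> J" "C j = p" "j \<notin> N" if "j \<in> E" for j using E NJ that by auto
  have act: "active (J \<union> N) A' C' x = active J A C x" if "x \<le> p" for x
    using that EJ NJ by (auto simp: active_def A'_def C'_def split: if_splits)
  have act_Suc: "active (J \<union> N) A' C' (Suc p) = E \<union> N"
    using AC EJ NJ by (force simp: active_def A'_def C'_def split: if_splits)
  have w'w: "w' j x = w j x" if "x \<le> p" "j \<in> active J A C y" for j x y
    using that NJ by (auto simp: w'_def active_def)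
  have "frame (active (J \<union> N) A' C' x) (\<lambda>j. w' j x) (rspace V x)" if "x \<le> Suc p" for x
  proof (cases "x = Suc p")
    case True
    have "frame (E \<union> N) (\<lambda>j. w' j x) (rspace V (Suc p)) \<longleftrightarrow> frame (E \<union> N) v (rspace V (Suc p))"
      by (rule frame_cong) (simp add: w'_def True)
    then show ?thesis using v act_Suc True by simp
  next
    case False
    then have x: "x \<le> p" using that by simp
    have "frame (active J A C x) (\<lambda>j. w' j x) (rspace V x) \<longleftrightarrow> frame (active J A C x) (\<lambda>j. w j x) (rspace V x)"
      by (rule frame_cong) (rule w'w[OF x])
    then show ?thesis using F[OF x] act[OF x] by simp
  qed
  moreover have "w' j x = 0" if "j \<in> J \<union> N" "\<not> (A' j \<le> x \<and> x \<le> C' j)" for j x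
    using that w0[of j x] EJ AC[of j] NJ by (auto simp: w'_def A'_def C'_def split: if_splits)
  moreover have "A' j \<le> C' j \<and> C' j \<le> Suc p" if "j \<in> J \<union> N" for j
    using that AC[of j] EJ NJ by (force simp: A'_def C'_def)
  moreover have "finite (J \<union> N)" using fin v by (simp add: frame_def)
  ultimately have fr: "string_frames (Suc p) V (J \<union> N) A' C' w'"
    by (simp add: string_frames_def)
  have "rmap V i (w' j (tail (A_quiver (Suc p) \<tau>) i)) = w' j (head (A_quiver (Suc p) \<tau>) i)"
    if i: "i \<in> arcs (A_quiver (Suc p) \<tau>)" and j: "j \<in> active (J \<union> N) A' C' (tail (A_quiver (Suc p) \<tau>) i)" for i j
  proof (cases "i = Suc p")
    case False
    let ?t = "tail (A_quiver p \<tau>) i" and ?h = "head (A_quiver p \<tau>) i"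
    have ip: "i \<in> arcs (A_quiver p \<tau>)" using i False by simp
    have tl: "?t \<le> p" "?h \<le> p" using A_quiver_ends[OF ip] by auto
    have th: "tail (A_quiver (Suc p) \<tau>) i = ?t" "head (A_quiver (Suc p) \<tau>) i = ?h" by simp_all
    have ja: "j \<in> active J A C ?t" using j act[OF tl(1)] unfolding th by metis
    show ?thesis unfolding th w'w[OF tl(1) ja] w'w[OF tl(2) ja] by (rule R[OF ip ja])
  next
    case i: True
    show ?thesis
    proof (cases "\<tau> (Suc p)")
      case True
      have "j \<in> active J A C p" using j act[of p] True i by simp
      then have jp: "j \<in> J" "C j = p" "j \<notin> N" using AC[of j] NJ by (auto simp: active_def)
      then show ?thesis using fwd[OF True jp(1,2)] True i by (simp add: w'_def)
    next
      case False
      have "j \<in> E \<union> N" using j act_Suc False i by simp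
      then show ?thesis using bwd[OF False, of j] bwd0[OF False, of j] EJ[of j] False i NJ
        by (auto simp: w'_def)
    qed
  qed
  then have "strings (Suc p) \<tau> V (J \<union> N) A' C' w'" using fr by (simp add: strings_def del: A_quiver_simps)
  then show ?thesis by blast
qed

text \<open>A new vertex concerns only the strings that reach the last one. If the arrow points
  right, strings spanning the kernel end and the others go on by their images. If it points left,
  strings spanning the image go on by lifts, the others end, and the kernel supplies new
  strings.\<close>

lemma strings_exist:
  fixes V :: "('f::field) Arep"
  assumes "is_rep (A_quiver p \<tau>) V"
  shows "\<exists>J A C w. strings p \<tau> V J A C w"
  using assms
proof (induction p)
  case 0
  then have "fd_subspace (rspace V 0)" by (simp add: is_rep_def)
  from fd_frame_exists[OF this, of "{}"] obtain N :: "nat set" and v where N: "frame N v (rspace V 0)" by auto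
  have "strings 0 \<tau> V N (\<lambda>_. 0) (\<lambda>_. 0) (\<lambda>j x. if x = 0 then v j else 0)"
    using N by (auto simp: strings_def string_frames_def active_def frame_def)
  then show ?case by blast
next
  case (Suc p)
  have V: "is_rep (A_quiver p \<tau>) V" using Suc.prems by (simp add: is_rep_def)
  from Suc.IH[OF V] obtain J A C w where str: "strings p \<tau> V J A C w" by blast
  define P where "P = {j \<in> J. C j = p}"
  define r where "r k = (key \<tau> (A k), k)" for k
  let ?f = "rmap V (Suc p)"
  have finJ: "finite J" using str by (simp add: strings_def string_frames_def)
  have actP: "active J A C p = P" using string_bounds[OF V str] by (force simp: active_def P_def)
  have FP: "frame P (\<lambda>j. w j p) (rspace V p)" using string_frame[OF V str order_refl] actP by simp
  have rinj: "inj_on r P" by (auto simp: r_def inj_on_def)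
  have fdS: "fd_subspace (rspace V (Suc p))" using Suc.prems by (simp add: is_rep_def)
  have sub: "seqs.subspace (rspace V p)" "seqs.subspace (rspace V (Suc p))"
    using frame_subspace[OF FP] fdS by (simp_all add: fd_subspace_def)
  \<comment> \<open>Echelon form at the vertex \<open>p\<close> with respect to the order
    \<open>r\<close> only adds \<open>r\<close>-smaller strings to larger ones, which is the change
    that extends along the strings.\<close>
  have adapt: "\<exists>w' Z. strings p \<tau> V J A C w' \<and> Z \<subseteq> P \<and> frame P (\<lambda>j. w' j p) (rspace V p) \<and>
      frame Z (\<lambda>j. w' j p) K" if K: "seqs.subspace K" "K \<subseteq> rspace V p" for K
  proof -
    define Z where "Z = lead P (\<lambda>j. w j p) r K"
    obtain u where u: "\<forall>k\<in>P. u k - w k p \<in> seqs.span ((\<lambda>j. w j p) ` {j \<in> P. r j < r k})"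
      "frame P u (rspace V p)" "frame Z u K"
      using echelon[OF FP rinj K] by (auto simp: Z_def)
    have "\<exists>c. u k - w k p = lin_comb {j \<in> P. r j < r k} c (\<lambda>j. w j p)" if "k \<in> P" for k
    proof -
      have "finite {j \<in> P. r j < r k}" using finJ by (simp add: P_def)
      from span_image_lin_comb[OF this] bspec[OF u(1) that] show ?thesis by blast
    qed
    then obtain c where c: "\<And>k. k \<in> P \<Longrightarrow> u k - w k p = lin_comb {j \<in> P. r j < r k} (c k) (\<lambda>j. w j p)"
      by metis
    define w' where "w' k x = (if k \<in> P \<and> A k \<le> x \<and> x \<le> p
      then w k x + lin_comb {j \<in> P. r j < r k} (c k) (\<lambda>j. w j x) else w k x)" for k x
    have "strings p \<tau> V J A C w'"
      using strings_modify[OF V str, of c] unfolding w'_def P_def r_def .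
    moreover have w'p: "w' k p = u k" if "k \<in> P" for k
    proof -
      have "A k \<le> p" using that string_bounds[OF V str, of k] by (auto simp: P_def)
      then show ?thesis using that c[OF that, symmetric] by (simp add: w'_def)
    qed
    moreover have "Z \<subseteq> P" by (auto simp: Z_def lead_def)
    moreover have "frame P (\<lambda>j. w' j p) (rspace V p)"
      using u(2) frame_cong[of P "\<lambda>j. w' j p" u] w'p by blast
    moreover have "frame Z (\<lambda>j. w' j p) K"
      using u(3) frame_cong[of Z "\<lambda>j. w' j p" u] w'p \<open>Z \<subseteq> P\<close> by blast
    ultimately show ?thesis by blast
  qed
  show ?case
  proof (cases "\<tau> (Suc p)")
    case True
    have f: "linear_between (rspace V p) (rspace V (Suc p)) ?f"
      using Suc.prems True by (auto simp: is_rep_def dest: bspec[of _ _ "Suc p"])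
    obtain w' Z where w': "strings p \<tau> V J A C w'" "Z \<subseteq> P" "frame P (\<lambda>j. w' j p) (rspace V p)"
      "frame Z (\<lambda>j. w' j p) {v \<in> rspace V p. ?f v = 0}"
      using adapt[OF linear_between_kernel_subspace[OF f sub(1)]] by auto
    have im: "?f ` rspace V p \<subseteq> rspace V (Suc p)" using linear_betweenD(1)[OF f] by blast
    obtain N v where N: "N \<inter> J = {}" "\<forall>j\<in>(P - Z) - N. v j = ?f (w' j p)" "N \<inter> (P - Z) = {}"
      "frame ((P - Z) \<union> N) v (rspace V (Suc p))"
      using frame_extend[OF fdS frame_image[OF f w'(3,2,4)] im finJ] by blast
    show ?thesis
    proof (rule strings_extend[OF w'(1) _ N(1) N(4)])
      show "P - Z \<subseteq> {j \<in> J. C j = p}" by (auto simp: P_def)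
      fix j assume "j \<in> J" "C j = p"
      then have "j \<in> P" by (simp add: P_def)
      then have "j \<in> (P - Z) - N \<or> j \<in> Z" using N(3) by blast
      then show "?f (w' j p) = (if j \<in> P - Z then v j else 0)"
        using N(2) frame_mem[OF w'(4), of j] by auto
    qed (use True in auto)
  next
    case False
    have f: "linear_between (rspace V (Suc p)) (rspace V p) ?f"
      using Suc.prems False by (auto simp: is_rep_def dest: bspec[of _ _ "Suc p"])
    have im: "?f ` rspace V (Suc p) \<subseteq> rspace V p" using linear_betweenD(1)[OF f] by blast
    obtain w' Z where w': "strings p \<tau> V J A C w'" "Z \<subseteq> P" "frame Z (\<lambda>j. w' j p) (?f ` rspace V (Suc p))"
      using adapt[OF linear_between_image_subspace[OF f sub(2)] im] by blast
    have "\<forall>j\<in>Z. \<exists>v. v \<in> rspace V (Suc p) \<and> ?f v = w' j p" using frame_mem[OF w'(3)] by fastforce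
    then obtain v where v: "\<And>j. j \<in> Z \<Longrightarrow> v j \<in> rspace V (Suc p) \<and> ?f (v j) = w' j p" by metis
    have "fd_subspace {v \<in> rspace V (Suc p). ?f v = 0}"
      using fd_subspace_subset(1)[OF fdS linear_between_kernel_subspace[OF f sub(2)]] by auto
    from fd_frame_exists[OF this finJ] obtain N n where
      N: "N \<inter> J = {}" "frame N n {v \<in> rspace V (Suc p). ?f v = 0}" by blast
    have disj: "Z \<inter> N = {}" using w'(2) N(1) by (auto simp: P_def)
    define v' where "v' j = (if j \<in> Z then v j else n j)" for j
    have "frame N v' S \<longleftrightarrow> frame N n S" for S
      by (rule frame_cong) (use disj in \<open>auto simp: v'_def\<close>)
    then have N': "frame N v' {v \<in> rspace V (Suc p). ?f v = 0}" using N(2) by blast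
    have vZ: "v' j \<in> rspace V (Suc p) \<and> ?f (v' j) = w' j p" if "j \<in> Z" for j
      using v that by (simp add: v'_def)
    have ZN: "frame (Z \<union> N) v' (rspace V (Suc p))"
      by (rule frame_split[OF f sub(2) w'(3) vZ N' disj])
    show ?thesis
    proof (rule strings_extend[OF w'(1) _ N(1) ZN])
      show "Z \<subseteq> {j \<in> J. C j = p}" using w'(2) by (auto simp: P_def)
      show "?f (v' j) = w' j p" if "j \<in> Z" for j using vZ that by blast
      show "?f (v' j) = 0" if "j \<in> N" for j using frame_mem[OF N' that] by simp
    qed (use False in auto)
  qed
qed

lemma complete_of_stable_intervals:
  assumes "\<And>a c. a \<le> c \<Longrightarrow> c \<le> l \<Longrightarrow> stable_interval \<alpha> \<tau> a c"
  shows "complete_charge TYPE('f::field) (A_quiver l \<tau>) \<alpha>"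
  unfolding complete_charge_def
proof (intro allI impI)
  fix V W :: "'f Arep"
  assume "is_rep (A_quiver l \<tau>) V \<and> is_rep (A_quiver l \<tau>) W \<and>
    HN_type (A_quiver l \<tau>) \<alpha> V = HN_type (A_quiver l \<tau>) \<alpha> W"
  moreover from this obtain J A C w J' A' C' w' where
    "strings l \<tau> V J A C w" "strings l \<tau> W J' A' C' w'" using strings_exist by metis
  ultimately show "rep_iso (A_quiver l \<tau>) V W" using strings_iso_of_HN_type assms by blast
qed

section \<open>Completeness implies stability of all intervals\<close>

definition null_rep :: "('a, 'e, 'f::field) qrep" where
  "null_rep = \<lparr>rspace = (\<lambda>_. {0}), rmap = (\<lambda>_ _. 0)\<rparr>"

lemma fd_null: "fd_subspace {0 :: nat \<Rightarrow> 'f::field}"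
  by (rule frame_fd[of "{} :: nat set" "\<lambda>_. 0"]) (simp add: frame_empty)

lemma null_rep_zero: "zero_rep Q null_rep"
  by (simp add: zero_rep_def null_rep_def)

lemma null_rep_subrep:
  fixes V :: "('a, 'e, 'f::field) qrep"
  assumes V: "is_rep Q V" and wf: "\<And>e. e \<in> arcs Q \<Longrightarrow> tail Q e \<in> verts Q"
  shows "subrep Q null_rep V"
proof -
  have "rmap V e 0 = 0" if "e \<in> arcs Q" for e
    using linear_between_zero[OF _ is_rep_subspace[OF V wf[OF that]]] V that by (auto simp: is_rep_def)
  moreover have "0 \<in> rspace V x" if "x \<in> verts Q" for x
    using is_rep_subspace[OF V that] by (rule seqs.subspace_0)
  ultimately show ?thesis by (simp add: subrep_def is_rep_def null_rep_def linear_between_def fd_null)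
qed

lemma is_quotient_null_rep:
  assumes V: "is_rep Q V" and wf: "\<And>e. e \<in> arcs Q \<Longrightarrow> tail Q e \<in> verts Q"
  shows "is_quotient Q V null_rep V"
proof -
  have "rep_morphism Q V V (\<lambda>_ v. v)" by (simp add: rep_morphism_def linear_between_def)
  moreover have "(\<lambda>v. v) ` rspace V x = rspace V x \<and> {v \<in> rspace V x. v = 0} = rspace null_rep x"
    if "x \<in> verts Q" for x
    using is_rep_subspace[OF V that] by (auto simp: null_rep_def intro: seqs.subspace_0)
  ultimately show ?thesis
    using null_rep_subrep[OF V wf] V unfolding is_quotient_def by (auto intro!: exI[of _ "\<lambda>_ v. v"])
qed

lemma subrep_refl: "is_rep Q V \<Longrightarrow> subrep Q V V"
  by (simp add: subrep_def)

lemma same_spaces_null_rep: "same_spaces Q null_rep V \<longleftrightarrow> zero_rep Q V"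
  unfolding same_spaces_def zero_rep_def null_rep_def qrep.simps by (simp only: eq_commute[of "{0}"])

lemma is_HN_type_semistable:
  assumes Q: "fin_digraph Q" and V: "semistable Q \<alpha> V"
  shows "is_HN_type Q \<alpha> V [dim_vector Q V]"
proof -
  interpret fin_digraph Q by (rule Q)
  have rV: "is_rep Q V" and nz: "\<not> zero_rep Q V" using V by (simp_all add: semistable_def)
  let ?F = "\<lambda>i::nat. if i = 0 then null_rep else V"
  have "HN_filtration Q \<alpha> V 1 ?F (\<lambda>_. V)"
    using null_rep_subrep[OF rV] subrep_refl[OF rV] null_rep_zero[of Q] same_spaces_null_rep[of Q V] nz
      is_quotient_null_rep[OF rV] V
    by (auto simp: HN_filtration_def same_spaces_def)
  then show ?thesis unfolding is_HN_type_def by (intro exI[of _ 1] exI[of _ ?F] exI[of _ "\<lambda>_. V"]) simp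
qed

lemma is_HN_type_extension:
  assumes Q: "fin_digraph Q" and V: "is_rep Q V" and q: "is_quotient Q V U W"
    and U: "semistable Q \<alpha> U" and W: "semistable Q \<alpha> W" and less: "slope Q \<alpha> W < slope Q \<alpha> U"
  shows "is_HN_type Q \<alpha> V [dim_vector Q U, dim_vector Q W]"
proof -
  interpret fin_digraph Q by (rule Q)
  have rU: "is_rep Q U" and nU: "\<not> zero_rep Q U" and nW: "\<not> zero_rep Q W"
    using U W by (simp_all add: semistable_def)
  have UV: "subrep Q U V" using q by (simp add: is_quotient_def)
  \<comment> \<open>A projection whose kernel is all of \<open>V\<close> has zero image, but
    \<open>W\<close> is nonzero.\<close>
  have ns: "\<not> same_spaces Q U V"
  proof
    assume same: "same_spaces Q U V"
    obtain \<pi> where \<pi>: "\<forall>x\<in>verts Q. \<pi> x ` rspace V x = rspace W x \<and> {v \<in> rspace V x. \<pi> x v = 0} = rspace U x"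
      using q by (auto simp: is_quotient_def)
    have "rspace W x = {0}" if x: "x \<in> verts Q" for x
    proof -
      have "\<pi> x ` rspace V x = {0}"
        using \<pi> x same seqs.subspace_0[OF is_rep_subspace[OF V x]] by (fastforce simp: same_spaces_def)
      then show ?thesis using \<pi> x by simp
    qed
    then show False using nW by (simp add: zero_rep_def)
  qed
  let ?F = "\<lambda>i::nat. if i = 0 then null_rep else if i = 1 then U else V"
  let ?S = "\<lambda>i::nat. if i = 1 then U else W"
  have two: "{1..2} = {1, 2::nat}" "{0..2} = {0, 1, 2::nat}" "{1..<2} = {1::nat}" by auto
  have "HN_filtration Q \<alpha> V 2 ?F ?S"
    unfolding HN_filtration_def two
    using null_rep_subrep[OF V] null_rep_subrep[OF rU] subrep_refl[OF V] null_rep_zero[of Q]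
      same_spaces_null_rep[of Q U] nU ns is_quotient_null_rep[OF rU] U W q UV less
    by (simp add: same_spaces_def)
  then show ?thesis
    unfolding is_HN_type_def by (intro exI[of _ 2] exI[of _ ?F] exI[of _ ?S]) (simp add: numeral_2_eq_2)
qed

section \<open>Interval modules and their extensions\<close>

definition unit_seq :: "nat \<Rightarrow> 'f::field" where
  "unit_seq n = (if n = 0 then 1 else 0)"

lemma unit_seq_nonzero: "unit_seq \<noteq> (0 :: nat \<Rightarrow> 'f::field)"
proof
  assume "unit_seq = (0 :: nat \<Rightarrow> 'f)"
  from fun_cong[OF this, of 0] show False by (simp add: unit_seq_def)
qed

lemma frame_field_line: "frame {j} (\<lambda>_. unit_seq) (field_line :: (nat \<Rightarrow> 'f::field) set)"
proof (rule frameI)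
  have "v \<in> range (\<lambda>c. lin_comb {j} c (\<lambda>_. unit_seq))" if "v \<in> field_line" for v :: "nat \<Rightarrow> 'f"
  proof -
    have "v = lin_comb {j} (\<lambda>_. v 0) (\<lambda>_. unit_seq)"
      using that by (auto simp: lin_comb_def unit_seq_def seq_scale_def field_line_def fun_eq_iff)
    then show ?thesis by (intro range_eqI[of _ _ "\<lambda>_. v 0"])
  qed
  then show "field_line = range (\<lambda>c. lin_comb {j} c (\<lambda>_. unit_seq :: nat \<Rightarrow> 'f))"
    by (auto simp: lin_comb_def unit_seq_def seq_scale_def field_line_def)
  show "c i = 0" if "lin_comb {j} c (\<lambda>_. unit_seq) = 0" "i \<in> {j}" for c :: "'a \<Rightarrow> 'f" and i
    using fun_cong[OF that(1), of 0] that(2) by (simp add: lin_comb_def unit_seq_def seq_scale_def)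
qed simp

lemma field_line_subspace: "seqs.subspace (field_line :: (nat \<Rightarrow> 'f::field) set)"
  using frame_subspace[OF frame_field_line] .

lemma zero_field_line: "0 \<in> field_line"
  using seqs.subspace_0[OF field_line_subspace] .

lemma unit_seq_field_line: "unit_seq \<in> field_line"
  by (simp add: unit_seq_def field_line_def)

text \<open>The module of \<open>[a, c]\<close> for \<open>k = True\<close>, and the direct sum of those of \<open>[a, b - 1]\<close> and
  \<open>[b, c]\<close> for \<open>k = False\<close>.\<close>

definition cut_rep :: "nat \<Rightarrow> nat \<Rightarrow> nat \<Rightarrow> bool \<Rightarrow> ('f::field) Arep" where
  "cut_rep a c b k =
     \<lparr>rspace = (\<lambda>x. if a \<le> x \<and> x \<le> c then field_line else {0}),
      rmap = (\<lambda>i v. if a \<le> i - 1 \<and> i \<le> c \<and> (i = b \<longrightarrow> k) then v else 0)\<rparr>"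

lemma fd_field_line: "fd_subspace (field_line :: (nat \<Rightarrow> 'f::field) set)"
  by (rule frame_fd[OF frame_field_line])

lemma cut_rep_is_rep: "is_rep (A_quiver l \<tau>) (cut_rep a c b k :: ('f::field) Arep)"
proof -
  let ?V = "cut_rep a c b k :: 'f Arep" and ?Q = "A_quiver l \<tau>"
  define P where "P i \<longleftrightarrow> a \<le> i - 1 \<and> i \<le> c \<and> (i = b \<longrightarrow> k)" for i
  have r: "rmap ?V i v = (if P i then v else 0)" for i v by (simp add: cut_rep_def P_def)
  have s: "rspace ?V x = (if a \<le> x \<and> x \<le> c then field_line else {0})" for x by (simp add: cut_rep_def)
  have 0: "0 \<in> rspace ?V x" for x unfolding s by (simp add: zero_field_line)
  have "linear_between (rspace ?V (tail ?Q i)) (rspace ?V (head ?Q i)) (rmap ?V i)" for i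
  proof (cases "P i")
    case True
    then have "rspace ?V (tail ?Q i) = rspace ?V (head ?Q i)" unfolding s by (auto simp: P_def)
    then show ?thesis using True by (simp add: linear_between_def r)
  next
    case False
    then show ?thesis using 0 by (simp add: linear_between_def r)
  qed
  moreover have "fd_subspace (rspace ?V x)" for x unfolding s by (simp add: fd_field_line fd_null)
  ultimately show ?thesis by (simp only: is_rep_def) blast
qed

lemma interval_rep_dim:
  "x \<le> l \<Longrightarrow> dim_vector (A_quiver l \<tau>) (interval_rep p q :: ('f::field) Arep) x =
    (if p \<le> x \<and> x \<le> q then 1 else 0)"
  using frame_dim[OF frame_field_line[of "0::nat", where 'f = 'f]] dim_zero[where 'f = 'f]
  by (simp add: dim_vector_def interval_rep_def)

lemma slope_interval_rep:
  assumes "p \<le> q" "q \<le> l"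
  shows "slope (A_quiver l \<tau>) \<alpha> (interval_rep p q :: ('f::field) Arep) = avg \<alpha> p q"
proof -
  have sub: "{0..l} \<inter> {p..q} = {p..q}" using assms by auto
  have *: "(\<Sum>x\<in>{0..l}. f x * real (dim_vector (A_quiver l \<tau>) (interval_rep p q :: 'f Arep) x)) =
      (\<Sum>x\<in>{p..q}. f x)" for f
  proof -
    have "(\<Sum>x\<in>{0..l}. f x * real (dim_vector (A_quiver l \<tau>) (interval_rep p q :: 'f Arep) x)) =
        (\<Sum>x\<in>{0..l}. if x \<in> {p..q} then f x else 0)"
      by (rule sum.cong) (auto simp: interval_rep_dim)
    also have "\<dots> = (\<Sum>x\<in>{p..q}. f x)"
      by (subst sum.inter_restrict[symmetric]) (simp_all only: sub finite_atLeastAtMost)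
    finally show ?thesis .
  qed
  show ?thesis
    using *[of \<alpha>] *[of "\<lambda>_. 1"] by (simp add: slope_def avg_def)
qed

text \<open>A single string has no lower terms, so triangularity is an equation.\<close>

lemma interval_rep_semistable:
  assumes "p \<le> q" "q \<le> l" "stable_interval \<alpha> \<tau> p q"
  shows "semistable (A_quiver l \<tau>) \<alpha> (interval_rep p q :: ('f::field) Arep)"
proof -
  let ?w = "\<lambda>(j::nat) x. if p \<le> x \<and> x \<le> q then unit_seq else (0 :: nat \<Rightarrow> 'f)"
  let ?A = "\<lambda>_::nat. p" and ?C = "\<lambda>_::nat. q"
  have "semistable (A_quiver l \<tau>) \<alpha> (interval_rep p q :: 'f Arep) \<and>
      slope (A_quiver l \<tau>) \<alpha> (interval_rep p q :: 'f Arep) = avg \<alpha> p q"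
  proof (rule semistable_triangular[where J = "{0}" and A = ?A and C = ?C and w = ?w and r = id])
    show "is_rep (A_quiver l \<tau>) (interval_rep p q :: 'f Arep)" by (rule is_rep_interval_rep)
    have "frame (active {0} ?A ?C x) (\<lambda>j. ?w j x) (rspace (interval_rep p q) x)" for x
    proof (cases "p \<le> x \<and> x \<le> q")
      case True
      then have "active {0} ?A ?C x = {0}" by (auto simp: active_def)
      then show ?thesis using True frame_field_line[of "0::nat"] by (simp add: interval_rep_def)
    next
      case False
      then have "active {0} ?A ?C x = {}" by (auto simp: active_def)
      moreover have "rspace (interval_rep p q) x = {0 :: nat \<Rightarrow> 'f}" using False by (auto simp: interval_rep_def)
      ultimately show ?thesis by (simp add: frame_empty)
    qed
    then show "string_frames l (interval_rep p q) {0} ?A ?C ?w"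
      using assms by (simp add: string_frames_def)
    show "rmap (interval_rep p q) i (?w j (tail (A_quiver l \<tau>) i)) - ?w j (head (A_quiver l \<tau>) i)
        \<in> seqs.span ((\<lambda>k. ?w k (head (A_quiver l \<tau>) i)) ` {k \<in> active {0} ?A ?C (head (A_quiver l \<tau>) i). id k < id j})"
      if "i \<in> arcs (A_quiver l \<tau>)" "j \<in> active {0} ?A ?C (tail (A_quiver l \<tau>) i)" for i j
    proof -
      have "rmap (interval_rep p q) i (?w j (tail (A_quiver l \<tau>) i)) = ?w j (head (A_quiver l \<tau>) i)"
        using that by (auto simp: interval_rep_def active_def)
      then have "rmap (interval_rep p q) i (?w j (tail (A_quiver l \<tau>) i)) - ?w j (head (A_quiver l \<tau>) i) = 0"
        by (simp only: diff_self)
      then show ?thesis by (simp only: seqs.span_zero)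
    qed
  qed (use assms in auto)
  then show ?thesis by blast
qed

context
  fixes l a b c :: nat and \<tau> :: "nat \<Rightarrow> bool" and \<alpha> :: "nat \<Rightarrow> real"
  assumes abc: "a < b" "b \<le> c" "c \<le> l"
begin

private abbreviation (input) Qv where "Qv \<equiv> A_quiver l \<tau>"

text \<open>The ends of the two pieces into which the edge \<open>b\<close> cuts
  \<open>[a, c]\<close>. The piece at the head of that edge is closed under all arrows and is the
  subobject; the piece at its tail is the quotient.\<close>

definition sub_lo where "sub_lo = (if \<tau> b then b else a)"
definition sub_hi where "sub_hi = (if \<tau> b then c else b - 1)"
definition quo_lo where "quo_lo = (if \<tau> b then a else b)"
definition quo_hi where "quo_hi = (if \<tau> b then b - 1 else c)"

lemmas piece_defs = sub_lo_def sub_hi_def quo_lo_def quo_hi_def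

lemma piece_bounds: "sub_lo \<le> sub_hi" "sub_hi \<le> l" "quo_lo \<le> quo_hi" "quo_hi \<le> l"
  using abc by (auto simp: piece_defs)

text \<open>Both values of \<open>k\<close> belong to the same two end terms; \<open>k\<close> only
  decides whether the sequence splits.\<close>

lemma cut_rep_quotient:
  "is_quotient Qv (cut_rep a c b k :: ('f::field) Arep)
     (interval_rep sub_lo sub_hi) (interval_rep quo_lo quo_hi)"
proof -
  have 0: "0 \<in> (field_line :: (nat \<Rightarrow> 'f) set)" by (rule zero_field_line)
  let ?V = "cut_rep a c b k :: 'f Arep"
  let ?U = "interval_rep sub_lo sub_hi :: 'f Arep"
  let ?W = "interval_rep quo_lo quo_hi :: 'f Arep"
  let ?\<pi> = "\<lambda>x (v :: nat \<Rightarrow> 'f). if quo_lo \<le> x \<and> x \<le> quo_hi then v else 0"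
  have "rspace ?U x \<subseteq> rspace ?V x" for x
    using 0 abc by (auto simp: interval_rep_def cut_rep_def piece_defs)
  moreover have "rmap ?U i v = rmap ?V i v"
    if "i \<in> arcs Qv" "v \<in> rspace ?U (tail Qv i)" for i v
    using that abc by (cases "\<tau> b"; cases "\<tau> i"; cases "i = b")
      (auto simp: interval_rep_def cut_rep_def piece_defs split: if_splits)
  ultimately have sub: "subrep Qv ?U ?V"
    using is_rep_interval_rep by (simp add: subrep_def del: A_quiver_simps)
  have "linear_between (rspace ?V x) (rspace ?W x) (?\<pi> x)" for x
    using 0 abc by (auto simp: linear_between_def interval_rep_def cut_rep_def piece_defs)
  moreover have "?\<pi> (head Qv i) (rmap ?V i v) = rmap ?W i (?\<pi> (tail Qv i) v)"
    if "i \<in> arcs Qv" "v \<in> rspace ?V (tail Qv i)" for i v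
    using that abc by (cases "\<tau> b"; cases "\<tau> i"; cases "i = b")
      (auto simp: interval_rep_def cut_rep_def piece_defs split: if_splits)
  ultimately have mor: "rep_morphism Qv ?V ?W ?\<pi>"
    by (simp add: rep_morphism_def del: A_quiver_simps)
  have "?\<pi> x ` rspace ?V x = rspace ?W x" for x
    using 0 abc by (auto simp: interval_rep_def cut_rep_def piece_defs)
  moreover have "{v \<in> rspace ?V x. ?\<pi> x v = 0} = rspace ?U x" for x
    using 0 abc by (cases "\<tau> b") (auto simp: interval_rep_def cut_rep_def piece_defs split: if_splits)
  ultimately have "\<forall>x\<in>verts Qv. ?\<pi> x ` rspace ?V x = rspace ?W x \<and>
      {v \<in> rspace ?V x. ?\<pi> x v = 0} = rspace ?U x" by blast
  then show ?thesis
    using sub mor is_rep_interval_rep unfolding is_quotient_def by blast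
qed

text \<open>The subobject gets the label 0 and the quotient the label 1. The map at the edge
  \<open>b\<close> then sends the string of the quotient to nothing or to the smaller string, which
  is triangular.\<close>

lemma cut_rep_semistable:
  assumes st: "stable_interval \<alpha> \<tau> sub_lo sub_hi" "stable_interval \<alpha> \<tau> quo_lo quo_hi"
    and eq: "avg \<alpha> sub_lo sub_hi = avg \<alpha> quo_lo quo_hi"
  shows "semistable Qv \<alpha> (cut_rep a c b k :: ('f::field) Arep)"
proof -
  let ?A = "\<lambda>j::nat. if j = 0 then sub_lo else quo_lo" and ?C = "\<lambda>j::nat. if j = 0 then sub_hi else quo_hi"
  let ?w = "\<lambda>j x. if ?A j \<le> x \<and> x \<le> ?C j then unit_seq else (0 :: nat \<Rightarrow> 'f)"
  let ?J = "{0, 1} :: nat set"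
  let ?Q = Qv
  have "semistable ?Q \<alpha> (cut_rep a c b k :: 'f Arep) \<and>
      slope ?Q \<alpha> (cut_rep a c b k :: 'f Arep) = avg \<alpha> sub_lo sub_hi"
  proof (rule semistable_triangular[where J = ?J and A = ?A and C = ?C and w = ?w and r = id])
    show "is_rep ?Q (cut_rep a c b k :: 'f Arep)" by (rule cut_rep_is_rep)
    have "frame (active ?J ?A ?C x) (\<lambda>j. ?w j x) (rspace (cut_rep a c b k) x)" for x
    proof (cases "a \<le> x \<and> x \<le> c")
      case True
      then have S: "rspace (cut_rep a c b k) x = (field_line :: (nat \<Rightarrow> 'f) set)" by (simp add: cut_rep_def)
      have "\<exists>j. active ?J ?A ?C x = {j}"
      proof (cases "sub_lo \<le> x \<and> x \<le> sub_hi")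
        case in_sub: True
        then have "\<not> (quo_lo \<le> x \<and> x \<le> quo_hi)" using abc by (auto simp: piece_defs split: if_splits)
        then have "active ?J ?A ?C x = {0}" using in_sub by (auto simp: active_def)
        then show ?thesis by blast
      next
        case out: False
        then have "quo_lo \<le> x \<and> x \<le> quo_hi" using True by (auto simp: piece_defs split: if_splits)
        then have "active ?J ?A ?C x = {1}" using out by (auto simp: active_def)
        then show ?thesis by blast
      qed
      then obtain j where j: "active ?J ?A ?C x = {j}" by blast
      have "j \<in> active ?J ?A ?C x" using j by blast
      then have "?w j x = unit_seq" unfolding active_def by simp
      then have "frame {j} (\<lambda>j. ?w j x) (field_line :: (nat \<Rightarrow> 'f) set) \<longleftrightarrow> frame {j} (\<lambda>_. unit_seq) (field_line :: (nat \<Rightarrow> 'f) set)"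
        by (intro frame_cong) simp
      then show ?thesis unfolding j S by (simp only: frame_field_line)
    next
      case False
      then have "active ?J ?A ?C x = {}" using abc by (auto simp: active_def piece_defs split: if_splits)
      moreover have "rspace (cut_rep a c b k) x = {0 :: nat \<Rightarrow> 'f}" using False by (auto simp: cut_rep_def)
      ultimately show ?thesis by (simp add: frame_empty)
    qed
    then show "string_frames l (cut_rep a c b k) ?J ?A ?C ?w"
      using piece_bounds by (simp add: string_frames_def)
    fix i j assume i: "i \<in> arcs ?Q" and j: "j \<in> active ?J ?A ?C (tail ?Q i)"
    let ?T = "seqs.span ((\<lambda>k. ?w k (head ?Q i)) ` {k \<in> active ?J ?A ?C (head ?Q i). id k < id j})"
    show "rmap (cut_rep a c b k) i (?w j (tail ?Q i)) - ?w j (head ?Q i) \<in> ?T"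
    \<comment> \<open>The only place where a lower term is present.\<close>
    proof (cases "i = b \<and> j = 1 \<and> k")
      case True
      then have h: "sub_lo \<le> head ?Q i" "head ?Q i \<le> sub_hi" "\<not> (quo_lo \<le> head ?Q i \<and> head ?Q i \<le> quo_hi)"
        using abc by (auto simp: piece_defs)
      have t: "quo_lo \<le> tail ?Q i \<and> tail ?Q i \<le> quo_hi" using j True by (simp add: active_def)
      have "rmap (cut_rep a c b k) i (?w j (tail ?Q i)) = (unit_seq :: nat \<Rightarrow> 'f)"
        using t True abc less_imp_le_nat[OF abc(1)] le_diff_conv[of a b 1]
        by (auto simp: cut_rep_def simp del: A_quiver_simps)
      moreover have "?w j (head ?Q i) = 0" using h(3) True by (auto simp del: A_quiver_simps)
      moreover have "unit_seq \<in> ?T"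
      proof (rule seqs.span_base, rule image_eqI[of _ _ 0])
        show "unit_seq = ?w 0 (head ?Q i)" using h by (auto simp del: A_quiver_simps)
        show "0 \<in> {k \<in> active ?J ?A ?C (head ?Q i). id k < id j}"
          using h True by (auto simp: active_def simp del: A_quiver_simps)
      qed
      ultimately show ?thesis by (simp only: diff_zero)
    next
      case False
      have "rmap (cut_rep a c b k) i (?w j (tail ?Q i)) = ?w j (head ?Q i)"
        using i j False abc by (cases "\<tau> b"; cases "\<tau> i"; cases "i = b"; cases "j = 0")
          (auto simp: cut_rep_def active_def piece_defs split: if_splits)
      then have "rmap (cut_rep a c b k) i (?w j (tail ?Q i)) - ?w j (head ?Q i) = 0"
        by (simp only: diff_self)
      then show ?thesis by (simp only: seqs.span_zero)
    qed
  qed (use st eq in auto)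
  then show ?thesis by blast
qed

text \<open>If the subobject has the larger slope, it is the first step of the filtration for both
  values of \<open>k\<close>. If the slopes agree, both representations are semistable and the type
  is their common dimension vector.\<close>

lemma cut_rep_HN_type:
  assumes st: "stable_interval \<alpha> \<tau> sub_lo sub_hi" "stable_interval \<alpha> \<tau> quo_lo quo_hi"
    and le: "avg \<alpha> quo_lo quo_hi \<le> avg \<alpha> sub_lo sub_hi"
  shows "HN_type Qv \<alpha> (cut_rep a c b True :: ('f::field) Arep) =
    HN_type Qv \<alpha> (cut_rep a c b False :: 'f Arep)"
proof (cases "avg \<alpha> quo_lo quo_hi = avg \<alpha> sub_lo sub_hi")
  case True
  have "HN_type Qv \<alpha> (cut_rep a c b k :: 'f Arep) =
      [dim_vector Qv (cut_rep a c b k :: 'f Arep)]" for k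
    using True by (intro HN_type_eqI is_HN_type_semistable fin_digraph_A_quiver cut_rep_semistable st) simp
  moreover have "dim_vector Qv (cut_rep a c b True :: 'f Arep) =
      dim_vector Qv (cut_rep a c b False :: 'f Arep)"
    by (simp add: dim_vector_def cut_rep_def)
  ultimately show ?thesis by simp
next
  case False
  then have less: "avg \<alpha> quo_lo quo_hi < avg \<alpha> sub_lo sub_hi" using le by simp
  have "HN_type Qv \<alpha> (cut_rep a c b k :: 'f Arep) =
      [dim_vector Qv (interval_rep sub_lo sub_hi :: 'f Arep),
       dim_vector Qv (interval_rep quo_lo quo_hi :: 'f Arep)]" for k
    using less piece_bounds
    by (intro HN_type_eqI is_HN_type_extension fin_digraph_A_quiver cut_rep_is_rep cut_rep_quotient
        interval_rep_semistable st) (simp_all add: slope_interval_rep)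
  then show ?thesis by simp
qed

text \<open>An isomorphism would intertwine the maps at the edge \<open>b\<close>, of which one is
  the identity of the line and the other zero.\<close>

lemma cut_rep_not_iso:
  "\<not> rep_iso Qv (cut_rep a c b True :: ('f::field) Arep) (cut_rep a c b False)"
proof
  let ?Q = Qv and ?V = "cut_rep a c b True :: 'f Arep"
    and ?W = "cut_rep a c b False :: 'f Arep"
  assume "rep_iso ?Q ?V ?W"
  then obtain \<phi> where \<phi>: "rep_morphism ?Q ?V ?W \<phi>" "\<forall>x\<in>verts ?Q. bij_betw (\<phi> x) (rspace ?V x) (rspace ?W x)"
    by (auto simp: rep_iso_def)
  let ?h = "head ?Q b" and ?t = "tail ?Q b"
  have th: "a \<le> ?h" "?h \<le> c" "a \<le> ?t" "?t \<le> c" "?h \<in> verts ?Q" "b \<in> arcs ?Q" using abc by auto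
  have "unit_seq \<in> rspace ?V ?t" using th unit_seq_field_line by (simp add: cut_rep_def del: A_quiver_simps)
  then have "\<phi> ?h (rmap ?V b unit_seq) = rmap ?W b (\<phi> ?t unit_seq)"
    using \<phi>(1) th by (simp add: rep_morphism_def del: A_quiver_simps)
  moreover have "a \<le> b - 1" using abc by simp
  ultimately have "\<phi> ?h unit_seq = 0" using abc by (simp add: cut_rep_def del: A_quiver_simps)
  moreover have "\<phi> ?h 0 = 0"
    using \<phi>(1) th linear_between_zero[of "rspace ?V ?h" "rspace ?W ?h" "\<phi> ?h"]
      is_rep_subspace[OF cut_rep_is_rep, of ?h l \<tau> a c b True] unfolding rep_morphism_def by blast
  moreover have "unit_seq \<in> rspace ?V ?h" "0 \<in> rspace ?V ?h"
    using th unit_seq_field_line seqs.subspace_0[OF field_line_subspace]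
    by (simp_all add: cut_rep_def del: A_quiver_simps)
  moreover have "inj_on (\<phi> ?h) (rspace ?V ?h)" using \<phi>(2) th by (auto simp: bij_betw_def simp del: A_quiver_simps)
  ultimately have "unit_seq = (0 :: nat \<Rightarrow> 'f)" by (metis inj_onD)
  then show False using unit_seq_nonzero by blast
qed

end

lemma stable_interval_of_complete:
  assumes compl: "complete_charge TYPE('f::field) (A_quiver l \<tau>) \<alpha>"
  shows "a \<le> c \<Longrightarrow> c \<le> l \<Longrightarrow> stable_interval \<alpha> \<tau> a c"
proof (induction "c - a" arbitrary: a c rule: less_induct)
  case less
  show ?case
  proof (rule ccontr)
    assume "\<not> stable_interval \<alpha> \<tau> a c"
    then obtain b where b: "a < b" "b \<le> c"
      "\<not> (if \<tau> b then avg \<alpha> a (b - 1) > avg \<alpha> b c else avg \<alpha> a (b - 1) < avg \<alpha> b c)"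
      by (auto simp: stable_interval_def)
    note abc = b(1,2) less.prems(2)
    have st: "stable_interval \<alpha> \<tau> a (b - 1)" "stable_interval \<alpha> \<tau> b c"
      using less b(1,2) by auto
    have "HN_type (A_quiver l \<tau>) \<alpha> (cut_rep a c b True :: 'f Arep) =
        HN_type (A_quiver l \<tau>) \<alpha> (cut_rep a c b False :: 'f Arep)"
      using st b(3) by (intro cut_rep_HN_type[OF abc]) (auto simp: piece_defs[OF abc] split: if_splits)
    then have "rep_iso (A_quiver l \<tau>) (cut_rep a c b True :: 'f Arep) (cut_rep a c b False)"
      using compl cut_rep_is_rep unfolding complete_charge_def by blast
    then show False using cut_rep_not_iso[OF abc] by blast
  qed
qed

section \<open>The inequalities on level sets\<close>

text \<open>The numerical form of vector space duality, which reverses the arrows and exchanges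
  subobjects and quotients. It reduces the inequalities for \<open>eta\<close> to those for
  \<open>chi\<close>.\<close>

lemma stable_interval_uminus:
  "stable_interval (\<lambda>x. - \<alpha> x) (\<lambda>i. \<not> \<tau> i) a c \<longleftrightarrow> stable_interval \<alpha> \<tau> a c"
proof -
  have "avg (\<lambda>x. - \<alpha> x) p q = - avg \<alpha> p q" for p q by (simp add: avg_def sum_negf)
  then show ?thesis by (auto simp: stable_interval_def)
qed

lemma eta_eq_chi: "eta \<tau> = chi (\<lambda>i. \<not> \<tau> i)"
proof
  show "eta \<tau> i = chi (\<lambda>i. \<not> \<tau> i) i" for i by (induction i) auto
qed

lemma chi_mono: "i \<le> j \<Longrightarrow> chi \<tau> i \<le> chi \<tau> j"
  by (induction j rule: dec_induct) auto

lemma chi_step: "0 < i \<Longrightarrow> chi \<tau> i = (if \<tau> i then chi \<tau> (i - 1) + 1 else chi \<tau> (i - 1))"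
  by (cases i) auto

section \<open>Level sets and their means\<close>

definition level :: "nat \<Rightarrow> (nat \<Rightarrow> bool) \<Rightarrow> nat \<Rightarrow> nat set" where
  "level l \<tau> k = {i \<in> {0..l}. chi \<tau> i = k}"

definition level_mean :: "nat \<Rightarrow> (nat \<Rightarrow> bool) \<Rightarrow> (nat \<Rightarrow> real) \<Rightarrow> nat \<Rightarrow> real" where
  "level_mean l \<tau> \<alpha> k = (\<Sum>x\<in>level l \<tau> k. \<alpha> x) / real (card (level l \<tau> k))"

definition decreasing_means :: "nat \<Rightarrow> (nat \<Rightarrow> bool) \<Rightarrow> (nat \<Rightarrow> real) \<Rightarrow> bool" where
  "decreasing_means l \<tau> \<alpha> \<longleftrightarrow> (\<forall>k<chi \<tau> l. level_mean l \<tau> \<alpha> k > level_mean l \<tau> \<alpha> (k + 1))"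

lemma level_nonempty: "k \<le> chi \<tau> l \<Longrightarrow> level l \<tau> k \<noteq> {}"
proof (induction l)
  case (Suc l)
  show ?case
  proof (cases "k \<le> chi \<tau> l")
    case True
    then have "level l \<tau> k \<noteq> {}" by (rule Suc.IH)
    moreover have "level l \<tau> k \<subseteq> level (Suc l) \<tau> k" by (auto simp: level_def)
    ultimately show ?thesis by blast
  next
    case False
    then have "chi \<tau> (Suc l) = k" using Suc.prems by (auto split: if_splits)
    then have "Suc l \<in> level (Suc l) \<tau> k" by (simp add: level_def)
    then show ?thesis by blast
  qed
qed (simp add: level_def)

lemma level_interval:
  assumes "k \<le> chi \<tau> l"
  shows "level l \<tau> k = {Min (level l \<tau> k)..Max (level l \<tau> k)}"
    "Min (level l \<tau> k) \<le> Max (level l \<tau> k)" "Max (level l \<tau> k) \<le> l"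
    "chi \<tau> (Min (level l \<tau> k)) = k" "chi \<tau> (Max (level l \<tau> k)) = k"
proof -
  have fin: "finite (level l \<tau> k)" by (simp add: level_def)
  note ne = level_nonempty[OF assms]
  have mem: "Min (level l \<tau> k) \<in> level l \<tau> k" "Max (level l \<tau> k) \<in> level l \<tau> k"
    using fin ne by simp_all
  then show e: "chi \<tau> (Min (level l \<tau> k)) = k" "chi \<tau> (Max (level l \<tau> k)) = k" "Max (level l \<tau> k) \<le> l"
    by (auto simp: level_def)
  show "Min (level l \<tau> k) \<le> Max (level l \<tau> k)" using fin mem by simp
  show "level l \<tau> k = {Min (level l \<tau> k)..Max (level l \<tau> k)}"
  proof
    show "level l \<tau> k \<subseteq> {Min (level l \<tau> k)..Max (level l \<tau> k)}" using fin by auto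
    show "{Min (level l \<tau> k)..Max (level l \<tau> k)} \<subseteq> level l \<tau> k"
    proof
      fix i assume "i \<in> {Min (level l \<tau> k)..Max (level l \<tau> k)}"
      then show "i \<in> level l \<tau> k"
        using e chi_mono[of "Min (level l \<tau> k)" i \<tau>] chi_mono[of i "Max (level l \<tau> k)" \<tau>]
        by (simp add: level_def)
    qed
  qed
qed

lemma level_mean_eq_avg:
  assumes "k \<le> chi \<tau> l"
  shows "level_mean l \<tau> \<alpha> k = avg \<alpha> (Min (level l \<tau> k)) (Max (level l \<tau> k))"
proof -
  define p q where "p = Min (level l \<tau> k)" and "q = Max (level l \<tau> k)"
  have "level l \<tau> k = {p..q}" "p \<le> q" unfolding p_def q_def by (rule level_interval[OF assms])+
  then show ?thesis unfolding p_def[symmetric] q_def[symmetric]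
    by (simp add: level_mean_def avg_def)
qed

lemma slope_level_rep:
  assumes "k \<le> chi \<tau> l"
  shows "slope (A_quiver l \<sigma>) \<alpha> (level_rep l (chi \<tau>) k :: ('f::field) Arep) = level_mean l \<tau> \<alpha> k"
  unfolding level_rep_def level_def[symmetric] level_mean_eq_avg[OF assms]
  by (rule slope_interval_rep) (rule level_interval[OF assms])+

text \<open>Two consecutive levels meet at an arrow pointing right, so their inequality is the
  stability of their union at that cut.\<close>

lemma decreasing_means_of_stable:
  assumes st: "\<And>a c. a \<le> c \<Longrightarrow> c \<le> l \<Longrightarrow> stable_interval \<alpha> \<tau> a c"
  shows "decreasing_means l \<tau> \<alpha>"
  unfolding decreasing_means_def
proof (intro allI impI)
  fix k assume k: "k < chi \<tau> l"
  then have k1: "k \<le> chi \<tau> l" "k + 1 \<le> chi \<tau> l" by simp_all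
  define p q where "p = Min (level l \<tau> k)" and "q = Max (level l \<tau> k)"
  define p' q' where "p' = Min (level l \<tau> (k + 1))" and "q' = Max (level l \<tau> (k + 1))"
  have pq: "p \<le> q" "chi \<tau> q = k" "level l \<tau> k = {p..q}"
    unfolding p_def q_def by (rule level_interval[OF k1(1)])+
  have pq': "p' \<le> q'" "q' \<le> l" "chi \<tau> p' = k + 1" "level l \<tau> (k + 1) = {p'..q'}"
    unfolding p'_def q'_def by (rule level_interval[OF k1(2)])+
  have qp: "q < p'" using chi_mono[of p' q \<tau>] pq(2) pq'(3) by (cases "q < p'") auto
  \<comment> \<open>The vertex behind level \<open>k\<close> has another value of
    \<open>chi \<tau>\<close>, and only an arrow pointing right changes that value.\<close>
  have "Suc q \<le> l" using qp pq' by simp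
  then have "Suc q \<notin> level l \<tau> k \<Longrightarrow> chi \<tau> (Suc q) \<noteq> k" by (simp add: level_def)
  moreover have "Suc q \<notin> level l \<tau> k" using pq(3) by simp
  ultimately have tq: "\<tau> (Suc q)" "chi \<tau> (Suc q) = k + 1" using pq(2) by (auto split: if_splits)
  then have "Suc q \<in> level l \<tau> (k + 1)" using \<open>Suc q \<le> l\<close> by (simp add: level_def)
  then have p': "p' = Suc q" using pq'(4) qp by simp
  have "stable_interval \<alpha> \<tau> p q'" using st pq pq' p' by simp
  then have "avg \<alpha> p q > avg \<alpha> (Suc q) q'"
    using pq(1) pq'(1) p' tq(1) by (auto simp: stable_interval_def dest: spec[of _ "Suc q"])
  moreover have "level_mean l \<tau> \<alpha> k = avg \<alpha> p q"
    unfolding p_def q_def by (rule level_mean_eq_avg[OF k1(1)])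
  moreover have "level_mean l \<tau> \<alpha> (k + 1) = avg \<alpha> p' q'"
    unfolding p'_def q'_def by (rule level_mean_eq_avg[OF k1(2)])
  ultimately show "level_mean l \<tau> \<alpha> (k + 1) < level_mean l \<tau> \<alpha> k"
    using p' by (simp only:)
qed

context
  fixes l :: nat and \<tau> :: "nat \<Rightarrow> bool" and \<alpha> :: "nat \<Rightarrow> real"
  assumes dec: "decreasing_means l \<tau> \<alpha>"
begin

lemma level_mean_antimono: "k \<le> k' \<Longrightarrow> k' \<le> chi \<tau> l \<Longrightarrow> level_mean l \<tau> \<alpha> k' \<le> level_mean l \<tau> \<alpha> k"
proof (induction k' rule: dec_induct)
  case (step n)
  then have "level_mean l \<tau> \<alpha> (n + 1) < level_mean l \<tau> \<alpha> n" using dec by (simp add: decreasing_means_def)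
  then show ?case using step by simp
qed simp

lemma level_mean_chi_antimono:
  "x \<le> y \<Longrightarrow> y \<le> l \<Longrightarrow> level_mean l \<tau> \<alpha> (chi \<tau> y) \<le> level_mean l \<tau> \<alpha> (chi \<tau> x)"
  by (intro level_mean_antimono chi_mono)

lemma level_mean_chi_less:
  assumes "0 < x" "x \<le> l" "\<tau> x"
  shows "level_mean l \<tau> \<alpha> (chi \<tau> x) < level_mean l \<tau> \<alpha> (chi \<tau> (x - 1))"
proof -
  have "chi \<tau> x = chi \<tau> (x - 1) + 1" using chi_step[OF assms(1)] assms(3) by simp
  moreover have "chi \<tau> x \<le> chi \<tau> l" using assms(2) by (rule chi_mono)
  ultimately show ?thesis using dec by (simp add: decreasing_means_def)
qed

end

lemma level_mean_sum_below:
  "(\<Sum>x\<in>{x \<in> {0..l}. chi \<tau> x < K}. level_mean l \<tau> \<alpha> (chi \<tau> x)) = (\<Sum>x\<in>{x \<in> {0..l}. chi \<tau> x < K}. \<alpha> x)"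
proof -
  let ?S = "{x \<in> {0..l}. chi \<tau> x < K}"
  have group: "(\<Sum>k\<in>{..<K}. \<Sum>x\<in>{x \<in> ?S. chi \<tau> x = k}. h x) = (\<Sum>x\<in>?S. h x)" for h :: "nat \<Rightarrow> real"
    by (rule sum.group) auto
  have lev: "{x \<in> ?S. chi \<tau> x = k} = level l \<tau> k" if "k \<in> {..<K}" for k
    using that by (auto simp: level_def)
  have "(\<Sum>x\<in>level l \<tau> k. level_mean l \<tau> \<alpha> (chi \<tau> x)) = (\<Sum>x\<in>level l \<tau> k. \<alpha> x)" for k
  proof -
    have "(\<Sum>x\<in>level l \<tau> k. level_mean l \<tau> \<alpha> (chi \<tau> x)) = (\<Sum>x\<in>level l \<tau> k. level_mean l \<tau> \<alpha> k)"
      by (rule sum.cong) (auto simp: level_def)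
    also have "\<dots> = (\<Sum>x\<in>level l \<tau> k. \<alpha> x)"
    proof (cases "level l \<tau> k = {}")
      case False
      then have "card (level l \<tau> k) \<noteq> 0" by (simp add: level_def)
      then show ?thesis by (simp add: level_mean_def)
    qed simp
    finally show ?thesis .
  qed
  then show ?thesis unfolding group[symmetric] using lev by simp
qed

text \<open>An arrow pointing right starts a new level, so the vertices before it form a union of
  levels, on which averaging preserves the sum. The same holds for the set of all vertices.\<close>

lemma level_mean_sum_lessThan:
  assumes "i = Suc l \<or> i \<le> l \<and> 0 < i \<and> \<tau> i"
  shows "(\<Sum>x<i. level_mean l \<tau> \<alpha> (chi \<tau> x)) = (\<Sum>x<i. \<alpha> x)"
proof -
  have "\<exists>K. {..<i} = {x \<in> {0..l}. chi \<tau> x < K}"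
  proof (cases "i = Suc l")
    case True
    then have "{..<i} = {x \<in> {0..l}. chi \<tau> x < Suc (chi \<tau> l)}"
      using chi_mono[of _ l \<tau>] by (auto simp: less_Suc_eq_le)
    then show ?thesis by blast
  next
    case False
    then have i: "i \<le> l" "0 < i" "\<tau> i" using assms by auto
    have lt: "chi \<tau> x < chi \<tau> i \<longleftrightarrow> x < i" for x
    proof
      assume "x < i"
      then have "chi \<tau> x \<le> chi \<tau> (i - 1)" by (intro chi_mono) simp
      then show "chi \<tau> x < chi \<tau> i" using chi_step[OF i(2), of \<tau>] i(3) by simp
    next
      assume "chi \<tau> x < chi \<tau> i"
      then show "x < i" using chi_mono[of i x \<tau>] by (cases "x < i") auto
    qed
    have "{..<i} = {x \<in> {0..l}. chi \<tau> x < chi \<tau> i}" unfolding lt using i(1) by auto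
    then show ?thesis by blast
  qed
  then obtain K where K: "{..<i} = {x \<in> {0..l}. chi \<tau> x < K}" by blast
  show ?thesis unfolding K by (rule level_mean_sum_below)
qed

text \<open>Partial sums of a decreasing sequence are concave, and these vanish at both
  ends.\<close>

lemma antimono_partial_sum_nonneg:
  fixes h :: "nat \<Rightarrow> real"
  assumes anti: "\<And>x y. x \<le> y \<Longrightarrow> y \<le> l \<Longrightarrow> h y \<le> h x" and zero: "(\<Sum>x<Suc l. h x) = 0" and i: "i \<le> Suc l"
  shows "0 \<le> (\<Sum>x<i. h x)"
proof (rule ccontr)
  assume neg: "\<not> 0 \<le> (\<Sum>x<i. h x)"
  then obtain x where x: "x < i" "h x < 0" using sum_nonneg[of "{..<i}" h] by force
  have "h y \<le> 0" if "y \<in> {i..<Suc l}" for y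
    using anti[of x y] x that by simp
  then have "(\<Sum>y\<in>{i..<Suc l}. h y) \<le> 0" by (rule sum_nonpos)
  moreover have "(\<Sum>y<Suc l. h y) = (\<Sum>y<i. h y) + (\<Sum>y\<in>{i..<Suc l}. h y)"
    using i by (simp only: lessThan_atLeast0 sum.atLeastLessThan_concat)
  ultimately show False using zero neg by linarith
qed

lemma avg_eq_partial_sums:
  assumes "a \<le> c"
  shows "avg \<alpha> a c = ((\<Sum>x<Suc c. \<alpha> x) - (\<Sum>x<a. \<alpha> x)) / (real (Suc c) - real a)"
proof -
  have "(\<Sum>x<Suc c. \<alpha> x) = (\<Sum>x<a. \<alpha> x) + (\<Sum>x\<in>{a..<Suc c}. \<alpha> x)"
    using assms by (simp only: lessThan_atLeast0 sum.atLeastLessThan_concat)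
  then show ?thesis
    using assms by (simp add: avg_def atLeastLessThanSuc_atLeastAtMost of_nat_diff)
qed

text \<open>The partial sums of the level means of \<open>\<tau>\<close> form the least concave majorant of those of \<open>\<alpha>\<close>
  touching them at the arrows pointing right; the opposite orientation gives a convex minorant.\<close>

lemma decreasing_means_avg_less:
  assumes dec: "decreasing_means l \<tau> \<alpha>" and dec': "decreasing_means l (\<lambda>i. \<not> \<tau> i) (\<lambda>x. - \<alpha> x)"
    and b: "a < b" "b \<le> c" "c \<le> l" and \<tau>: "\<tau> b"
  shows "avg \<alpha> b c < avg \<alpha> a (b - 1)"
proof -
  let ?u = "\<lambda>x. level_mean l \<tau> \<alpha> (chi \<tau> x)"
  let ?v = "\<lambda>x. - level_mean l (\<lambda>i. \<not> \<tau> i) (\<lambda>x. - \<alpha> x) (chi (\<lambda>i. \<not> \<tau> i) x)"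
  have u: "?u y \<le> ?u x" if "x \<le> y" "y \<le> l" for x y using level_mean_chi_antimono[OF dec that] .
  have v: "?v x \<le> ?v y" if "x \<le> y" "y \<le> l" for x y using level_mean_chi_antimono[OF dec' that] by simp
  have sumu: "(\<Sum>x<i. ?u x) = (\<Sum>x<i. \<alpha> x)" if "i = Suc l \<or> i \<le> l \<and> 0 < i \<and> \<tau> i" for i
    using level_mean_sum_lessThan[of i l \<tau> \<alpha>] that by blast
  have sumv: "(\<Sum>x<i. ?v x) = (\<Sum>x<i. \<alpha> x)" if "i = Suc l \<or> i \<le> l \<and> 0 < i \<and> \<not> \<tau> i" for i
    using level_mean_sum_lessThan[of i l "\<lambda>i. \<not> \<tau> i" "\<lambda>x. - \<alpha> x"] that by (simp add: sum_negf)
  have le: "(\<Sum>x<i. \<alpha> x) \<le> (\<Sum>x<i. ?u x)" if "i \<le> Suc l" for i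
  proof (cases "i = 0 \<or> i = Suc l \<or> \<tau> i")
    case True
    then show ?thesis using sumu[of i] that by (cases "i = 0"; cases "i = Suc l") auto
  next
    case False
    \<comment> \<open>At an arrow pointing left the partial sums of \<alpha> are those of the convex
      function given by \<open>?v\<close>, so it suffices to compare \<open>?u\<close> with
      \<open>?v\<close>; their difference is decreasing with total zero.\<close>
    have "0 \<le> (\<Sum>x<i. ?u x - ?v x)"
    proof (rule antimono_partial_sum_nonneg[OF _ _ that])
      show "?u y - ?v y \<le> ?u x - ?v x" if "x \<le> y" "y \<le> l" for x y
        using u[OF that] v[OF that] by linarith
      show "(\<Sum>x<Suc l. ?u x - ?v x) = 0"
        using sumu[of "Suc l"] sumv[of "Suc l"] by (simp only: sum_subtractf) simp
    qed
    moreover have "(\<Sum>x<i. ?v x) = (\<Sum>x<i. \<alpha> x)" using sumv[of i] False that by simp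
    ultimately show ?thesis by (simp only: sum_subtractf)
  qed
  have eq: "(\<Sum>x<b. ?u x) = (\<Sum>x<b. \<alpha> x)" using sumu[of b] b \<tau> by simp
  have split: "(\<Sum>x<j. ?u x) = (\<Sum>x<i. ?u x) + (\<Sum>x\<in>{i..<j}. ?u x)" if "i \<le> j" for i j
    using that by (simp only: lessThan_atLeast0 sum.atLeastLessThan_concat)
  \<comment> \<open>The majorant and the partial sums of \<alpha> agree at \<open>b\<close>. Hence
    the chord of \<alpha> ending at \<open>b\<close> is at least as steep as that of the majorant,
    and the chord starting there at most as steep; the majorant has slope at least
    \<open>?u (b - 1)\<close> before \<open>b\<close> and at most \<open>?u b\<close> after
    it.\<close>
  have "(real b - real a) * ?u (b - 1) = (\<Sum>x\<in>{a..<b}. ?u (b - 1))" using b by (simp add: of_nat_diff)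
  also have "\<dots> \<le> (\<Sum>x\<in>{a..<b}. ?u x)" by (rule sum_mono) (use u b in auto)
  also have "\<dots> \<le> (\<Sum>x<b. \<alpha> x) - (\<Sum>x<a. \<alpha> x)" using split[of a b] le[of a] eq b by simp
  finally have left: "?u (b - 1) \<le> avg \<alpha> a (b - 1)"
    using b avg_eq_partial_sums[of a "b - 1" \<alpha>] by (simp add: pos_le_divide_eq mult.commute)
  have "(\<Sum>x<Suc c. \<alpha> x) - (\<Sum>x<b. \<alpha> x) \<le> (\<Sum>x\<in>{b..<Suc c}. ?u x)"
    using split[of b "Suc c"] le[of "Suc c"] eq b by (simp del: sum.lessThan_Suc)
  also have "\<dots> \<le> (\<Sum>x\<in>{b..<Suc c}. ?u b)" by (rule sum_mono) (use u b in auto)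
  also have "\<dots> = (real (Suc c) - real b) * ?u b" using b by (simp add: of_nat_diff)
  finally have right: "avg \<alpha> b c \<le> ?u b"
    using b avg_eq_partial_sums[of b c \<alpha>]
    by (simp add: pos_divide_le_eq mult.commute del: sum.lessThan_Suc)
  have "?u b < ?u (b - 1)" using level_mean_chi_less[OF dec, of b] b \<tau> by simp
  then show ?thesis using left right by simp
qed

section \<open>Characterisation and existence of complete charges\<close>

lemma stable_interval_iff_decreasing_means:
  "(\<forall>a c. a \<le> c \<longrightarrow> c \<le> l \<longrightarrow> stable_interval \<alpha> \<tau> a c) \<longleftrightarrow>
    decreasing_means l \<tau> \<alpha> \<and> decreasing_means l (\<lambda>i. \<not> \<tau> i) (\<lambda>x. - \<alpha> x)"
proof (intro iffI conjI allI impI)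
  assume st: "\<forall>a c. a \<le> c \<longrightarrow> c \<le> l \<longrightarrow> stable_interval \<alpha> \<tau> a c"
  then show "decreasing_means l \<tau> \<alpha>" by (intro decreasing_means_of_stable) simp
  show "decreasing_means l (\<lambda>i. \<not> \<tau> i) (\<lambda>x. - \<alpha> x)"
    using st stable_interval_uminus[of \<alpha> \<tau>] by (intro decreasing_means_of_stable) simp
next
  fix a c assume dec: "decreasing_means l \<tau> \<alpha> \<and> decreasing_means l (\<lambda>i. \<not> \<tau> i) (\<lambda>x. - \<alpha> x)"
    and ac: "a \<le> c" "c \<le> l"
  have neg: "avg (\<lambda>x. - \<alpha> x) p q = - avg \<alpha> p q" for p q by (simp add: avg_def sum_negf)
  have "avg \<alpha> a (b - 1) < avg \<alpha> b c" if "a < b" "b \<le> c" "\<not> \<tau> b" for b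
    using decreasing_means_avg_less[of l "\<lambda>i. \<not> \<tau> i" "\<lambda>x. - \<alpha> x" a b c] dec that ac neg by simp
  moreover have "avg \<alpha> b c < avg \<alpha> a (b - 1)" if "a < b" "b \<le> c" "\<tau> b" for b
    using decreasing_means_avg_less[of l \<tau> \<alpha> a b c] dec that ac by simp
  ultimately show "stable_interval \<alpha> \<tau> a c" by (auto simp: stable_interval_def)
qed

lemma complete_charge_iff:
  "complete_charge TYPE('f::field) (A_quiver l \<tau>) \<alpha> \<longleftrightarrow>
    decreasing_means l \<tau> \<alpha> \<and> decreasing_means l (\<lambda>i. \<not> \<tau> i) (\<lambda>x. - \<alpha> x)"
  unfolding stable_interval_iff_decreasing_means[symmetric]
proof (intro iffI allI impI)
  show "complete_charge TYPE('f) (A_quiver l \<tau>) \<alpha>"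
    if "\<forall>a c. a \<le> c \<longrightarrow> c \<le> l \<longrightarrow> stable_interval \<alpha> \<tau> a c"
    using that by (intro complete_of_stable_intervals) simp
qed (rule stable_interval_of_complete)

lemma decreasing_means_iff_slopes:
  "decreasing_means l \<tau> \<alpha> \<longleftrightarrow> (\<forall>k<chi \<tau> l.
     slope (A_quiver l \<sigma>) \<alpha> (level_rep l (chi \<tau>) k :: ('f::field) Arep)
     > slope (A_quiver l \<sigma>) \<alpha> (level_rep l (chi \<tau>) (k + 1) :: 'f Arep))"
  unfolding decreasing_means_def by (simp add: slope_level_rep)

lemma level_mean_uminus: "level_mean l \<tau> (\<lambda>x. - \<alpha> x) k = - level_mean l \<tau> \<alpha> k"
  by (simp add: level_mean_def sum_negf)

lemma decreasing_means_uminus_iff_slopes: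
  "decreasing_means l (\<lambda>i. \<not> \<tau> i) (\<lambda>x. - \<alpha> x) \<longleftrightarrow> (\<forall>k<eta \<tau> l.
     slope (A_quiver l \<sigma>) \<alpha> (level_rep l (eta \<tau>) k :: ('f::field) Arep)
     < slope (A_quiver l \<sigma>) \<alpha> (level_rep l (eta \<tau>) (k + 1) :: 'f Arep))"
  unfolding decreasing_means_def eta_eq_chi level_mean_uminus by (simp add: slope_level_rep)

text \<open>The partial sums of this charge lie on a concave parabola at the arrows pointing right and on
  its negative at those pointing left.\<close>

lemma ex_stable_charge: "\<exists>\<alpha>. \<forall>a c. a \<le> c \<longrightarrow> c \<le> l \<longrightarrow> stable_interval \<alpha> \<tau> a c"
proof -
  \<comment> \<open>The parabola vanishes at 0 and \<open>l + 1\<close> and is nonnegative between,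
    so that both \<open>B\<close> and \<open>- B\<close> stay below it. Its chord from
    \<open>i\<close> to \<open>j\<close> has slope \<open>l + 1 - i - j\<close>.\<close>
  define q where "q i = real i * (real l + 1 - real i)" for i
  define B where "B i = (if \<tau> i then q i else - q i)" for i
  define \<alpha> where "\<alpha> x = B (Suc x) - B x" for x
  have q0: "0 \<le> q i" if "i \<le> Suc l" for i using that by (simp add: q_def)
  have "B 0 = 0" by (simp add: B_def q_def)
  then have sumB: "(\<Sum>x<i. \<alpha> x) = B i" for i
    by (induction i) (simp_all add: \<alpha>_def)
  \<comment> \<open>A function below the parabola that touches it at \<open>b\<close> has a chord to
    the left of \<open>b\<close> at least as steep, and a chord to the right at most as steep, as
    the parabola; strict concavity separates the two. It is applied to \<open>B\<close> and to
    \<open>- B\<close>.\<close>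
  have key: "D b c' < D a b" if D: "\<And>i j. D i j = (E j - E i) / (real j - real i)"
      and E: "\<And>i. i \<le> Suc l \<Longrightarrow> E i \<le> q i" and Eb: "E b = q b" and abc: "a < b" "b < c'" "c' \<le> Suc l"
    for D :: "nat \<Rightarrow> nat \<Rightarrow> real" and E a b c'
  proof -
    have "(real l + 1 - real a - real b) * (real b - real a) = q b - q a"
      by (simp add: q_def algebra_simps)
    also have "\<dots> \<le> E b - E a" using E[of a] Eb abc by simp
    finally have 1: "real l + 1 - real a - real b \<le> D a b"
      unfolding D using abc by (simp add: pos_le_divide_eq)
    have "E c' - E b \<le> q c' - q b" using E[of c'] Eb abc by simp
    also have "\<dots> = (real l + 1 - real b - real c') * (real c' - real b)"
      by (simp add: q_def algebra_simps)
    finally have 2: "D b c' \<le> real l + 1 - real b - real c'"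
      unfolding D using abc by (simp add: pos_divide_le_eq)
    show ?thesis using 1 2 abc by linarith
  qed
  have avgB: "avg \<alpha> a c = (B (Suc c) - B a) / (real (Suc c) - real a)" if "a \<le> c" for a c
    using avg_eq_partial_sums[OF that, of \<alpha>] unfolding sumB .
  have "stable_interval \<alpha> \<tau> a c" if "a \<le> c" "c \<le> l" for a c
    unfolding stable_interval_def
  proof (intro allI impI)
    fix b assume b: "a < b \<and> b \<le> c"
    have "a \<le> b - 1" using b by auto
    let ?D = "\<lambda>i j. (B j - B i) / (real j - real i)"
    have L: "avg \<alpha> a (b - 1) = ?D a b" and R: "avg \<alpha> b c = ?D b (Suc c)"
      using avgB[OF \<open>a \<le> b - 1\<close>] avgB[of b c] b by simp_all
    show "if \<tau> b then avg \<alpha> a (b - 1) > avg \<alpha> b c else avg \<alpha> a (b - 1) < avg \<alpha> b c"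
    proof (cases "\<tau> b")
      case True
      have "?D b (Suc c) < ?D a b"
      proof (rule key[of ?D B])
        show "B i \<le> q i" if "i \<le> Suc l" for i using q0[OF that] by (simp add: B_def)
      qed (use True b that in \<open>auto simp: B_def\<close>)
      then show ?thesis using True L R by simp
    next
      case False
      let ?D' = "\<lambda>i j. (- B j - - B i) / (real j - real i)"
      have D': "?D' i j = - ?D i j" for i j by (simp add: minus_divide_left)
      have "?D' b (Suc c) < ?D' a b"
      proof (rule key[of ?D' "\<lambda>i. - B i"])
        show "- B i \<le> q i" if "i \<le> Suc l" for i using q0[OF that] by (simp add: B_def)
      qed (use False b that in \<open>auto simp: B_def\<close>)
      then have "- ?D b (Suc c) < - ?D a b" unfolding D' .
      then have "avg \<alpha> a (b - 1) < avg \<alpha> b c" unfolding L R by (simp only: neg_less_iff_less)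
      then show ?thesis using False by simp
    qed
  qed
  then show ?thesis by blast
qed

text \<open>The levels of \<open>chi\<close> are single vertices, and \<open>eta\<close> is
  constantly 0, so that the second chain consists of one term.\<close>

lemma decreasing_means_equioriented:
  assumes "\<And>i. i \<in> {1..l} \<Longrightarrow> \<tau> i"
  shows "decreasing_means l \<tau> \<alpha> \<longleftrightarrow> (\<forall>i<l. \<alpha> i > \<alpha> (i + 1))"
    and "decreasing_means l (\<lambda>i. \<not> \<tau> i) (\<lambda>x. - \<alpha> x)"
proof -
  have chi: "chi \<tau> i = i" if "i \<le> l" for i using that assms by (induction i) auto
  then have "level l \<tau> k = {k}" if "k \<le> l" for k using that by (auto simp: level_def)
  then have "level_mean l \<tau> \<alpha> k = \<alpha> k" if "k \<le> l" for k using that by (simp add: level_mean_def)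
  then show "decreasing_means l \<tau> \<alpha> \<longleftrightarrow> (\<forall>i<l. \<alpha> i > \<alpha> (i + 1))"
    using chi[of l] by (simp add: decreasing_means_def)
  have "chi (\<lambda>i. \<not> \<tau> i) i = 0" if "i \<le> l" for i using that assms by (induction i) auto
  then show "decreasing_means l (\<lambda>i. \<not> \<tau> i) (\<lambda>x. - \<alpha> x)" by (simp add: decreasing_means_def)
qed

theorem mainTheorem2:
  fixes l :: nat and \<tau> :: "nat \<Rightarrow> bool"
  shows
    "{\<alpha>. complete_charge TYPE('f::field) (A_quiver l \<tau>) \<alpha>} \<noteq> {} \<and>
     {\<alpha>. complete_charge TYPE('f) (A_quiver l \<tau>) \<alpha>} =
       {\<alpha>. (\<forall>k<chi \<tau> l.
              slope (A_quiver l \<tau>) \<alpha> (level_rep l (chi \<tau>) k :: (nat, nat, 'f) qrep)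
              > slope (A_quiver l \<tau>) \<alpha> (level_rep l (chi \<tau>) (k + 1) :: (nat, nat, 'f) qrep)) \<and>
            (\<forall>k<eta \<tau> l.
              slope (A_quiver l \<tau>) \<alpha> (level_rep l (eta \<tau>) k :: (nat, nat, 'f) qrep)
              < slope (A_quiver l \<tau>) \<alpha> (level_rep l (eta \<tau>) (k + 1) :: (nat, nat, 'f) qrep))} \<and>
     ((\<forall>i\<in>{1..l}. \<tau> i) \<longrightarrow>
        (\<forall>\<alpha>. complete_charge TYPE('f) (A_quiver l \<tau>) \<alpha> \<longleftrightarrow> (\<forall>i<l. \<alpha> i > \<alpha> (i + 1))))"
proof (intro conjI impI allI)
  obtain \<alpha> where "\<forall>a c. a \<le> c \<longrightarrow> c \<le> l \<longrightarrow> stable_interval \<alpha> \<tau> a c" using ex_stable_charge by blast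
  then have "complete_charge TYPE('f) (A_quiver l \<tau>) \<alpha>" by (intro complete_of_stable_intervals) simp
  then show "{\<alpha>. complete_charge TYPE('f) (A_quiver l \<tau>) \<alpha>} \<noteq> {}" by blast
  show "{\<alpha>. complete_charge TYPE('f) (A_quiver l \<tau>) \<alpha>} =
       {\<alpha>. (\<forall>k<chi \<tau> l.
              slope (A_quiver l \<tau>) \<alpha> (level_rep l (chi \<tau>) k :: (nat, nat, 'f) qrep)
              > slope (A_quiver l \<tau>) \<alpha> (level_rep l (chi \<tau>) (k + 1) :: (nat, nat, 'f) qrep)) \<and>
            (\<forall>k<eta \<tau> l.
              slope (A_quiver l \<tau>) \<alpha> (level_rep l (eta \<tau>) k :: (nat, nat, 'f) qrep)
              < slope (A_quiver l \<tau>) \<alpha> (level_rep l (eta \<tau>) (k + 1) :: (nat, nat, 'f) qrep))}"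
    unfolding complete_charge_iff
      decreasing_means_iff_slopes[of l \<tau> _ \<tau>, where 'f = 'f]
      decreasing_means_uminus_iff_slopes[of l \<tau> _ \<tau>, where 'f = 'f] ..
next
  fix \<alpha> assume "\<forall>i\<in>{1..l}. \<tau> i"
  then show "complete_charge TYPE('f) (A_quiver l \<tau>) \<alpha> \<longleftrightarrow> (\<forall>i<l. \<alpha> i > \<alpha> (i + 1))"
    unfolding complete_charge_iff using decreasing_means_equioriented[of l \<tau> \<alpha>] by simp
qed

end
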